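(* Let $G$ be a countable, amenable group, let $\mathcal{A}$ be a finite alphabet, and let $X \subset \mathcal{A}^G$ be a subshift such that $P_X : C(\mathcal{A}^G)\to\mathbb{R}$ is a computable function. Then the function $C(\mathcal{A}^G) \to \mathbb{R}$ sending $\phi$ to its ground state energy $\sup_{\nu \in M_\sigma(X)} \int \phi \, d\nu$ is computable.
   Context: $F \Subset G$ means $F$ is a finite subset of $G$. A Følner sequence in $G$ is a sequence $F_1 \subsetneq F_2 \subsetneq \cdots$ of finite subsets with $\bigcup_n F_n = G$ and $\lim_{n} |KF_n \triangle F_n|/|F_n| = 0$ for every $K \Subset G$; a countable group is amenable if it admits a Følner sequence. $\mathcal{A}$ is finite and discrete, $\mathcal{A}^G$ has the product topology, and $(\sigma_g x)(h) = x(hg)$. A subshift is a nonempty closed set $X \subset \mathcal{A}^G$ invariant under all $\sigma_g$. $M_\sigma(X)$ is the set of $\sigma$-invariant Borel probability measures on $X$. For $F \Subset G$, $L_F(X) = \{x|_F : x \in X\}$; for $w \in \mathcal{A}^F$, $[w]=\{x : x|_F = w\}$. $C(\mathcal{A}^G)$ is the space of continuous real-valued functions with the uniform norm. For $\phi \in C(\mathcal{A}^G)$, $Z_F(\phi) = \sum_{w \in L_F(X)} \exp\left(\sup_{x \in [w]\cap X} \sum_{g \in F} \phi(\sigma_g x)\right)$ and $P_X(\phi) = \lim_{n} \frac{1}{|F_n|}\log Z_{F_n}(\phi)$ for a Følner sequence $(F_n)$ (the limit exists and is independent of the Følner sequence). Fix an enumeration of the elements of $G$ (used to name finite subsets of $G$).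 A function on $\mathcal{A}^G$ is locally constant if for some $E \Subset G$ its value at $x$ depends only on $x|_E$. Fix a computable enumeration $(s_n)$ of all rational-valued locally constant functions on $\mathcal{A}^G$, each given by a finite set $E \Subset G$ and a finite table $\mathcal{A}^E \to \mathbb{Q}$. An oracle for $\phi \in C(\mathcal{A}^G)$ is a function $\gamma : \mathbb{N} \to \mathbb{N}$ with $\|s_{\gamma(n)} - \phi\|_\infty < 2^{-n}$ for all $n$. A function $f : C(\mathcal{A}^G) \to \mathbb{R}$ is computable if there is a Turing machine $T$ such that for every $\phi$, every oracle $\gamma$ for $\phi$ and every $n \in \mathbb{N}$, $|T(\gamma,n) - f(\phi)| < 2^{-n}$. *)

theory Defs
  imports "HOL-Probability.Probability" "HOL-Library.Nat_Bijection"
begin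

section \<open>Amenability, subshifts and pressure\<close>

text \<open>
  The group is the type \<open>'g\<close>, written additively but not assumed commutative: the product
  \<open>g h\<close> is \<open>g + h\<close>.  The alphabet is the type \<open>'a\<close>, finite and discrete, so that \<open>'g \<Rightarrow> 'a\<close> is the
  full shift with the product topology.
\<close>

definition shift :: "'g::group_add \<Rightarrow> ('g \<Rightarrow> 'a) \<Rightarrow> ('g \<Rightarrow> 'a)" where
  "shift g x = (\<lambda>h. x (h + g))"

text \<open>
  The set \<open>K\<close> has to be nonempty in the limit condition: for \<open>K = {}\<close> the quotient is eventually 1.
  Since the inclusions are strict, a group with a Folner sequence is infinite.
\<close>

definition folner_sequence :: "(nat \<Rightarrow> 'g::group_add set) \<Rightarrow> bool" where
  "folner_sequence F \<longleftrightarrow>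
     (\<forall>n. finite (F n)) \<and> (\<forall>n. F n \<subset> F (Suc n)) \<and> (\<Union>n. F n) = UNIV \<and>
     (\<forall>K. finite K \<and> K \<noteq> {} \<longrightarrow>
        (\<lambda>n. real (card (sym_diff {k + f | k f. k \<in> K \<and> f \<in> F n} (F n))) / real (card (F n)))
          \<longlonglongrightarrow> 0)"

definition subshift :: "('g::group_add \<Rightarrow> 'a::{finite,discrete_topology}) set \<Rightarrow> bool" where
  "subshift X \<longleftrightarrow> X \<noteq> {} \<and> closed X \<and> (\<forall>g. shift g ` X \<subseteq> X)"

text \<open>A pattern on \<open>F\<close> is represented by its extension with the value \<open>undefined\<close> outside \<open>F\<close>.\<close>

definition language :: "('g \<Rightarrow> 'a) set \<Rightarrow> 'g set \<Rightarrow> ('g \<Rightarrow> 'a) set" where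
  "language X F = (\<lambda>x. restrict x F) ` X"

definition cylinder :: "'g set \<Rightarrow> ('g \<Rightarrow> 'a) \<Rightarrow> ('g \<Rightarrow> 'a) set" where
  "cylinder F w = {x. restrict x F = w}"

definition partition_function ::
  "('g::group_add \<Rightarrow> 'a) set \<Rightarrow> 'g set \<Rightarrow> (('g \<Rightarrow> 'a) \<Rightarrow> real) \<Rightarrow> real" where
  "partition_function X F \<phi> =
     (\<Sum>w\<in>language X F. exp (SUP x\<in>cylinder F w \<inter> X. \<Sum>g\<in>F. \<phi> (shift g x)))"

text \<open>
  The full shift is compact, so the bounded continuous functions are all the continuous ones, and
  the norm of \<open>\<Rightarrow>\<^sub>C\<close> is the uniform norm.
\<close>

definition pressure ::
  "(nat \<Rightarrow> 'g::group_add set) \<Rightarrow> ('g \<Rightarrow> 'a::{finite,discrete_topology}) set \<Rightarrow>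
    (('g \<Rightarrow> 'a) \<Rightarrow>\<^sub>C real) \<Rightarrow> real" where
  "pressure F X \<phi> =
     lim (\<lambda>n. ln (partition_function X (F n) (apply_bcontfun \<phi>)) / real (card (F n)))"

definition invariant_measures ::
  "('g::group_add \<Rightarrow> 'a::{finite,discrete_topology}) set \<Rightarrow> ('g \<Rightarrow> 'a) measure set" where
  "invariant_measures X =
     {\<nu>. prob_space \<nu> \<and> sets \<nu> = sets (restrict_space borel X) \<and>
         (\<forall>g. distr \<nu> \<nu> (shift g) = \<nu>)}"

definition ground_state_energy ::
  "('g::group_add \<Rightarrow> 'a::{finite,discrete_topology}) set \<Rightarrow> (('g \<Rightarrow> 'a) \<Rightarrow>\<^sub>C real) \<Rightarrow> real" where
  "ground_state_energy X \<phi> = (SUP \<nu>\<in>invariant_measures X. integral\<^sup>L \<nu> (apply_bcontfun \<phi>))"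


section \<open>Oracle Turing machines\<close>

text \<open>
  A two-way infinite tape is a pair of lists: the cells to the left of the head, nearest first, and
  the cells from the head rightwards.  Cells beyond the ends of the lists carry the blank 0.
  A number \<open>n\<close> is written in unary, as \<open>n\<close> symbols 1; the number on a tape is the length of the block
  of 1s starting at the head.
\<close>

type_synonym tape = "nat list \<times> nat list"

definition read_tape :: "tape \<Rightarrow> nat" where
  "read_tape t = (case snd t of [] \<Rightarrow> 0 | s # _ \<Rightarrow> s)"

definition tape_of_nat :: "nat \<Rightarrow> tape" where
  "tape_of_nat n = ([], replicate n 1)"

definition nat_of_tape :: "tape \<Rightarrow> nat" where
  "nat_of_tape t = length (takeWhile (\<lambda>s. s = 1) (snd t))"

datatype direction = Move_Left | Move_Right | Stay

fun act_tape :: "nat \<times> direction \<Rightarrow> tape \<Rightarrow> tape" where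
  "act_tape (s, Stay) (l, r) = (l, s # tl r)"
| "act_tape (s, Move_Right) (l, r) = (s # l, tl r)"
| "act_tape (s, Move_Left) (l, r) = (tl l, (case l of [] \<Rightarrow> 0 | u # _ \<Rightarrow> u) # s # tl r)"

text \<open>
  States and symbols are numbers below \<open>num_states\<close> and \<open>num_symbols\<close>.  Tape 0 is the input and
  output tape, tape 1 is the oracle tape.  State 0 is initial, state 1 is halting, state 2 is the
  query state: from it the machine passes to state 3, the number \<open>m\<close> on the oracle tape being
  replaced by \<open>\<gamma> m\<close>.  In all other states the machine acts by its transition function, which only
  matters on the finite set of arguments allowed in \<open>turing_machine\<close>.
\<close>

record otm =
  num_tapes :: nat
  num_states :: nat
  num_symbols :: nat
  transition :: "nat \<Rightarrow> nat list \<Rightarrow> nat \<times> (nat \<times> direction) list"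

definition turing_machine :: "otm \<Rightarrow> bool" where
  "turing_machine M \<longleftrightarrow>
     num_tapes M \<ge> 2 \<and> num_states M \<ge> 4 \<and> num_symbols M \<ge> 2 \<and>
     (\<forall>q < num_states M. \<forall>ss. length ss = num_tapes M \<and> (\<forall>s\<in>set ss. s < num_symbols M) \<longrightarrow>
        (case transition M q ss of (q', as) \<Rightarrow>
           q' < num_states M \<and> length as = num_tapes M \<and> (\<forall>(s, d)\<in>set as. s < num_symbols M)))"

definition otm_step :: "(nat \<Rightarrow> nat) \<Rightarrow> otm \<Rightarrow> nat \<times> tape list \<Rightarrow> nat \<times> tape list" where
  "otm_step \<gamma> M = (\<lambda>(q, ts).
     if q = 1 then (q, ts)
     else if q = 2 then (3, ts[1 := tape_of_nat (\<gamma> (nat_of_tape (ts ! 1)))])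
     else (case transition M q (map read_tape ts) of (q', as) \<Rightarrow> (q', map2 act_tape as ts)))"

definition otm_init :: "otm \<Rightarrow> nat \<Rightarrow> nat \<times> tape list" where
  "otm_init M n = (0, (replicate (num_tapes M) ([], []))[0 := tape_of_nat n])"

definition otm_outputs :: "otm \<Rightarrow> (nat \<Rightarrow> nat) \<Rightarrow> nat \<Rightarrow> nat \<Rightarrow> bool" where
  "otm_outputs M \<gamma> n m \<longleftrightarrow>
     (\<exists>k ts. (otm_step \<gamma> M ^^ k) (otm_init M n) = (1, ts) \<and> nat_of_tape (ts ! 0) = m)"

text \<open>A computable function on \<open>nat\<close> is one that a machine computes whatever its oracle is.\<close>

definition computable_nat_fun :: "(nat \<Rightarrow> nat) \<Rightarrow> bool" where
  "computable_nat_fun c \<longleftrightarrow>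
     (\<exists>M. turing_machine M \<and> (\<forall>\<gamma> n. otm_outputs M \<gamma> n (c n)))"


section \<open>Computable functions on the space of continuous functions\<close>

text \<open>The rational number (as a real) with a given code; every rational has a code.\<close>

definition rat_of_code :: "nat \<Rightarrow> real" where
  "rat_of_code m = (case prod_decode m of (i, j) \<Rightarrow> of_int (int_decode i) / real (Suc j))"

definition locally_constant :: "(('g \<Rightarrow> 'a) \<Rightarrow> real) \<Rightarrow> bool" where
  "locally_constant f \<longleftrightarrow>
     (\<exists>E. finite E \<and> (\<forall>x y. (\<forall>g\<in>E. x g = y g) \<longrightarrow> f x = f y))"

text \<open>
  Let \<open>e\<close> enumerate the group and let \<open>a\<close> number the letters of the alphabet by \<open>0, \<dots>, CARD('a) - 1\<close>.
  A code \<open>c\<close> describes a finite set \<open>E = {e i\<^sub>1, \<dots>, e i\<^sub>k}\<close> through the list \<open>[i\<^sub>1, \<dots>, i\<^sub>k]\<close>, together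
  with a table that lists the rational values of all patterns on \<open>E\<close>.  The pattern of \<open>x\<close> has
  position \<open>a (x (e i\<^sub>1)) + CARD('a) * a (x (e i\<^sub>2)) + \<dots>\<close> in the table.
\<close>

definition table_code ::
  "(nat \<Rightarrow> 'g) \<Rightarrow> ('a::finite \<Rightarrow> nat) \<Rightarrow> nat \<Rightarrow> (('g \<Rightarrow> 'a) \<Rightarrow> real) \<Rightarrow> bool" where
  "table_code e a c f \<longleftrightarrow>
     (let ns = list_decode (fst (prod_decode c)); qs = list_decode (snd (prod_decode c)) in
        distinct ns \<and> length qs = CARD('a) ^ length ns \<and>
        (\<forall>x. f x = rat_of_code (qs ! horner_sum (\<lambda>i. a (x (e i))) CARD('a) ns)))"

definition computable_enumeration ::
  "(nat \<Rightarrow> 'g) \<Rightarrow> ('a::{finite,discrete_topology} \<Rightarrow> nat) \<Rightarrow>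
    (nat \<Rightarrow> (('g \<Rightarrow> 'a) \<Rightarrow>\<^sub>C real)) \<Rightarrow> bool" where
  "computable_enumeration e a s \<longleftrightarrow>
     range s = {f. locally_constant (apply_bcontfun f) \<and> (\<forall>x. apply_bcontfun f x \<in> \<rat>)} \<and>
     (\<exists>c. computable_nat_fun c \<and> (\<forall>n. table_code e a (c n) (apply_bcontfun (s n))))"

definition oracle_for ::
  "(nat \<Rightarrow> (('g \<Rightarrow> 'a::topological_space) \<Rightarrow>\<^sub>C real)) \<Rightarrow>
    (('g \<Rightarrow> 'a) \<Rightarrow>\<^sub>C real) \<Rightarrow> (nat \<Rightarrow> nat) \<Rightarrow> bool" where
  "oracle_for s \<phi> \<gamma> \<longleftrightarrow> (\<forall>n. norm (s (\<gamma> n) - \<phi>) < 1 / 2 ^ n)"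

text \<open>The output of the machine is a natural number, read as the code of a rational.\<close>

definition computable_functional ::
  "(nat \<Rightarrow> (('g \<Rightarrow> 'a::topological_space) \<Rightarrow>\<^sub>C real)) \<Rightarrow>
    ((('g \<Rightarrow> 'a) \<Rightarrow>\<^sub>C real) \<Rightarrow> real) \<Rightarrow> bool" where
  "computable_functional s f \<longleftrightarrow>
     (\<exists>M. turing_machine M \<and>
        (\<forall>\<phi> \<gamma>. oracle_for s \<phi> \<gamma> \<longrightarrow>
           (\<forall>n. \<exists>m. otm_outputs M \<gamma> n m \<and> \<bar>rat_of_code m - f \<phi>\<bar> < 1 / 2 ^ n)))"

end

theory Submission
  imports Defs
begin

text \<open>
  Write \<open>g \<phi>\<close> for the ground state energy and \<open>P\<close> for the pressure.  At inverse temperature \<open>\<beta>\<close> the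
  pressure \<open>P (\<beta> \<phi>)\<close> differs from \<open>\<beta> g \<phi>\<close> by an entropy between \<open>0\<close> and the logarithm of the
  number of letters, so \<open>P (\<beta> \<phi>) / \<beta>\<close> converges to \<open>g \<phi>\<close> at a known rate.  To approximate \<open>g \<phi>\<close>,
  it suffices to run the machine for \<open>P\<close> once, on \<open>\<beta> \<phi>\<close> for a large power \<open>\<beta>\<close> of 2.

  The analytic half is the estimate \<open>\<bar>P (\<beta> \<phi>) / \<beta> - g \<phi>\<bar> \<le> ln CARD('a) / \<beta>\<close>, proved in
  \<open>ground_state_energy_pressure\<close> without the variational principle.  Both bounds
  compare the partition function with the maximum over \<open>X\<close> of the ergodic sum on \<open>F n\<close>.  An invariant
  measure integrates an ergodic sum to \<open>card (F n)\<close> times the integral of \<open>\<phi>\<close>, which gives the lower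
  bound.  For the upper bound, the empirical measures along \<open>F n\<close> of points that maximize the ergodic
  sums accumulate at an invariant measure whose integral realizes the limiting maximal average
  (\<open>empirical_measures_accumulate\<close>).  Since the pressure is defined by \<open>lim\<close>, neither bound says
  anything before the limit is known to exist.  This is \<open>convergent_pressure\<close>: the logarithm of the
  partition function satisfies a Shearer type inequality (\<open>partition_function_cover\<close>), a consequence
  of Finner's generalization of the Hoelder and Loomis-Whitney inequalities, and covering \<open>F n\<close>
  uniformly by translates of a fixed window \<open>K\<close> bounds the upper limit by the value at \<open>K\<close>.

  The other half is programming.  The machine for \<open>P\<close> must be given an oracle for \<open>\<beta> \<phi>\<close>, that is,
  indices in the enumeration \<open>s\<close> of the functions \<open>2 ^ j * s (\<gamma> m)\<close>; such an index is found by
  unbounded search, deciding equality of two locally constant functions by comparing their tables on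
  all patterns.  To avoid writing this as a Turing machine, a class of functionals is introduced that
  consists of what register programs compute, it is shown to be closed under recursion and search,
  every functional in it is computed by an oracle Turing machine (\<open>computable_rel_turing_machine\<close>),
  and conversely the run of a given machine, with its oracle replaced by a computed function, is
  in the class (\<open>computable_rel_otm_outputs\<close>).
\<close>

section \<open>Products of functions of overlapping coordinates\<close>
text \<open>
  Divide each \<open>u i\<close> by its norm with exponent \<open>card I\<close>; for normalized functions the inequality is
  the pointwise inequality of arithmetic and geometric means, summed over \<open>A\<close>.
\<close>
lemma Hoelder_prod_sum:
  fixes u :: "'i \<Rightarrow> 'b \<Rightarrow> real"
  assumes "finite I" "I \<noteq> {}" "finite A" and u: "\<And>i a. i \<in> I \<Longrightarrow> a \<in> A \<Longrightarrow> 0 \<le> u i a"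
  shows "(\<Sum>a\<in>A. \<Prod>i\<in>I. u i a) \<le> (\<Prod>i\<in>I. root (card I) (\<Sum>a\<in>A. u i a ^ card I))"
proof -
  define k where "k = card I"
  have k: "0 < k" using assms by (simp add: k_def card_gt_0_iff)
  define T where "T i = (\<Sum>a\<in>A. u i a ^ k)" for i
  have T0: "0 \<le> T i" if "i \<in> I" for i
    unfolding T_def using u that by (intro sum_nonneg zero_le_power) auto
  show ?thesis
  proof (cases "\<exists>i\<in>I. T i = 0")
    case True
    then obtain i where i: "i \<in> I" "T i = 0" by blast
    have "u i a = 0" if "a \<in> A" for a
      using i u that k \<open>finite A\<close> unfolding T_def
      by (subst (asm) sum_nonneg_eq_0_iff) auto
    then have "(\<Sum>a\<in>A. \<Prod>i\<in>I. u i a) = 0"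
      using i \<open>finite I\<close> by (intro sum.neutral ballI prod_zero) auto
    moreover have "0 \<le> (\<Prod>i\<in>I. root (card I) (\<Sum>a\<in>A. u i a ^ card I))"
      using T0 by (intro prod_nonneg) (auto simp: T_def k_def intro: real_root_pos_pos_le)
    ultimately show ?thesis by simp
  next
    case False
    then have T: "0 < T i" if "i \<in> I" for i using T0 that by (metis less_eq_real_def)
    have "(\<Prod>i\<in>I. u i a / root k (T i)) \<le> (\<Sum>i\<in>I. u i a ^ k / T i / k)" if a: "a \<in> A" for a
    proof -
      have nn: "0 \<le> u i a ^ k / T i" if "i \<in> I" for i
        using T[OF that] u[OF that a] by simp
      have "(\<Prod>i\<in>I. u i a / root k (T i)) = root k (\<Prod>i\<in>I. u i a ^ k / T i)"
      proof -
        have "(\<Prod>i\<in>I. u i a ^ k / T i) = (\<Prod>i\<in>I. u i a / root k (T i)) ^ k"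
          unfolding prod_power_distrib
          using k by (intro prod.cong refl) (simp add: power_divide T0)
        moreover have "0 \<le> (\<Prod>i\<in>I. u i a / root k (T i))"
          using T0 u a k by (intro prod_nonneg) auto
        ultimately show ?thesis using k by (simp add: real_root_power_cancel)
      qed
      also have "\<dots> = (\<Prod>i\<in>I. u i a ^ k / T i) powr (1 / k)"
        using nn k by (intro root_powr_inverse prod_nonneg) auto
      also have "\<dots> \<le> (\<Sum>i\<in>I. u i a ^ k / T i / k)"
        unfolding k_def using assms(1,2) nn[unfolded k_def] by (intro arith_geom_mean) auto
      finally show ?thesis .
    qed
    then have "(\<Sum>a\<in>A. \<Prod>i\<in>I. u i a / root k (T i)) \<le> (\<Sum>a\<in>A. \<Sum>i\<in>I. u i a ^ k / T i / k)"
      by (rule sum_mono)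
    also have "\<dots> = (\<Sum>i\<in>I. \<Sum>a\<in>A. u i a ^ k / T i / k)" by (rule sum.swap)
    also have "\<dots> = (\<Sum>i\<in>I. T i / T i / k)"
      by (simp only: sum_divide_distrib[symmetric] T_def[symmetric])
    also have "\<dots> = 1" using T k False by (simp add: k_def)
    finally have "(\<Sum>a\<in>A. \<Prod>i\<in>I. u i a) / (\<Prod>i\<in>I. root k (T i)) \<le> 1"
      by (simp add: prod_dividef sum_divide_distrib)
    moreover have "0 < (\<Prod>i\<in>I. root k (T i))" using T k by (intro prod_pos) auto
    ultimately have "(\<Sum>a\<in>A. \<Prod>i\<in>I. u i a) \<le> (\<Prod>i\<in>I. root k (T i))" by (simp add: divide_le_eq)
    then show ?thesis by (simp add: T_def k_def)
  qed
qed

lemma sum_PiE_insert: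
  assumes "finite S" "x \<notin> S"
  shows "(\<Sum>w\<in>PiE (insert x S) (\<lambda>_. UNIV). G w) =
    (\<Sum>w\<in>PiE S (\<lambda>_. UNIV :: 'a::finite set). \<Sum>a\<in>UNIV. G (w(x := a)))"
proof -
  have "(\<Sum>w\<in>PiE (insert x S) (\<lambda>_. UNIV). G w) =
     (\<Sum>z\<in>UNIV \<times> PiE S (\<lambda>_. UNIV). G ((\<lambda>(y, g). g(x := y)) z))"
    unfolding PiE_insert_eq by (rule sum.reindex[unfolded o_def]) (rule inj_combinator[OF assms(2)])
  also have "\<dots> = (\<Sum>a\<in>UNIV. \<Sum>w\<in>PiE S (\<lambda>_. UNIV). G (w(x := a)))"
    by (simp add: sum.cartesian_product case_prod_unfold)
  finally show ?thesis by (subst sum.swap)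
qed

text \<open>
  The coordinates are summed out one at a time.  Only the \<open>k\<close> factors whose window contains the
  coordinate \<open>h\<close> depend on it, and Hoelder's inequality with exponent \<open>k\<close> replaces each of them by
  its norm in that coordinate, which is a function on the smaller window.
\<close>
theorem Finner_inequality:
  fixes f :: "'i \<Rightarrow> ('g \<Rightarrow> 'a::finite) \<Rightarrow> real"
  assumes "finite F" "finite I" "0 < k"
    and "\<And>i. i \<in> I \<Longrightarrow> B i \<subseteq> F"
    and "\<And>h. h \<in> F \<Longrightarrow> card {i \<in> I. h \<in> B i} = k"
    and "\<And>i v. i \<in> I \<Longrightarrow> 0 \<le> f i v"
  shows "(\<Sum>w\<in>PiE F (\<lambda>_. UNIV). \<Prod>i\<in>I. f i (restrict w (B i))) \<le>
    (\<Prod>i\<in>I. root k (\<Sum>v\<in>PiE (B i) (\<lambda>_. UNIV). f i v ^ k))"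
  using assms(1,4-6)
proof (induction F arbitrary: B f rule: finite_induct)
  case empty
  then have B: "B i = {}" if "i \<in> I" for i using that by auto
  have "(\<Prod>i\<in>I. root k (\<Sum>v\<in>PiE (B i) (\<lambda>_. UNIV). f i v ^ k)) = (\<Prod>i\<in>I. f i (\<lambda>_. undefined))"
    using empty B \<open>0 < k\<close> by (intro prod.cong) (auto simp: real_root_power_cancel)
  moreover have "(\<Prod>i\<in>I. f i (restrict w (B i))) = (\<Prod>i\<in>I. f i (\<lambda>_. undefined))" for w
    using B by (intro prod.cong) (auto simp: restrict_def)
  ultimately show ?case by simp
next
  case (insert h F)
  define J where "J = {i \<in> I. h \<in> B i}"
  define B' where "B' i = B i - {h}" for i
  define f' where "f' i v = (if i \<in> J then root k (\<Sum>a\<in>UNIV. f i (v(h := a)) ^ k) else f i v)" for i v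
  have J: "J \<subseteq> I" "finite J" "card J = k" using insert.prems(2)[of h] \<open>finite I\<close> by (auto simp: J_def)
  then have "J \<noteq> {}" using \<open>0 < k\<close> by auto
  have restr: "restrict (w(h := a)) (B i) = (if i \<in> J then (restrict w (B' i))(h := a) else restrict w (B' i))"
    if "i \<in> I" for w a i
    using that by (auto simp: J_def B'_def restrict_def fun_eq_iff)
  have "(\<Sum>w\<in>PiE (insert h F) (\<lambda>_. UNIV). \<Prod>i\<in>I. f i (restrict w (B i)))
    = (\<Sum>w\<in>PiE F (\<lambda>_. UNIV). \<Sum>a\<in>UNIV. \<Prod>i\<in>I. f i (restrict (w(h := a)) (B i)))"
    using insert.hyps by (rule sum_PiE_insert)
  also have "\<dots> \<le> (\<Sum>w\<in>PiE F (\<lambda>_. UNIV). \<Prod>i\<in>I. f' i (restrict w (B' i)))"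
  proof (rule sum_mono)
    fix w
    let ?P = "\<Prod>i\<in>I - J. f i (restrict w (B' i))"
    have split: "(\<Prod>i\<in>I. g i) = (\<Prod>i\<in>I - J. g i) * (\<Prod>i\<in>J. g i)" for g :: "'i \<Rightarrow> real"
      using prod.subset_diff[OF J(1) \<open>finite I\<close>] .
    have "(\<Sum>a\<in>UNIV. \<Prod>i\<in>I. f i (restrict (w(h := a)) (B i)))
      = (\<Sum>a\<in>UNIV. ?P * (\<Prod>i\<in>J. f i ((restrict w (B' i))(h := a))))"
    proof (rule sum.cong[OF refl])
      fix a
      have "(\<Prod>i\<in>I - J. f i (restrict (w(h := a)) (B i))) = ?P"
        by (rule prod.cong) (auto simp: restr)
      moreover have "(\<Prod>i\<in>J. f i (restrict (w(h := a)) (B i))) = (\<Prod>i\<in>J. f i ((restrict w (B' i))(h := a)))"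
        by (rule prod.cong) (use J(1) in \<open>auto simp: restr\<close>)
      ultimately show "(\<Prod>i\<in>I. f i (restrict (w(h := a)) (B i))) = ?P * (\<Prod>i\<in>J. f i ((restrict w (B' i))(h := a)))"
        by (simp add: split)
    qed
    also have "\<dots> = ?P * (\<Sum>a\<in>UNIV. \<Prod>i\<in>J. f i ((restrict w (B' i))(h := a)))"
      by (simp add: sum_distrib_left)
    also have "\<dots> \<le> ?P * (\<Prod>i\<in>J. root k (\<Sum>a\<in>UNIV. f i ((restrict w (B' i))(h := a)) ^ k))"
      using Hoelder_prod_sum[OF J(2) \<open>J \<noteq> {}\<close>, of UNIV "\<lambda>i a. f i ((restrict w (B' i))(h := a))"]
        insert.prems(3) J
      by (intro mult_left_mono prod_nonneg) (auto simp: subset_eq)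
    also have "\<dots> = (\<Prod>i\<in>I. f' i (restrict w (B' i)))"
      unfolding split by (simp add: f'_def)
    finally show "(\<Sum>a\<in>UNIV. \<Prod>i\<in>I. f i (restrict (w(h := a)) (B i))) \<le> (\<Prod>i\<in>I. f' i (restrict w (B' i)))" .
  qed
  also have "\<dots> \<le> (\<Prod>i\<in>I. root k (\<Sum>v\<in>PiE (B' i) (\<lambda>_. UNIV). f' i v ^ k))"
  proof (rule insert.IH)
    show "B' i \<subseteq> F" if "i \<in> I" for i using insert.prems(1)[OF that] by (auto simp: B'_def)
    show "card {i \<in> I. g \<in> B' i} = k" if "g \<in> F" for g
    proof -
      have "g \<noteq> h" using that insert.hyps by auto
      then have "{i \<in> I. g \<in> B' i} = {i \<in> I. g \<in> B i}" by (auto simp: B'_def)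
      then show ?thesis using insert.prems(2)[of g] that by simp
    qed
    show "0 \<le> f' i v" if "i \<in> I" for i v
      using insert.prems(3)[OF that] by (auto simp: f'_def intro!: real_root_pos_pos_le sum_nonneg)
  qed
  also have "\<dots> = (\<Prod>i\<in>I. root k (\<Sum>v\<in>PiE (B i) (\<lambda>_. UNIV). f i v ^ k))"
  proof (rule prod.cong[OF refl])
    fix i assume i: "i \<in> I"
    have fin: "finite (B' i)"
      using insert.prems(1)[OF i] insert.hyps(1) finite_subset[of "B' i" F] by (auto simp: B'_def)
    show "root k (\<Sum>v\<in>PiE (B' i) (\<lambda>_. UNIV). f' i v ^ k) = root k (\<Sum>v\<in>PiE (B i) (\<lambda>_. UNIV). f i v ^ k)"
    proof (cases "i \<in> J")
      case True
      then have "B i = insert h (B' i)" "h \<notin> B' i" by (auto simp: J_def B'_def)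
      then have "(\<Sum>v\<in>PiE (B i) (\<lambda>_. UNIV). f i v ^ k) =
          (\<Sum>v\<in>PiE (B' i) (\<lambda>_. UNIV). \<Sum>a\<in>UNIV. f i (v(h := a)) ^ k)"
        using sum_PiE_insert[OF fin \<open>h \<notin> B' i\<close>, of "\<lambda>v. f i v ^ k"] by (simp only:)
      also have "\<dots> = (\<Sum>v\<in>PiE (B' i) (\<lambda>_. UNIV). f' i v ^ k)"
        using True \<open>0 < k\<close> insert.prems(3)[OF i]
        by (intro sum.cong) (auto simp: f'_def intro!: real_root_pow_pos2[symmetric] sum_nonneg)
      finally show ?thesis by simp
    next
      case False
      then have "B' i = B i" using i by (auto simp: J_def B'_def)
      then show ?thesis using False by (simp add: f'_def)
    qed
  qed
  finally show ?case .
qed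

section \<open>Partition functions\<close>

definition ergodic_sum :: "(('g::group_add \<Rightarrow> 'a) \<Rightarrow> real) \<Rightarrow> 'g set \<Rightarrow> ('g \<Rightarrow> 'a) \<Rightarrow> real" where
  "ergodic_sum \<phi> F x = (\<Sum>g\<in>F. \<phi> (shift g x))"

lemma shift_shift: "shift g (shift h x) = shift (g + h) x"
  by (simp add: shift_def fun_eq_iff add.assoc)

text \<open>
  The exponent that the pattern \<open>w\<close> contributes to the partition function.
\<close>
definition max_pressure :: "('g::group_add \<Rightarrow> 'a) set \<Rightarrow> (('g \<Rightarrow> 'a) \<Rightarrow> real) \<Rightarrow> 'g set \<Rightarrow> ('g \<Rightarrow> 'a) \<Rightarrow> real" where
  "max_pressure X \<phi> F w = (SUP x\<in>cylinder F w \<inter> X. ergodic_sum \<phi> F x)"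

lemma partition_function_eq:
  "partition_function X F \<phi> = (\<Sum>w\<in>language X F. exp (max_pressure X \<phi> F w))"
  by (simp add: partition_function_def max_pressure_def ergodic_sum_def)

lemma language_subset: "language X F \<subseteq> PiE F (\<lambda>_. UNIV)"
  by (auto simp: language_def)

lemma finite_language: "finite F \<Longrightarrow> finite (language X F :: ('g \<Rightarrow> 'a::finite) set)"
  by (rule finite_subset[OF language_subset finite_PiE]) auto

lemma card_language:
  assumes "finite F" shows "card (language X F :: ('g \<Rightarrow> 'a::finite) set) \<le> CARD('a) ^ card F"
proof -
  have "card (language X F) \<le> card (PiE F (\<lambda>_. UNIV :: 'a set))"
    using assms by (intro card_mono language_subset finite_PiE) auto
  then show ?thesis using assms by (simp add: card_PiE)
qed

lemma cylinder_language: "w \<in> language X F \<Longrightarrow> cylinder F w \<inter> X \<noteq> {}"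
  by (auto simp: language_def cylinder_def)

lemma abs_ergodic_sum_le:
  assumes "\<And>x. \<bar>\<phi> x\<bar> \<le> B"
  shows "\<bar>ergodic_sum \<phi> F x\<bar> \<le> real (card F) * B"
proof -
  have "\<bar>ergodic_sum \<phi> F x\<bar> \<le> (\<Sum>g\<in>F. \<bar>\<phi> (shift g x)\<bar>)"
    unfolding ergodic_sum_def by (rule sum_abs)
  also have "\<dots> \<le> (\<Sum>g\<in>F. B)" using assms by (intro sum_mono)
  finally show ?thesis by simp
qed

lemma bdd_above_ergodic_sum:
  assumes "\<And>x. \<bar>\<phi> x\<bar> \<le> (B::real)"
  shows "bdd_above (ergodic_sum \<phi> F ` S)"
proof (rule bdd_aboveI2)
  fix x show "ergodic_sum \<phi> F x \<le> real (card F) * B"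
    using abs_ergodic_sum_le[of \<phi> B F x, OF assms] by linarith
qed

lemma ergodic_sum_le_max_pressure:
  assumes "\<And>x. \<bar>\<phi> x\<bar> \<le> B" "x \<in> X"
  shows "ergodic_sum \<phi> F x \<le> max_pressure X \<phi> F (restrict x F)"
  unfolding max_pressure_def
  by (rule cSUP_upper[OF _ bdd_above_ergodic_sum[of \<phi> B, OF assms(1)]]) (use assms in \<open>auto simp: cylinder_def\<close>)

lemma max_pressure_le:
  assumes "w \<in> language X F" "\<And>x. x \<in> X \<Longrightarrow> restrict x F = w \<Longrightarrow> ergodic_sum \<phi> F x \<le> M"
  shows "max_pressure X \<phi> F w \<le> M"
  unfolding max_pressure_def using cylinder_language[OF assms(1)] assms(2)
  by (intro cSUP_least) (auto simp: cylinder_def)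

lemma partition_function_le:
  fixes X :: "('g::group_add \<Rightarrow> 'a::finite) set"
  assumes "finite F" "\<And>x. x \<in> X \<Longrightarrow> ergodic_sum \<phi> F x \<le> M"
  shows "partition_function X F \<phi> \<le> real CARD('a) ^ card F * exp M"
proof -
  have "partition_function X F \<phi> \<le> (\<Sum>w\<in>language X F. exp M)"
    unfolding partition_function_eq using assms by (intro sum_mono) (auto intro!: max_pressure_le)
  also have "\<dots> = real (card (language X F)) * exp M" by simp
  also have "\<dots> \<le> real (CARD('a) ^ card F) * exp M"
    using card_language[OF assms(1), of X] by (intro mult_right_mono) (simp_all only: of_nat_le_iff, auto)
  finally show ?thesis by simp
qed

lemma exp_ergodic_sum_le:
  fixes X :: "('g::group_add \<Rightarrow> 'a::finite) set"
  assumes "\<And>x. \<bar>\<phi> x\<bar> \<le> B" "finite F" "x \<in> X"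
  shows "exp (ergodic_sum \<phi> F x) \<le> partition_function X F \<phi>"
proof -
  have "restrict x F \<in> language X F"
    unfolding language_def using assms(3) by (rule imageI)
  have "exp (ergodic_sum \<phi> F x) \<le> exp (max_pressure X \<phi> F (restrict x F))"
    using ergodic_sum_le_max_pressure[of \<phi> B, OF assms(1,3)] by simp
  also have "exp (max_pressure X \<phi> F (restrict x F)) \<le> partition_function X F \<phi>"
    unfolding partition_function_eq
    using \<open>restrict x F \<in> language X F\<close> member_le_sum[of "restrict x F" "language X F" "\<lambda>w. exp (max_pressure X \<phi> F w)"]
      finite_language[OF assms(2), of X] by simp
  finally show ?thesis .
qed

lemma partition_function_pos:
  fixes X :: "('g::group_add \<Rightarrow> 'a::finite) set"
  assumes "X \<noteq> {}" "finite F"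
  shows "0 < partition_function X F \<phi>"
  unfolding partition_function_eq using assms
  by (intro sum_pos finite_language) (auto simp: language_def)

lemma ln_partition_function_le:
  fixes X :: "('g::group_add \<Rightarrow> 'a::finite) set"
  assumes "finite F" "X \<noteq> {}" "\<And>x. x \<in> X \<Longrightarrow> ergodic_sum \<phi> F x \<le> M"
  shows "ln (partition_function X F \<phi>) \<le> real (card F) * ln CARD('a) + M"
proof -
  have "ln (partition_function X F \<phi>) \<le> ln (real CARD('a) ^ card F * exp M)"
    using partition_function_le[OF assms(1,3)] partition_function_pos[OF assms(2,1), of \<phi>]
    by (intro ln_mono) auto
  then show ?thesis by (simp add: ln_mult ln_realpow)
qed

lemma le_ln_partition_function:
  fixes X :: "('g::group_add \<Rightarrow> 'a::finite) set"
  assumes "\<And>x. \<bar>\<phi> x\<bar> \<le> B" "finite F" "x \<in> X"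
  shows "ergodic_sum \<phi> F x \<le> ln (partition_function X F \<phi>)"
  using exp_ergodic_sum_le[of \<phi> B, OF assms] partition_function_pos[of X F \<phi>] assms(2,3)
  by (subst ln_ge_iff) auto

text \<open>
  The ergodic sum over the right translate \<open>K + g\<close> at \<open>x\<close> is the ergodic sum over \<open>K\<close> at \<open>shift g x\<close>,
  and the shift carries the patterns of \<open>X\<close> on \<open>K + g\<close> injectively to patterns on \<open>K\<close>.
\<close>
lemma partition_function_translate_le:
  fixes X :: "('g::group_add \<Rightarrow> 'a::finite) set"
  assumes \<phi>: "\<And>x. \<bar>\<phi> x\<bar> \<le> B" and K: "finite K" and X: "\<And>g. shift g ` X \<subseteq> X"
  shows "partition_function X ((\<lambda>k. k + g) ` K) \<phi> \<le> partition_function X K \<phi>"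
proof -
  let ?K = "(\<lambda>k. k + g) ` K"
  let ?T = "\<lambda>v. restrict (shift g v) K"
  have T: "?T (restrict x ?K) = restrict (shift g x) K" for x :: "'g \<Rightarrow> 'a"
    by (auto simp: restrict_def shift_def fun_eq_iff)
  have sum: "ergodic_sum \<phi> ?K x = ergodic_sum \<phi> K (shift g x)" for x
    unfolding ergodic_sum_def by (subst sum.reindex) (auto simp: inj_on_def shift_shift)
  have inj: "inj_on ?T (language X ?K)"
  proof (rule inj_onI)
    fix v w assume vw: "v \<in> language X ?K" "w \<in> language X ?K" "?T v = ?T w"
    have "v h = w h" if "h \<in> ?K" for h
    proof -
      obtain k where "k \<in> K" "h = k + g" using \<open>h \<in> ?K\<close> by blast
      then show ?thesis using fun_cong[OF vw(3), of k] by (simp add: shift_def)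
    qed
    moreover have "v \<in> extensional ?K" "w \<in> extensional ?K"
      using vw(1,2) by (auto simp: language_def)
    ultimately show "v = w" using extensionalityI by blast
  qed
  have "partition_function X ?K \<phi> \<le> (\<Sum>v\<in>language X ?K. exp (max_pressure X \<phi> K (?T v)))"
    unfolding partition_function_eq
  proof (rule sum_mono)
    fix v assume v: "v \<in> language X ?K"
    have "max_pressure X \<phi> ?K v \<le> max_pressure X \<phi> K (?T v)"
    proof (rule max_pressure_le[OF v])
      fix x assume x: "x \<in> X" "restrict x ?K = v"
      then have "shift g x \<in> X" using X by blast
      from ergodic_sum_le_max_pressure[of \<phi> B, OF \<phi> this, of K]
      show "ergodic_sum \<phi> ?K x \<le> max_pressure X \<phi> K (?T v)"
        unfolding sum x(2)[symmetric] T .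
    qed
    then show "exp (max_pressure X \<phi> ?K v) \<le> exp (max_pressure X \<phi> K (?T v))" by simp
  qed
  also have "\<dots> = (\<Sum>v\<in>?T ` language X ?K. exp (max_pressure X \<phi> K v))"
    by (simp add: sum.reindex[OF inj])
  also have "\<dots> \<le> partition_function X K \<phi>"
    unfolding partition_function_eq
  proof (rule sum_mono2[OF finite_language[OF K]])
    show "?T ` language X ?K \<subseteq> language X K"
    proof
      fix u assume "u \<in> ?T ` language X ?K"
      then obtain x where x: "x \<in> X" "u = ?T (restrict x ?K)" unfolding language_def by blast
      then have "shift g x \<in> X" using X by blast
      then show "u \<in> language X K" unfolding x(2) T language_def by (rule imageI)
    qed
  qed simp
  finally show ?thesis .
qed

text \<open>
  Shearer's inequality for pressure.  Since every point of \<open>F\<close> lies in exactly \<open>k\<close> of the windows, an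
  ergodic sum over \<open>F\<close> is the mean, with weights \<open>1 / k\<close>, of the sums over the windows.  So the weight
  of a pattern on \<open>F\<close> is at most a product of functions of its restrictions to the windows, and
  Finner's inequality applies.
\<close>
theorem partition_function_cover:
  fixes X :: "('g::group_add \<Rightarrow> 'a::finite) set"
  assumes \<phi>: "\<And>x. \<bar>\<phi> x\<bar> \<le> C" and F: "finite F" and I: "finite I" and k: "0 < k" and X: "X \<noteq> {}"
    and B: "\<And>i. i \<in> I \<Longrightarrow> B i \<subseteq> F"
    and cover: "\<And>h. h \<in> F \<Longrightarrow> card {i \<in> I. h \<in> B i} = k"
  shows "real k * ln (partition_function X F \<phi>) \<le> (\<Sum>i\<in>I. ln (partition_function X (B i) \<phi>))"
proof -
  define f where "f i v = (if v \<in> language X (B i) then exp (max_pressure X \<phi> (B i) v / k) else 0)" for i v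
  have fin: "finite (B i)" if "i \<in> I" for i using B[OF that] F finite_subset by blast
  have lang: "restrict w (B i) \<in> language X (B i)" if "w \<in> language X F" "i \<in> I" for w i
  proof -
    obtain x where "x \<in> X" "w = restrict x F" using \<open>w \<in> language X F\<close> by (auto simp: language_def)
    then have "restrict w (B i) = restrict x (B i)" using B[OF \<open>i \<in> I\<close>] by (simp add: inf.absorb2)
    then show ?thesis using \<open>x \<in> X\<close> by (simp add: language_def)
  qed
  have "partition_function X F \<phi> \<le> (\<Sum>w\<in>language X F. \<Prod>i\<in>I. f i (restrict w (B i)))"
    unfolding partition_function_eq
  proof (rule sum_mono)
    fix w assume w: "w \<in> language X F"
    have "max_pressure X \<phi> F w \<le> (\<Sum>i\<in>I. max_pressure X \<phi> (B i) (restrict w (B i)) / k)"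
    proof (rule max_pressure_le[OF w])
      fix x assume x: "x \<in> X" "restrict x F = w"
      have "real k * ergodic_sum \<phi> F x = (\<Sum>h\<in>F. \<Sum>i\<in>{i \<in> I. h \<in> B i}. \<phi> (shift h x))"
        using cover by (simp add: ergodic_sum_def sum_distrib_left)
      also have "\<dots> = (\<Sum>h\<in>F. \<Sum>i\<in>I. if h \<in> B i then \<phi> (shift h x) else 0)"
        using I by (simp only: sum.inter_filter)
      also have "\<dots> = (\<Sum>i\<in>I. \<Sum>h\<in>F. if h \<in> B i then \<phi> (shift h x) else 0)"
        by (rule sum.swap)
      also have "\<dots> = (\<Sum>i\<in>I. ergodic_sum \<phi> (B i) x)"
      proof (rule sum.cong[OF refl])
        fix i assume "i \<in> I"
        then have "{h \<in> F. h \<in> B i} = B i" using B by auto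
        then show "(\<Sum>h\<in>F. if h \<in> B i then \<phi> (shift h x) else 0) = ergodic_sum \<phi> (B i) x"
          unfolding ergodic_sum_def using F by (simp flip: sum.inter_filter)
      qed
      also have "\<dots> \<le> (\<Sum>i\<in>I. max_pressure X \<phi> (B i) (restrict w (B i)))"
      proof (rule sum_mono)
        fix i assume "i \<in> I"
        then have "restrict w (B i) = restrict x (B i)" using B x(2) by (auto simp: inf.absorb2)
        then show "ergodic_sum \<phi> (B i) x \<le> max_pressure X \<phi> (B i) (restrict w (B i))"
          using ergodic_sum_le_max_pressure[of \<phi> C, OF \<phi> x(1), of "B i"] by simp
      qed
      finally show "ergodic_sum \<phi> F x \<le> (\<Sum>i\<in>I. max_pressure X \<phi> (B i) (restrict w (B i)) / k)"
        using k by (simp add: sum_divide_distrib[symmetric] field_simps)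
    qed
    then have "exp (max_pressure X \<phi> F w) \<le> exp (\<Sum>i\<in>I. max_pressure X \<phi> (B i) (restrict w (B i)) / k)"
      by simp
    also have "\<dots> = (\<Prod>i\<in>I. f i (restrict w (B i)))"
      unfolding exp_sum[OF I] by (rule prod.cong) (auto simp: f_def lang[OF w])
    finally show "exp (max_pressure X \<phi> F w) \<le> (\<Prod>i\<in>I. f i (restrict w (B i)))" .
  qed
  also have "\<dots> \<le> (\<Sum>w\<in>PiE F (\<lambda>_. UNIV). \<Prod>i\<in>I. f i (restrict w (B i)))"
    using F by (intro sum_mono2 finite_PiE language_subset prod_nonneg) (auto simp: f_def)
  also have "\<dots> \<le> (\<Prod>i\<in>I. root k (\<Sum>v\<in>PiE (B i) (\<lambda>_. UNIV). f i v ^ k))"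
    using F I k B cover by (rule Finner_inequality) (auto simp: f_def)
  also have "\<dots> = (\<Prod>i\<in>I. root k (partition_function X (B i) \<phi>))"
  proof (rule prod.cong[OF refl])
    fix i assume i: "i \<in> I"
    have "(\<Sum>v\<in>PiE (B i) (\<lambda>_. UNIV). f i v ^ k) = (\<Sum>v\<in>language X (B i). f i v ^ k)"
      using fin[OF i] k language_subset by (intro sum.mono_neutral_right finite_PiE) (auto simp: f_def)
    also have "\<dots> = partition_function X (B i) \<phi>"
      unfolding partition_function_eq using k
      by (intro sum.cong) (auto simp: f_def simp flip: exp_of_nat_mult)
    finally show "root k (\<Sum>v\<in>PiE (B i) (\<lambda>_. UNIV). f i v ^ k) = root k (partition_function X (B i) \<phi>)"
      by simp
  qed
  finally have le: "partition_function X F \<phi> \<le> (\<Prod>i\<in>I. root k (partition_function X (B i) \<phi>))" .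
  have pos: "0 < partition_function X (B i) \<phi>" if "i \<in> I" for i
    by (rule partition_function_pos[OF X fin[OF that]])
  have "ln (partition_function X F \<phi>) \<le> ln (\<Prod>i\<in>I. root k (partition_function X (B i) \<phi>))"
    using le partition_function_pos[OF X F, of \<phi>] by (intro ln_mono) auto
  also have "\<dots> = (\<Sum>i\<in>I. ln (root k (partition_function X (B i) \<phi>)))"
    using pos k by (intro ln_prod I) (auto simp: less_imp_neq[symmetric])
  also have "\<dots> = (\<Sum>i\<in>I. ln (partition_function X (B i) \<phi>) / k)"
    using pos k by (intro sum.cong) (auto simp: ln_root)
  finally show ?thesis using k by (simp add: sum_divide_distrib[symmetric] field_simps)
qed

section \<open>Convergence of the pressure\<close>
lemma ln_partition_function_small:
  fixes X :: "('g::group_add \<Rightarrow> 'a::finite) set"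
  assumes \<phi>: "\<And>x. \<bar>\<phi> x\<bar> \<le> C" and F: "finite F" and X: "X \<noteq> {}"
  shows "\<bar>ln (partition_function X F \<phi>)\<bar> \<le> real (card F) * (ln CARD('a) + C)"
proof -
  have C: "\<bar>ergodic_sum \<phi> F x\<bar> \<le> real (card F) * C" for x
    by (rule abs_ergodic_sum_le[of \<phi> C, OF \<phi>])
  obtain x where x: "x \<in> X" using X by blast
  have "ln (partition_function X F \<phi>) \<le> real (card F) * ln CARD('a) + real (card F) * C"
    using C by (intro ln_partition_function_le F X) (auto simp: abs_le_iff)
  moreover have "- (real (card F) * C) \<le> ln (partition_function X F \<phi>)"
    using le_ln_partition_function[of \<phi> C, OF \<phi> F x] C[of x] by (simp add: abs_le_iff)
  moreover have "0 \<le> real (card F) * ln CARD('a)" by simp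
  ultimately show ?thesis unfolding abs_le_iff distrib_left by linarith
qed

text \<open>
  The windows are the sets \<open>(K + g) \<inter> F\<close>, which cover each point of \<open>F\<close> exactly \<open>card K\<close> times.  Those
  with \<open>K + g \<subseteq> F\<close> contribute at most the value for \<open>K\<close>, and there are about \<open>card F\<close> of them.  A
  translate that meets both \<open>F\<close> and its complement contains a point of \<open>K' + F\<close> outside \<open>F\<close>, which
  bounds the number of the remaining windows.  The factor 2 arises because these windows enter twice:
  by their own value, and by the error in the number of full windows.
\<close>
lemma ln_partition_function_window:
  fixes X :: "('g::group_add \<Rightarrow> 'a::finite) set"
  assumes \<phi>: "\<And>x. \<bar>\<phi> x\<bar> \<le> C" and F: "finite F" and K: "finite K" "K \<noteq> {}"
    and X: "X \<noteq> {}" "\<And>g. shift g ` X \<subseteq> X"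
  defines "K' \<equiv> (\<lambda>(k, l). k - l) ` (K \<times> K)"
  shows "real (card K) * ln (partition_function X F \<phi>) \<le>
    real (card F) * ln (partition_function X K \<phi>) +
    real (card (sym_diff {k + f | k f. k \<in> K' \<and> f \<in> F} F)) *
      (2 * real (card K) ^ 2 * (ln CARD('a) + C))"
proof -
  define k where "k = card K"
  have k: "0 < k" using K by (simp add: k_def card_gt_0_iff)
  define D where "D = sym_diff {k + f | k f. k \<in> K' \<and> f \<in> F} F"
  define I where "I = (\<lambda>(k, f). - k + f) ` (K \<times> F)"
  define B where "B g = (\<lambda>k. k + g) ` K \<inter> F" for g
  define G where "G = {g \<in> I. (\<lambda>k. k + g) ` K \<subseteq> F}"
  let ?L = "ln (real CARD('a)) + C"
  let ?P = "\<lambda>B. ln (partition_function X B \<phi>)"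
  have C0: "0 \<le> C" using \<phi>[of "\<lambda>_. undefined"] by linarith
  have L0: "0 \<le> ?L" using C0 by simp
  have finI: "finite I" unfolding I_def using K F by auto
  have G: "G \<subseteq> I" "finite G" using finI by (auto simp: G_def)
  have cover: "card {g \<in> I. h \<in> B g} = k" if h: "h \<in> F" for h
  proof -
    have "{g \<in> I. h \<in> B g} = (\<lambda>l. - l + h) ` K"
    proof (intro equalityI subsetI)
      fix g assume "g \<in> {g \<in> I. h \<in> B g}"
      then obtain l where "l \<in> K" "h = l + g" by (auto simp: B_def)
      moreover from this have "g = - l + h" by (simp add: add.assoc[symmetric])
      ultimately show "g \<in> (\<lambda>l. - l + h) ` K" by blast
    next
      fix g assume "g \<in> (\<lambda>l. - l + h) ` K"
      then obtain l where l: "l \<in> K" "g = - l + h" by blast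
      then have "h = l + g" by (simp add: add.assoc[symmetric])
      then have "h \<in> B g" using l(1) h unfolding B_def by blast
      moreover have "g \<in> I" using l h by (auto simp: I_def)
      ultimately show "g \<in> {g \<in> I. h \<in> B g}" by simp
    qed
    also have "card \<dots> = k" unfolding k_def by (rule card_image) (auto simp: inj_on_def)
    finally show ?thesis .
  qed
  have cardB: "card (B g) \<le> k" for g
    using card_mono[of "(\<lambda>k. k + g) ` K" "B g"] card_image_le[of K "\<lambda>k. k + g"] K(1)
    by (simp add: B_def k_def)
  have finB: "finite (B g)" for g using F by (simp add: B_def)
  have PB: "?P (B g) \<le> real k * ?L" for g
  proof -
    have "?P (B g) \<le> real (card (B g)) * ?L"
      using ln_partition_function_small[of \<phi> C, OF \<phi> finB X(1)] by (simp add: abs_le_iff)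
    also have "\<dots> \<le> real k * ?L" using cardB L0 by (intro mult_right_mono) auto
    finally show ?thesis .
  qed
  have PG: "?P (B g) \<le> ?P K" if "g \<in> G" for g
  proof -
    have "B g = (\<lambda>k. k + g) ` K" using that by (auto simp: B_def G_def)
    then show ?thesis
      using partition_function_translate_le[of \<phi> C K X g, OF \<phi> K(1) X(2)]
        partition_function_pos[OF X(1) finB[of g], of \<phi>] by (intro ln_mono) auto
  qed
  have "real k * ?P F \<le> (\<Sum>g\<in>I. ?P (B g))"
    by (rule partition_function_cover[of \<phi> C, OF \<phi> F finI k X(1) _ cover]) (auto simp: B_def)
  also have "\<dots> = (\<Sum>g\<in>I - G. ?P (B g)) + (\<Sum>g\<in>G. ?P (B g))"
    by (rule sum.subset_diff[OF G(1) finI])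
  also have "\<dots> \<le> (\<Sum>g\<in>I - G. real k * ?L) + (\<Sum>g\<in>G. ?P K)"
    by (intro add_mono sum_mono PB PG)
  also have "\<dots> = real (card (I - G)) * (real k * ?L) + real (card G) * ?P K" by simp
  finally have 1: "real k * ?P F \<le> real (card (I - G)) * (real k * ?L) + real (card G) * ?P K" .
  have count: "k * card F = (\<Sum>g\<in>I. card (B g))"
  proof -
    \<comment> \<open>Double counting of the pairs \<open>(h, g)\<close> with \<open>h \<in> B g\<close>.\<close>
    have "k * card F = (\<Sum>h\<in>F. card {g \<in> I. h \<in> B g})" using cover by simp
    also have "\<dots> = (\<Sum>h\<in>F. \<Sum>g\<in>I. if h \<in> B g then 1 else 0)"
      using finI by (simp flip: sum.inter_filter)
    also have "\<dots> = (\<Sum>g\<in>I. \<Sum>h\<in>F. if h \<in> B g then 1 else 0)" by (rule sum.swap)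
    also have "\<dots> = (\<Sum>g\<in>I. card (B g))"
    proof (rule sum.cong[OF refl])
      fix g
      have "{h \<in> F. h \<in> B g} = B g" by (auto simp: B_def)
      then show "(\<Sum>h\<in>F. if h \<in> B g then 1 else 0) = card (B g)"
        using F by (simp flip: sum.inter_filter)
    qed
    finally show ?thesis .
  qed
  have BG: "card (B g) = k" if "g \<in> G" for g
  proof -
    have "B g = (\<lambda>k. k + g) ` K" using that by (auto simp: B_def G_def)
    then show ?thesis unfolding k_def by (simp add: card_image inj_on_def)
  qed
  have "(\<Sum>g\<in>I. card (B g)) = (\<Sum>g\<in>I - G. card (B g)) + (\<Sum>g\<in>G. card (B g))"
    by (rule sum.subset_diff[OF G(1) finI])
  also have "(\<Sum>g\<in>G. card (B g)) = k * card G" using BG by simp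
  finally have split: "k * card F = (\<Sum>g\<in>I - G. card (B g)) + k * card G" using count by simp
  have "k * card G \<le> k * card F" using split by simp
  then have G_le: "card G \<le> card F" using k by simp
  have "(\<Sum>g\<in>I - G. card (B g)) \<le> (\<Sum>g\<in>I - G. k)" by (intro sum_mono cardB)
  then have "k * card F \<le> k * (card (I - G) + card G)" using split by (simp add: algebra_simps)
  then have F_le: "card F \<le> card (I - G) + card G" using k by simp
  have "\<bar>?P K\<bar> \<le> real k * ?L"
    unfolding k_def by (rule ln_partition_function_small[of \<phi> C, OF \<phi> K(1) X(1)])
  moreover have "real (card G) * ?P K \<le> real (card F) * ?P K + (real (card F) - real (card G)) * \<bar>?P K\<bar>"
  proof -
    have "(real (card F) - real (card G)) * (- ?P K) \<le> (real (card F) - real (card G)) * \<bar>?P K\<bar>"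
      using G_le by (intro mult_left_mono) auto
    then show ?thesis by (simp add: algebra_simps)
  qed
  moreover have "(real (card F) - real (card G)) * \<bar>?P K\<bar> \<le> real (card (I - G)) * (real k * ?L)"
    using F_le calculation(1) L0 by (intro mult_mono) (auto simp flip: of_nat_add)
  ultimately have 2: "real (card G) * ?P K \<le> real (card F) * ?P K + real (card (I - G)) * (real k * ?L)"
    by linarith
  have bd: "card (I - G) \<le> k * card D"
  proof -
    have finD: "finite D"
    proof -
      have "{k + f | k f. k \<in> K' \<and> f \<in> F} = (\<lambda>(k, f). k + f) ` (K' \<times> F)" by auto
      then show ?thesis unfolding D_def K'_def using K F by auto
    qed
    have "I - G \<subseteq> (\<lambda>(l, y). - l + y) ` (K \<times> D)"
    proof
      fix g assume g: "g \<in> I - G"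
      then obtain l f where l: "l \<in> K" "f \<in> F" "g = - l + f" by (auto simp: I_def)
      from g obtain l' where l': "l' \<in> K" "l' + g \<notin> F" by (auto simp: G_def)
      have "l' + g = (l' - l) + f" unfolding l(3) by (simp add: add.assoc[symmetric])
      moreover have "l' - l \<in> K'" unfolding K'_def using l(1) l'(1) by force
      ultimately have "l' + g \<in> D" using l' l unfolding D_def by blast
      moreover have "g = - l' + (l' + g)" by (simp add: add.assoc[symmetric])
      ultimately show "g \<in> (\<lambda>(l, y). - l + y) ` (K \<times> D)" using l'(1) by force
    qed
    then have "card (I - G) \<le> card (K \<times> D)"
      using K finD by (meson card_image_le card_mono finite_SigmaI finite_imageI le_trans)
    then show ?thesis by (simp add: k_def card_cartesian_product)
  qed
  have "real k * ?P F \<le> real (card F) * ?P K + real (card (I - G)) * (2 * (real k * ?L))"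
    using 1 2 by (simp add: algebra_simps)
  also have "\<dots> \<le> real (card F) * ?P K + real (k * card D) * (2 * (real k * ?L))"
    using bd L0 by (intro add_left_mono mult_right_mono) (simp_all only: of_nat_le_iff, auto)
  finally show ?thesis
    unfolding D_def[symmetric] k_def[symmetric] by (simp add: power2_eq_square algebra_simps)
qed

lemma convergent_if_eventually_below_terms:
  fixes u :: "nat \<Rightarrow> real"
  assumes below: "\<And>m \<epsilon>. m \<ge> N \<Longrightarrow> \<epsilon> > 0 \<Longrightarrow> eventually (\<lambda>n. u n \<le> u m + \<epsilon>) sequentially"
    and bdd: "bdd_below (u ` {N..})"
  shows "convergent u"
proof -
  define l where "l = (INF n\<in>{N..}. u n)"
  have "u \<longlonglongrightarrow> l"
  proof (rule order_tendstoI)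
    fix a assume "a < l"
    have "l \<le> u n" if "n \<ge> N" for n unfolding l_def using that by (intro cINF_lower[OF bdd]) auto
    then show "eventually (\<lambda>n. a < u n) sequentially"
      using \<open>a < l\<close> by (intro eventually_sequentiallyI[of N]) (meson less_le_trans)
  next
    fix a assume "l < a"
    then obtain m where m: "m \<ge> N" "u m < a"
      unfolding l_def using cINF_less_iff[OF _ bdd, of a] by auto
    have "eventually (\<lambda>n. u n \<le> u m + (a - u m) / 2) sequentially"
      using m by (intro below) auto
    then show "eventually (\<lambda>n. u n < a) sequentially"
    proof eventually_elim
      case (elim n)
      then show ?case using m(2) by (simp add: field_simps)
    qed
  qed
  then show ?thesis by (auto simp: convergent_def)
qed

lemma folner_card_pos:
  assumes "folner_sequence F" "n \<ge> 1" shows "finite (F n)" "F n \<noteq> {}"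
proof -
  obtain m where "n = Suc m" using assms(2) by (cases n) auto
  then show "finite (F n)" "F n \<noteq> {}" using assms(1) by (auto simp: folner_sequence_def)
qed

text \<open>
  By the window estimate with \<open>K = F m\<close>, each term of the sequence bounds all sufficiently late terms up to
  a small error; hence the sequence converges to its infimum.  The index starts at 1 because \<open>F 0\<close> may be
  empty.
\<close>
lemma convergent_pressure:
  fixes X :: "('g::group_add \<Rightarrow> 'a::{finite,discrete_topology}) set"
  assumes F: "folner_sequence F" and X: "subshift X" and \<phi>: "\<And>x. \<bar>\<phi> x\<bar> \<le> C"
  shows "convergent (\<lambda>n. ln (partition_function X (F n) \<phi>) / real (card (F n)))"
    (is "convergent ?u")
proof (rule convergent_if_eventually_below_terms[where N = 1])
  have X': "X \<noteq> {}" "\<And>g. shift g ` X \<subseteq> X" using X by (auto simp: subshift_def)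
  let ?L = "ln (real CARD('a)) + C"
  have fin: "finite (F n)" for n using F by (auto simp: folner_sequence_def)
  have pos: "0 < real (card (F n))" if "n \<ge> 1" for n
    using folner_card_pos[OF F that] by (simp add: card_gt_0_iff)
  show "bdd_below (?u ` {1..})"
  proof (rule bdd_belowI2)
    fix n :: nat assume "n \<in> {1..}"
    then show "- ?L \<le> ?u n"
      using ln_partition_function_small[of \<phi> C, OF \<phi> fin X'(1), of n] pos[of n]
      by (simp add: field_simps abs_le_iff)
  qed
  fix m :: nat and \<epsilon> :: real assume m: "m \<ge> 1" and \<epsilon>: "\<epsilon> > 0"
  define K' where "K' = (\<lambda>(k, l). k - l) ` (F m \<times> F m)"
  let ?c = "2 * real (card (F m)) ^ 2 * ?L"
  define d where "d n = real (card (sym_diff {k + f | k f. k \<in> K' \<and> f \<in> F n} (F n)))" for n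
  have "finite K' \<and> K' \<noteq> {}" using folner_card_pos[OF F m] by (auto simp: K'_def)
  then have "(\<lambda>n. d n / real (card (F n))) \<longlonglongrightarrow> 0"
    using F unfolding folner_sequence_def d_def by blast
  then have "(\<lambda>n. d n / real (card (F n)) * (?c / real (card (F m)))) \<longlonglongrightarrow> 0 * (?c / real (card (F m)))"
    by (intro tendsto_mult_right)
  then have "eventually (\<lambda>n. d n / real (card (F n)) * (?c / real (card (F m))) < \<epsilon>) sequentially"
    using \<epsilon> by (intro order_tendstoD(2)) auto
  then show "eventually (\<lambda>n. ?u n \<le> ?u m + \<epsilon>) sequentially"
    using eventually_ge_at_top[of 1]
  proof eventually_elim
    case (elim n)
    have "real (card (F m)) * ln (partition_function X (F n) \<phi>) \<le>
      real (card (F n)) * ln (partition_function X (F m) \<phi>) + d n * ?c"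
      unfolding d_def K'_def
      using folner_card_pos[OF F m]
      by (intro ln_partition_function_window[of \<phi> C, OF \<phi> fin _ _ X'])
    then have "?u n \<le> ?u m + d n / real (card (F n)) * (?c / real (card (F m)))"
      using pos[OF m] pos[OF elim(2)] by (simp add: field_simps)
    then show ?case using elim(1) by linarith
  qed
qed

lemma tendsto_pressure:
  fixes X :: "('g::group_add \<Rightarrow> 'a::{finite,discrete_topology}) set"
  assumes F: "folner_sequence F" and X: "subshift X"
  shows "(\<lambda>n. ln (partition_function X (F n) (apply_bcontfun \<phi>)) / real (card (F n)))
    \<longlonglongrightarrow> pressure F X \<phi>"
proof -
  have "\<bar>apply_bcontfun \<phi> x\<bar> \<le> norm \<phi>" for x using norm_bounded[of \<phi> x] by simp
  from convergent_pressure[of F X "apply_bcontfun \<phi>", OF F X this] show ?thesis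
    unfolding pressure_def by (simp add: convergent_LIMSEQ_iff)
qed

section \<open>Clopen sets of the full shift\<close>
lemma compact_full_shift: "compact (UNIV :: ('g \<Rightarrow> 'a::{finite,discrete_topology}) set)"
proof -
  have "compactin (euclidean :: 'a topology) UNIV"
    by (simp add: finite_imp_compact)
  then have "compactin (product_topology (\<lambda>_::'g. euclidean :: 'a topology) UNIV) (PiE UNIV (\<lambda>_. UNIV))"
    by (subst compactin_PiE) auto
  then show ?thesis by (simp add: euclidean_product_topology)
qed

lemma compact_unit_cube: "compact (PiE UNIV (\<lambda>_. {0..1}) :: ('i \<Rightarrow> real) set)"
proof -
  have "compactin (product_topology (\<lambda>_::'i. euclidean :: real topology) UNIV) (PiE UNIV (\<lambda>_. {0..1}))"
    by (subst compactin_PiE) auto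
  then show ?thesis by (simp add: euclidean_product_topology)
qed

text \<open>
  Tychonoff's theorem in place of a diagonal sequence: the functions \<open>m n\<close> lie in a compact cube, so
  they have a cluster point \<open>p\<close>, and along a suitable filter finer than \<open>sequentially\<close> all coordinates
  converge to those of \<open>p\<close> simultaneously.
\<close>
lemma bounded_sequences_limit_filter:
  fixes m :: "nat \<Rightarrow> 'i \<Rightarrow> real"
  assumes "\<And>n i. m n i \<in> {0..1}"
  obtains G p where "G \<noteq> bot" "G \<le> sequentially" "\<And>i. ((\<lambda>n. m n i) \<longlongrightarrow> p i) G"
proof -
  let ?S = "filtermap m sequentially"
  have S: "?S \<noteq> bot" by (simp add: filtermap_bot_iff)
  have "eventually (\<lambda>x. x \<in> PiE UNIV (\<lambda>_. {0..1})) ?S"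
    using assms by (simp add: eventually_filtermap PiE_def Pi_def)
  with S obtain p where p: "inf (nhds p) ?S \<noteq> bot"
    using compact_unit_cube[where 'i = 'i] unfolding compact_filter by blast
  define G where "G = inf (filtercomap m (nhds p)) sequentially"
  have "G \<noteq> bot"
  proof
    assume "G = bot"
    then have "eventually (\<lambda>_. False) G" by simp
    then obtain P Q where PQ: "eventually P (nhds p)" "eventually Q sequentially" "\<And>n. P (m n) \<Longrightarrow> Q n \<Longrightarrow> False"
      unfolding G_def eventually_inf eventually_filtercomap by blast
    have "eventually (\<lambda>x. \<not> P x) ?S"
      unfolding eventually_filtermap using PQ(2) by eventually_elim (use PQ(3) in blast)
    with PQ(1) have "eventually (\<lambda>_. False) (inf (nhds p) ?S)"
      unfolding eventually_inf by blast
    with p show False by (simp add: trivial_limit_def[symmetric])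
  qed
  moreover have "G \<le> sequentially" by (simp add: G_def)
  moreover have "((\<lambda>n. m n i) \<longlongrightarrow> p i) G" for i
  proof -
    have "filterlim m (nhds p) G"
      unfolding G_def by (rule filterlim_mono[OF filterlim_filtercomap]) auto
    then have lim: "\<And>P. eventually P (nhds p) \<Longrightarrow> eventually (\<lambda>n. P (m n)) G"
      by (simp add: filterlim_iff)
    show ?thesis
    proof (rule topological_tendstoI)
      fix S :: "real set" assume S: "open S" "p i \<in> S"
      have "open ((\<lambda>x::'i \<Rightarrow> real. x i) -` S)"
        using S(1) by (rule open_vimage) simp
      from eventually_nhds_in_open[OF this, of p] S(2)
      have "eventually (\<lambda>x. x \<in> (\<lambda>x. x i) -` S) (nhds p)" by simp
      from lim[OF this] show "eventually (\<lambda>n. m n i \<in> S) G" by simp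
    qed
  qed
  ultimately show ?thesis by (rule that)
qed

lemma continuous_shift: "continuous_on UNIV (shift g :: ('g::group_add \<Rightarrow> 'a::topological_space) \<Rightarrow> _)"
  unfolding shift_def by (intro continuous_on_coordinatewise_then_product continuous_on_product_coordinates)

definition clopen :: "'x::topological_space set \<Rightarrow> bool" where
  "clopen C \<longleftrightarrow> open C \<and> closed C"

lemma clopen_Un: "clopen C \<Longrightarrow> clopen D \<Longrightarrow> clopen (C \<union> D)"
  and clopen_Compl: "clopen C \<Longrightarrow> clopen (- C)"
  by (auto simp: clopen_def)

lemma clopen_vimage_shift:
  "clopen C \<Longrightarrow> clopen (shift g -` C :: ('g::group_add \<Rightarrow> 'a::topological_space) set)"
  unfolding clopen_def using continuous_shift open_vimage closed_vimage by blast

lemma cylinder_eq_INT: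
  "w \<in> extensional E \<Longrightarrow> cylinder E w = (\<Inter>g\<in>E. (\<lambda>x. x g) -` {w g})"
  by (auto simp: cylinder_def restrict_def extensional_def fun_eq_iff)

lemma clopen_cylinder:
  fixes w :: "'g \<Rightarrow> 'a::discrete_topology"
  assumes "finite E" "w \<in> extensional E"
  shows "clopen (cylinder E w)"
proof -
  have "open ((\<lambda>x. x g) -` {w g} :: ('g \<Rightarrow> 'a) set)" for g
    by (rule open_vimage[OF discrete_topology_class.open_discrete]) simp
  moreover have "closed ((\<lambda>x. x g) -` {w g} :: ('g \<Rightarrow> 'a) set)" for g
    by (rule closed_vimage[OF closed_singleton]) simp
  ultimately show ?thesis
    unfolding cylinder_eq_INT[OF assms(2)] clopen_def using assms(1) by (auto intro!: open_INT closed_INT)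
qed

lemma open_contains_cylinder:
  fixes U :: "('g \<Rightarrow> 'a::discrete_topology) set"
  assumes "open U" "x \<in> U"
  obtains E where "finite E" "cylinder E (restrict x E) \<subseteq> U"
proof -
  have "openin (product_topology (\<lambda>_::'g. euclidean :: 'a topology) UNIV) U"
    using assms(1) by (simp add: euclidean_product_topology)
  from product_topology_open_contains_basis[OF this assms(2)]
  obtain V where V: "x \<in> PiE UNIV V" "finite {i. V i \<noteq> (UNIV :: 'a set)}" "PiE UNIV V \<subseteq> U"
    by auto
  let ?E = "{i. V i \<noteq> (UNIV :: 'a set)}"
  have "cylinder ?E (restrict x ?E) \<subseteq> PiE UNIV V"
  proof
    fix y assume "y \<in> cylinder ?E (restrict x ?E)"
    then have eq: "y i = x i" if "i \<in> ?E" for i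
      using that by (auto simp: cylinder_def fun_eq_iff restrict_def split: if_splits)
    have "y i \<in> V i" for i
      using V(1) eq[of i] by (cases "i \<in> ?E") auto
    then show "y \<in> PiE UNIV V" by auto
  qed
  with V show ?thesis by (intro that) auto
qed

text \<open>
  Uniform continuity in the product topology: finitely many cylinders on which \<open>\<phi>\<close> is nearly constant
  cover the full shift, and \<open>E\<close> is the union of their supports.  Outside \<open>E\<close> the restricted
  configuration takes the value \<open>undefined\<close>, so \<open>restrict x E\<close> is again a point of the full shift.
\<close>
lemma locally_constant_approximation:
  fixes \<phi> :: "('g \<Rightarrow> 'a::{finite,discrete_topology}) \<Rightarrow>\<^sub>C real"
  assumes "\<epsilon> > 0"
  obtains E where "finite E" "\<And>x. \<bar>apply_bcontfun \<phi> x - apply_bcontfun \<phi> (restrict x E)\<bar> < \<epsilon>"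
proof -
  let ?f = "apply_bcontfun \<phi>"
  have cont: "continuous_on UNIV ?f" using apply_bcontfun[of \<phi>] by (simp add: bcontfun_def)
  define U where "U x = {y. \<bar>?f y - ?f x\<bar> < \<epsilon> / 2}" for x
  have "open (U x)" for x
  proof -
    have "U x = ?f -` ball (?f x) (\<epsilon> / 2)"
      by (auto simp: U_def ball_def dist_real_def abs_minus_commute)
    then show ?thesis using cont by (simp add: open_vimage)
  qed
  moreover have "x \<in> U x" for x using assms by (simp add: U_def)
  ultimately have "\<forall>x. \<exists>E. finite E \<and> cylinder E (restrict x E) \<subseteq> U x"
    using open_contains_cylinder by metis
  from choice[OF this] obtain E where "\<forall>x. finite (E x) \<and> cylinder (E x) (restrict x (E x)) \<subseteq> U x" ..
  then have E: "\<And>x. finite (E x)" "\<And>x. cylinder (E x) (restrict x (E x)) \<subseteq> U x"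
    by simp_all
  obtain S where S: "finite S" "UNIV \<subseteq> (\<Union>x\<in>S. cylinder (E x) (restrict x (E x)))"
  proof (rule compactE_image[OF compact_full_shift, of UNIV "\<lambda>x. cylinder (E x) (restrict x (E x))"])
    show "open (cylinder (E x) (restrict x (E x)))" for x
      using clopen_cylinder[OF E(1), of "restrict x (E x)"] by (auto simp: clopen_def)
    show "UNIV \<subseteq> (\<Union>x. cylinder (E x) (restrict x (E x)))"
      by (auto simp: cylinder_def)
  qed (use that in auto)
  define E' where "E' = (\<Union>x\<in>S. E x)"
  have "\<bar>?f x - ?f (restrict x E')\<bar> < \<epsilon>" for x
  proof -
    obtain z where z: "z \<in> S" "x \<in> cylinder (E z) (restrict z (E z))" using S(2) by blast
    then have "restrict (restrict x E') (E z) = restrict x (E z)"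
      by (auto simp: E'_def inf.absorb2 SUP_upper)
    then have "restrict x E' \<in> cylinder (E z) (restrict z (E z))"
      using z(2) by (simp add: cylinder_def)
    with z(2) E(2)[of z] have "x \<in> U z" "restrict x E' \<in> U z" by blast+
    then show ?thesis unfolding U_def mem_Collect_eq by linarith
  qed
  moreover have "finite E'" using S(1) E(1) by (simp add: E'_def)
  ultimately show ?thesis by (intro that) auto
qed

text \<open>
  There are only countably many cylinders, so every open set is a countable union of them.
\<close>
lemma sets_borel_clopen:
  "sets (borel :: ('g::countable \<Rightarrow> 'a::{finite,discrete_topology}) measure) = sigma_sets UNIV {C. clopen C}"
proof (rule antisym)
  have "U \<in> sigma_sets UNIV {C. clopen C}" if U: "open U" for U :: "('g \<Rightarrow> 'a) set"
  proof -
    define J where "J = {(E, w). finite E \<and> w \<in> PiE E (\<lambda>_. UNIV) \<and> cylinder E w \<subseteq> U}"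
    have "J \<subseteq> (SIGMA E:{E. finite E}. PiE E (\<lambda>_. UNIV))" by (auto simp: J_def)
    moreover have "countable (SIGMA E:{E::'g set. finite E}. PiE E (\<lambda>_. UNIV :: 'a set))"
    proof (rule countable_SIGMA)
      show "countable {E::'g set. finite E}"
        by (rule countable_Collect_finite)
      show "countable (PiE E (\<lambda>_. UNIV :: 'a set))" if "E \<in> {E::'g set. finite E}" for E
        using that by (intro countable_finite finite_PiE) auto
    qed
    ultimately have "countable J" by (rule countable_subset)
    have "U = (\<Union>(E, w)\<in>J. cylinder E w)"
    proof (intro equalityI subsetI)
      fix x assume "x \<in> U"
      then obtain E where "finite E" "cylinder E (restrict x E) \<subseteq> U"
        using open_contains_cylinder[OF U] by blast
      then have "(E, restrict x E) \<in> J" by (auto simp: J_def)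
      then show "x \<in> (\<Union>(E, w)\<in>J. cylinder E w)" by (force simp: cylinder_def)
    qed (auto simp: J_def)
    moreover have "(\<Union>z\<in>J. case z of (E, w) \<Rightarrow> cylinder E w) \<in> sigma_sets UNIV {C. clopen C}"
    proof (rule sigma_sets_UNION)
      show "countable ((\<lambda>z. case z of (E, w) \<Rightarrow> cylinder E w) ` J)" using \<open>countable J\<close> by simp
      fix b assume "b \<in> (\<lambda>z. case z of (E, w) \<Rightarrow> cylinder E w) ` J"
      then show "b \<in> sigma_sets UNIV {C. clopen C}"
        by (auto simp: J_def PiE_def intro!: sigma_sets.Basic clopen_cylinder)
    qed
    ultimately show ?thesis by simp
  qed
  then show "sets borel \<subseteq> sigma_sets UNIV {C :: ('g \<Rightarrow> 'a) set. clopen C}"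
    unfolding sets_borel by (intro sigma_sets_mono) auto
  show "sigma_sets UNIV {C :: ('g \<Rightarrow> 'a) set. clopen C} \<subseteq> sets borel"
    unfolding sets_borel by (intro sigma_sets_mono') (auto simp: clopen_def)
qed

section \<open>Invariant measures from empirical measures\<close>
definition empirical :: "'g::group_add set \<Rightarrow> ('g \<Rightarrow> 'a) \<Rightarrow> ('g \<Rightarrow> 'a) set \<Rightarrow> real" where
  "empirical F x C = real (card {g \<in> F. shift g x \<in> C}) / real (card F)"

lemma empirical_bounds: "finite F \<Longrightarrow> empirical F x C \<in> {0..1}"
  by (auto simp: empirical_def divide_le_eq intro!: card_mono)

lemma empirical_Un:
  assumes "finite F" "C \<inter> D = {}"
  shows "empirical F x (C \<union> D) = empirical F x C + empirical F x D"
proof -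
  have "{g \<in> F. shift g x \<in> C \<union> D} = {g \<in> F. shift g x \<in> C} \<union> {g \<in> F. shift g x \<in> D}" by auto
  moreover have "card ({g \<in> F. shift g x \<in> C} \<union> {g \<in> F. shift g x \<in> D}) =
      card {g \<in> F. shift g x \<in> C} + card {g \<in> F. shift g x \<in> D}"
    using assms by (intro card_Un_disjoint) auto
  ultimately show ?thesis by (simp add: empirical_def add_divide_distrib)
qed

text \<open>
  Shifting the set amounts to averaging over \<open>h + F\<close> instead of \<open>F\<close>.
\<close>
lemma empirical_vimage_shift:
  assumes "finite F"
  shows "\<bar>empirical F x (shift h -` C) - empirical F x C\<bar> \<le>
    real (card (sym_diff {k + f | k f. k \<in> {h} \<and> f \<in> F} F)) / real (card F)"
proof -
  let ?H = "{k + f | k f. k \<in> {h} \<and> f \<in> F}"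
  have H: "?H = (\<lambda>f. h + f) ` F" by auto
  have finH: "finite ?H" unfolding H using assms by simp
  have "{g \<in> ?H. shift g x \<in> C} = (\<lambda>f. h + f) ` {g \<in> F. shift g x \<in> shift h -` C}"
    unfolding H by (auto simp: shift_shift)
  then have eq: "card {g \<in> F. shift g x \<in> shift h -` C} = card {g \<in> ?H. shift g x \<in> C}"
    by (simp add: card_image inj_on_def)
  have le: "real (card {g \<in> A. shift g x \<in> C}) \<le> real (card {g \<in> B. shift g x \<in> C}) + real (card (sym_diff ?H F))"
    if "finite A" "finite B" "A - B \<subseteq> sym_diff ?H F" for A B
  proof -
    have "card {g \<in> A. shift g x \<in> C} \<le> card ({g \<in> B. shift g x \<in> C} \<union> sym_diff ?H F)"
      using that finH assms by (intro card_mono) auto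
    also have "\<dots> \<le> card {g \<in> B. shift g x \<in> C} + card (sym_diff ?H F)" by (rule card_Un_le)
    finally show ?thesis by (simp flip: of_nat_add)
  qed
  have "\<bar>real (card {g \<in> ?H. shift g x \<in> C}) - real (card {g \<in> F. shift g x \<in> C})\<bar> \<le> real (card (sym_diff ?H F))"
    using le[OF finH assms] le[OF assms finH] by (simp add: abs_le_iff)
  then have "\<bar>real (card {g \<in> ?H. shift g x \<in> C}) - real (card {g \<in> F. shift g x \<in> C})\<bar> / real (card F)
      \<le> real (card (sym_diff ?H F)) / real (card F)"
    by (rule divide_right_mono) simp
  then show ?thesis
    unfolding empirical_def eq diff_divide_distrib[symmetric] abs_divide by simp
qed

lemma ergodic_average_locally_constant:
  fixes f :: "('g::group_add \<Rightarrow> 'a::finite) \<Rightarrow> real"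
  assumes F: "finite F" and E: "finite E"
  shows "ergodic_sum (\<lambda>x. f (restrict x E)) F x / real (card F) =
    (\<Sum>w\<in>PiE E (\<lambda>_. UNIV). f w * empirical F x (cylinder E w))"
proof -
  have fin: "finite (PiE E (\<lambda>_. UNIV :: 'a set))" using E by (intro finite_PiE) auto
  have "ergodic_sum (\<lambda>x. f (restrict x E)) F x
    = (\<Sum>g\<in>F. \<Sum>w\<in>PiE E (\<lambda>_. UNIV). if shift g x \<in> cylinder E w then f w else 0)"
    unfolding ergodic_sum_def
  proof (rule sum.cong[OF refl])
    fix g
    have "(\<Sum>w\<in>PiE E (\<lambda>_. UNIV). if shift g x \<in> cylinder E w then f w else 0)
      = (\<Sum>w\<in>PiE E (\<lambda>_. UNIV). if w = restrict (shift g x) E then f w else 0)"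
      by (rule sum.cong) (auto simp: cylinder_def)
    also have "\<dots> = f (restrict (shift g x) E)" using fin by (simp add: sum.delta)
    finally show "f (restrict (shift g x) E) =
        (\<Sum>w\<in>PiE E (\<lambda>_. UNIV). if shift g x \<in> cylinder E w then f w else 0)" by simp
  qed
  also have "\<dots> = (\<Sum>w\<in>PiE E (\<lambda>_. UNIV). \<Sum>g\<in>F. if shift g x \<in> cylinder E w then f w else 0)"
    by (rule sum.swap)
  also have "\<dots> = (\<Sum>w\<in>PiE E (\<lambda>_. UNIV). f w * real (card {g \<in> F. shift g x \<in> cylinder E w}))"
    using F by (intro sum.cong) (simp_all flip: sum.inter_filter)
  finally show ?thesis by (simp add: empirical_def sum_divide_distrib)
qed

lemma integral_locally_constant:
  fixes f :: "('g \<Rightarrow> 'a::finite) \<Rightarrow> real"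
  assumes "prob_space \<nu>" "space \<nu> = X" "finite E"
    and cyl: "\<And>w. w \<in> PiE E (\<lambda>_. UNIV) \<Longrightarrow> cylinder E w \<inter> X \<in> sets \<nu>"
  shows "integrable \<nu> (\<lambda>x. f (restrict x E))"
    and "integral\<^sup>L \<nu> (\<lambda>x. f (restrict x E)) =
      (\<Sum>w\<in>PiE E (\<lambda>_. UNIV). f w * measure \<nu> (cylinder E w \<inter> X))"
proof -
  interpret prob_space \<nu> by fact
  have fin: "finite (PiE E (\<lambda>_. UNIV :: 'a set))" using assms(3) by (intro finite_PiE) auto
  have eq: "f (restrict x E) = (\<Sum>w\<in>PiE E (\<lambda>_. UNIV). f w * indicator (cylinder E w \<inter> X) x)"
    if "x \<in> space \<nu>" for x
  proof -
    have "(\<Sum>w\<in>PiE E (\<lambda>_. UNIV). f w * indicator (cylinder E w \<inter> X) x)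
      = (\<Sum>w\<in>PiE E (\<lambda>_. UNIV). if w = restrict x E then f w else 0)"
      using that assms(2) by (intro sum.cong) (auto simp: cylinder_def indicator_def)
    also have "\<dots> = f (restrict x E)" using fin by (simp add: sum.delta)
    finally show ?thesis by simp
  qed
  have int: "integrable \<nu> (\<lambda>x. f w * indicator (cylinder E w \<inter> X) x)"
    if "w \<in> PiE E (\<lambda>_. UNIV)" for w
    using cyl[OF that] by (intro integrable_mult_right integrable_real_indicator) (auto simp: emeasure_eq_measure)
  have "integrable \<nu> (\<lambda>x. \<Sum>w\<in>PiE E (\<lambda>_. UNIV). f w * indicator (cylinder E w \<inter> X) x)"
    by (rule Bochner_Integration.integrable_sum) (rule int)
  then show "integrable \<nu> (\<lambda>x. f (restrict x E))"
    by (subst Bochner_Integration.integrable_cong[OF refl eq]) simp_all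
  have "integral\<^sup>L \<nu> (\<lambda>x. f (restrict x E)) =
      integral\<^sup>L \<nu> (\<lambda>x. \<Sum>w\<in>PiE E (\<lambda>_. UNIV). f w * indicator (cylinder E w \<inter> X) x)"
    using eq by (rule Bochner_Integration.integral_cong[OF refl])
  also have "\<dots> = (\<Sum>w\<in>PiE E (\<lambda>_. UNIV). integral\<^sup>L \<nu> (\<lambda>x. f w * indicator (cylinder E w \<inter> X) x))"
    by (rule Bochner_Integration.integral_sum) (rule int)
  also have "\<dots> = (\<Sum>w\<in>PiE E (\<lambda>_. UNIV). f w * measure \<nu> (cylinder E w \<inter> X))"
    using assms(2) by (intro sum.cong) (auto simp: Int_absorb1 Int_commute)
  finally show "integral\<^sup>L \<nu> (\<lambda>x. f (restrict x E)) =
      (\<Sum>w\<in>PiE E (\<lambda>_. UNIV). f w * measure \<nu> (cylinder E w \<inter> X))" .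
qed

definition relative_clopens :: "'x::topological_space set \<Rightarrow> 'x set set" where
  "relative_clopens X = (\<inter>) X ` {C. clopen C}"

lemma relative_clopensI: "clopen C \<Longrightarrow> X \<inter> C \<in> relative_clopens X"
  unfolding relative_clopens_def by (rule imageI) simp

lemma relative_clopensE:
  assumes "A \<in> relative_clopens X" obtains C where "clopen C" "A = X \<inter> C"
  using assms unfolding relative_clopens_def by blast

lemma sets_restrict_borel_clopen:
  fixes X :: "('g::countable \<Rightarrow> 'a::{finite,discrete_topology}) set"
  assumes "closed X"
  shows "sets (restrict_space borel X) = sigma_sets X (relative_clopens X)"
proof -
  have "X \<in> sets borel" using assms by simp
  then have "X \<in> sigma_sets UNIV {C. clopen C}" by (simp only: sets_borel_clopen)
  then show ?thesis
    unfolding sets_restrict_space sets_borel_clopen relative_clopens_def by (rule sigma_sets_Int) simp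
qed

lemma algebra_relative_clopens: "algebra X (relative_clopens X)"
  unfolding algebra_iff_Un relative_clopens_def
proof (intro conjI ballI)
  show "(\<inter>) X ` {C. clopen C} \<subseteq> Pow X" by auto
  show "{} \<in> (\<inter>) X ` {C. clopen C}"
    by (rule image_eqI[of _ _ "{}"]) (auto simp: clopen_def)
next
  fix A assume "A \<in> (\<inter>) X ` {C. clopen C}"
  then obtain C where "clopen C" "A = X \<inter> C" by auto
  then show "X - A \<in> (\<inter>) X ` {C. clopen C}"
    by (intro image_eqI[of _ _ "- C"]) (auto simp: clopen_Compl)
next
  fix A B assume "A \<in> (\<inter>) X ` {C. clopen C}" "B \<in> (\<inter>) X ` {C. clopen C}"
  then obtain C D where "clopen C" "A = X \<inter> C" "clopen D" "B = X \<inter> D" by auto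
  then show "A \<union> B \<in> (\<inter>) X ` {C. clopen C}"
    by (intro image_eqI[of _ _ "C \<union> D"]) (auto simp: clopen_Un)
qed

text \<open>
  Caratheodory's theorem.  Continuity at the empty set is automatic: a decreasing sequence of clopen
  subsets of the compact space \<open>X\<close> with empty intersection is eventually empty.
\<close>
lemma additive_on_clopens_extends:
  fixes X :: "('g::countable \<Rightarrow> 'a::{finite,discrete_topology}) set"
  assumes X: "closed X" and p0: "\<And>A. A \<in> relative_clopens X \<Longrightarrow> 0 \<le> p A" and p1: "p X = 1"
    and add: "\<And>A B. A \<in> relative_clopens X \<Longrightarrow> B \<in> relative_clopens X \<Longrightarrow> A \<inter> B = {} \<Longrightarrow>
      p (A \<union> B) = p A + p B"
  obtains \<nu> where "prob_space \<nu>" "space \<nu> = X" "sets \<nu> = sigma_sets X (relative_clopens X)"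
    "\<And>A. A \<in> relative_clopens X \<Longrightarrow> measure \<nu> A = p A"
proof -
  interpret algebra X "relative_clopens X" by (rule algebra_relative_clopens)
  have p_empty: "p {} = 0" using add[OF empty_sets empty_sets] by simp
  have pos: "positive (relative_clopens X) (\<lambda>A. ennreal (p A))"
    unfolding positive_def p_empty by simp
  have addi: "additive (relative_clopens X) (\<lambda>A. ennreal (p A))"
    unfolding additive_def
  proof (intro ballI impI)
    fix A B assume AB: "A \<in> relative_clopens X" "B \<in> relative_clopens X" "A \<inter> B = {}"
    show "ennreal (p (A \<union> B)) = ennreal (p A) + ennreal (p B)"
      unfolding add[OF AB] using p0 AB by (intro ennreal_plus)
  qed
  have cont: "(\<lambda>i. ennreal (p (A i))) \<longlonglongrightarrow> 0"
    if A: "range A \<subseteq> relative_clopens X" "decseq A" "(\<Inter>i. A i) = {}" for A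
  proof -
    have closed: "closed (A i)" for i
    proof -
      have "A i \<in> relative_clopens X" using A(1) by blast
      then obtain C where "clopen C" "A i = X \<inter> C" by (rule relative_clopensE)
      then show ?thesis using X by (simp add: clopen_def closed_Int)
    qed
    have "\<exists>n. A n = {}"
    proof (rule ccontr)
      assume "\<nexists>n. A n = {}"
      then have ne: "A n \<noteq> {}" for n by simp
      have "UNIV \<inter> (\<Inter>i\<in>UNIV. A i) \<noteq> {}"
      proof (rule compact_imp_fip_image[OF compact_full_shift closed])
        fix I' :: "nat set" assume I': "finite I'"
        have "A (Max (insert 0 I')) \<subseteq> A i" if "i \<in> I'" for i
          by (rule decseqD[OF A(2)]) (use I' that in simp)
        then show "UNIV \<inter> (\<Inter>i\<in>I'. A i) \<noteq> {}" using ne[of "Max (insert 0 I')"] by blast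
      qed
      with A(3) show False by simp
    qed
    then obtain n where n: "A n = {}" ..
    have "A i = {}" if "i \<ge> n" for i using decseqD[OF A(2) that] n by simp
    then have "eventually (\<lambda>i. ennreal (p (A i)) = 0) sequentially"
      by (intro eventually_sequentiallyI[of n]) (simp add: p_empty)
    then show ?thesis by (rule tendsto_eventually)
  qed
  have "\<exists>\<mu>. (\<forall>s\<in>relative_clopens X. \<mu> s = ennreal (p s)) \<and>
      measure_space X (sigma_sets X (relative_clopens X)) \<mu>"
    by (rule caratheodory_empty_continuous[OF pos addi _ cont]) simp_all
  then obtain \<mu> where \<mu>: "\<And>A. A \<in> relative_clopens X \<Longrightarrow> \<mu> A = ennreal (p A)"
    "measure_space X (sigma_sets X (relative_clopens X)) \<mu>" by blast
  define \<nu> where "\<nu> = measure_of X (relative_clopens X) \<mu>"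
  have sp: "space \<nu> = X" and se: "sets \<nu> = sigma_sets X (relative_clopens X)"
    unfolding \<nu>_def using space_closed by (simp_all add: space_measure_of sets_measure_of)
  have em: "emeasure \<nu> A = ennreal (p A)" if "A \<in> relative_clopens X" for A
  proof -
    have "emeasure \<nu> A = \<mu> A"
    proof (rule emeasure_measure_of[OF \<nu>_def space_closed])
      show "positive (sets \<nu>) \<mu>" "countably_additive (sets \<nu>) \<mu>"
        unfolding se using \<mu>(2) by (simp_all add: measure_space_def)
      show "A \<in> sets \<nu>" unfolding se using that by (rule sigma_sets.Basic)
    qed
    then show ?thesis using \<mu>(1)[OF that] by simp
  qed
  have prob: "prob_space \<nu>"
    by (rule prob_spaceI) (simp add: sp em[OF top] p1)
  have meas: "measure \<nu> A = p A" if "A \<in> relative_clopens X" for A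
    using em[OF that] p0[OF that] by (simp add: measure_def)
  show ?thesis by (rule that[OF prob sp se meas])
qed

lemma invariant_measuresD:
  assumes "\<nu> \<in> invariant_measures X"
  shows "prob_space \<nu>" "sets \<nu> = sets (restrict_space borel X)" "space \<nu> = X"
    "distr \<nu> \<nu> (shift g) = \<nu>"
proof -
  show "prob_space \<nu>" "sets \<nu> = sets (restrict_space borel X)" "distr \<nu> \<nu> (shift g) = \<nu>"
    using assms by (auto simp: invariant_measures_def)
  from sets_eq_imp_space_eq[OF this(2)] show "space \<nu> = X" by (simp add: space_restrict_space)
qed

lemma borel_measurable_bcontfun:
  fixes \<phi> :: "'x::topological_space \<Rightarrow>\<^sub>C real"
  assumes "sets \<nu> = sets (restrict_space borel X)"
  shows "apply_bcontfun \<phi> \<in> borel_measurable \<nu>"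
proof -
  have "continuous_on UNIV (apply_bcontfun \<phi>)" using apply_bcontfun[of \<phi>] by (simp add: bcontfun_def)
  then have "apply_bcontfun \<phi> \<in> borel_measurable borel" by (rule borel_measurable_continuous_onI)
  then have "apply_bcontfun \<phi> \<in> borel_measurable (restrict_space borel X)" by (rule measurable_restrict_space1)
  then show ?thesis by (simp only: measurable_cong_sets[OF assms refl])
qed

lemma abs_bcontfun_le: "\<bar>apply_bcontfun \<phi> x\<bar> \<le> norm (\<phi> :: 'x::topological_space \<Rightarrow>\<^sub>C real)"
  using norm_bounded[of \<phi> x] by simp

lemma integrable_bcontfun:
  fixes \<phi> :: "'x::topological_space \<Rightarrow>\<^sub>C real"
  assumes "prob_space \<nu>" "sets \<nu> = sets (restrict_space borel X)"
  shows "integrable \<nu> (apply_bcontfun \<phi>)"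
proof -
  interpret prob_space \<nu> by fact
  show ?thesis
    by (rule integrable_const_bound[of _ "norm \<phi>"]) (simp_all add: abs_bcontfun_le borel_measurable_bcontfun[OF assms(2)])
qed

text \<open>
  The frequencies with which the orbits along \<open>F n\<close> visit sets have a limit \<open>p\<close> along a filter.  It is
  finitely additive, hence extends from the clopen sets to a measure; it is invariant because \<open>F n\<close> is
  nearly invariant under left translation.  Averages of continuous functions converge to integrals as
  these functions are uniform limits of functions of finitely many coordinates.
\<close>
theorem empirical_measures_accumulate:
  fixes X :: "('g::{group_add,countable} \<Rightarrow> 'a::{finite,discrete_topology}) set"
  assumes F: "folner_sequence F" and X: "subshift X" and x: "\<And>n. x n \<in> X"
  obtains \<nu> G where "\<nu> \<in> invariant_measures X" "G \<noteq> bot" "G \<le> sequentially"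
    "\<And>\<phi>. ((\<lambda>n. ergodic_sum (apply_bcontfun \<phi>) (F n) (x n) / real (card (F n)))
       \<longlongrightarrow> integral\<^sup>L \<nu> (apply_bcontfun \<phi>)) G"
proof -
  have fin: "finite (F n)" for n using F by (auto simp: folner_sequence_def)
  have shX: "shift g z \<in> X" if "z \<in> X" for g z
    using X that by (auto simp: subshift_def)
  have clX: "closed X" using X by (simp add: subshift_def)
  define m where "m n C = empirical (F n) (x n) C" for n C
  have "m n C \<in> {0..1}" for n C unfolding m_def by (rule empirical_bounds[OF fin])
  then obtain G p where G: "G \<noteq> bot" "G \<le> sequentially" and p: "\<And>C. ((\<lambda>n. m n C) \<longlongrightarrow> p C) G"
    by (rule bounded_sequences_limit_filter[of m]) (rule that)
  have mX: "m n (X \<inter> C) = m n C" for n C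
    unfolding m_def empirical_def using shX[OF x] by simp
  have pX: "p (X \<inter> C) = p C" for C
    using tendsto_unique[OF G(1) p[of "X \<inter> C", unfolded mX] p] .
  have p0: "0 \<le> p C" for C
    by (rule tendsto_lowerbound[OF p _ G(1)]) (simp add: m_def empirical_def)
  have p1: "p X = 1"
  proof -
    have "m n X = 1" if "n \<ge> 1" for n
      using folner_card_pos[OF F that] shX[OF x] by (simp add: m_def empirical_def)
    then have "eventually (\<lambda>n. m n X = 1) sequentially" by (rule eventually_sequentiallyI)
    then have "eventually (\<lambda>n. m n X = 1) G" using G(2) by (rule filter_leD[rotated])
    then have "((\<lambda>n. m n X) \<longlongrightarrow> 1) G" by (rule tendsto_eventually)
    from tendsto_unique[OF G(1) p this] show ?thesis .
  qed
  have padd: "p (A \<union> B) = p A + p B" if "A \<inter> B = {}" for A B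
  proof -
    have "m n (A \<union> B) = m n A + m n B" for n unfolding m_def by (rule empirical_Un[OF fin that])
    then have "((\<lambda>n. m n A + m n B) \<longlongrightarrow> p (A \<union> B)) G" using p[of "A \<union> B"] by simp
    from tendsto_unique[OF G(1) this tendsto_add[OF p p]] show ?thesis .
  qed
  have pshift: "p (shift h -` C) = p C" for h C
  proof -
    have "(\<lambda>n. real (card (sym_diff {k + f | k f. k \<in> {h} \<and> f \<in> F n} (F n))) / real (card (F n))) \<longlonglongrightarrow> 0"
      using F unfolding folner_sequence_def by blast
    then have "(\<lambda>n. m n (shift h -` C) - m n C) \<longlonglongrightarrow> 0"
      by (rule Lim_null_comparison[rotated])
        (simp only: m_def real_norm_def, intro always_eventually allI empirical_vimage_shift fin)
    then have "((\<lambda>n. m n (shift h -` C) - m n C) \<longlongrightarrow> 0) G"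
      by (rule tendsto_mono[OF G(2)])
    from tendsto_unique[OF G(1) tendsto_diff[OF p p] this] show ?thesis by simp
  qed
  obtain \<nu> where \<nu>: "prob_space \<nu>" "space \<nu> = X" "sets \<nu> = sigma_sets X (relative_clopens X)"
    and meas: "\<And>A. A \<in> relative_clopens X \<Longrightarrow> measure \<nu> A = p A"
    by (rule additive_on_clopens_extends[OF clX, of p], rule p0, rule p1, rule padd, assumption) blast
  interpret prob_space \<nu> by fact
  interpret A: algebra X "relative_clopens X" by (rule algebra_relative_clopens)
  have sets: "sets \<nu> = sets (restrict_space borel X)"
    unfolding \<nu>(3) sets_restrict_borel_clopen[OF clX] ..
  have vim1: "shift g -` D \<inter> X = X \<inter> shift g -` C" if "D = X \<inter> C" for g C D
    unfolding that using shX by blast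
  have vim2: "X \<inter> shift g -` C \<in> relative_clopens X" if "clopen C" for g C
    by (intro relative_clopensI clopen_vimage_shift that)
  have shift_meas: "shift g \<in> measurable \<nu> \<nu>" for g
  proof (rule measurable_sigma_sets[OF \<nu>(3) A.space_closed])
    show "shift g \<in> space \<nu> \<rightarrow> X" using shX \<nu>(2) by auto
    fix D assume "D \<in> relative_clopens X"
    then obtain C where C: "clopen C" "D = X \<inter> C" by (rule relative_clopensE)
    from vim2[OF C(1), of g] show "shift g -` D \<inter> space \<nu> \<in> sets \<nu>"
      unfolding \<nu>(2,3) vim1[OF C(2)] by (rule sigma_sets.Basic)
  qed
  have "distr \<nu> \<nu> (shift g) = \<nu>" for g
  proof (rule measure_eqI_generator_eq[where E = "relative_clopens X" and \<Omega> = X and A = "\<lambda>_. X"])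
    show "Int_stable (relative_clopens X)" by (auto simp: Int_stable_def)
    show "relative_clopens X \<subseteq> Pow X" by (rule A.space_closed)
    show "range (\<lambda>_. X) \<subseteq> relative_clopens X" by auto
    show "emeasure (distr \<nu> \<nu> (shift g)) X \<noteq> \<infinity>"
      using emeasure_distr[OF shift_meas, of X g] \<nu>(2) sets.top[of \<nu>] by (simp add: emeasure_eq_measure)
    show "sets (distr \<nu> \<nu> (shift g)) = sigma_sets X (relative_clopens X)" "sets \<nu> = sigma_sets X (relative_clopens X)"
      using \<nu>(3) by simp_all
    fix D assume D: "D \<in> relative_clopens X"
    then obtain C where C: "clopen C" "D = X \<inter> C" by (rule relative_clopensE)
    note v = vim1[OF C(2), of g] vim2[OF C(1), of g]
    have "D \<in> sets \<nu>" unfolding \<nu>(3) using D by (rule sigma_sets.Basic)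
    then have "emeasure (distr \<nu> \<nu> (shift g)) D = emeasure \<nu> (shift g -` D \<inter> X)"
      using shift_meas[of g] \<nu>(2) by (simp add: emeasure_distr)
    also have "\<dots> = ennreal (p (X \<inter> shift g -` C))"
      unfolding v(1) using meas[OF v(2)] by (simp add: emeasure_eq_measure)
    also have "\<dots> = ennreal (p D)" by (simp only: pX pshift C(2))
    also have "\<dots> = emeasure \<nu> D" using meas[OF D] by (simp add: emeasure_eq_measure)
    finally show "emeasure (distr \<nu> \<nu> (shift g)) D = emeasure \<nu> D" .
  qed auto
  then have inv: "\<nu> \<in> invariant_measures X"
    using \<nu>(1) sets by (simp add: invariant_measures_def)
  have "((\<lambda>n. ergodic_sum (apply_bcontfun \<phi>) (F n) (x n) / real (card (F n)))
       \<longlongrightarrow> integral\<^sup>L \<nu> (apply_bcontfun \<phi>)) G" for \<phi>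
  proof (rule tendstoI)
    fix \<epsilon> :: real assume "\<epsilon> > 0"
    then have e3: "\<epsilon> / 3 > 0" by simp
    let ?f = "apply_bcontfun \<phi>"
    obtain E where E: "finite E" "\<And>x. \<bar>?f x - ?f (restrict x E)\<bar> < \<epsilon> / 3"
      by (rule locally_constant_approximation[OF e3, of \<phi>]) (rule that)
    let ?h = "\<lambda>x. ?f (restrict x E)"
    have cyl: "X \<inter> cylinder E w \<in> relative_clopens X" if "w \<in> PiE E (\<lambda>_. UNIV)" for w
      using that by (intro relative_clopensI clopen_cylinder[OF E(1)]) (simp add: PiE_def)
    have cyl': "cylinder E w \<inter> X \<in> sets \<nu>" if "w \<in> PiE E (\<lambda>_. UNIV)" for w
      using cyl[OF that] unfolding \<nu>(3) by (simp add: Int_commute sigma_sets.Basic)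
    have int: "integrable \<nu> ?h"
      "integral\<^sup>L \<nu> ?h = (\<Sum>w\<in>PiE E (\<lambda>_. UNIV). ?f w * measure \<nu> (cylinder E w \<inter> X))"
      by (rule integral_locally_constant[OF \<nu>(1,2) E(1)], erule cyl')+
    have "integral\<^sup>L \<nu> ?h = (\<Sum>w\<in>PiE E (\<lambda>_. UNIV). ?f w * p (cylinder E w))"
      unfolding int(2)
    proof (rule sum.cong[OF refl])
      fix w :: "'g \<Rightarrow> 'a" assume "w \<in> PiE E (\<lambda>_. UNIV)"
      then have "measure \<nu> (cylinder E w \<inter> X) = p (cylinder E w)"
        using meas[OF cyl] by (simp add: Int_commute[of _ X] pX)
      then show "?f w * measure \<nu> (cylinder E w \<inter> X) = ?f w * p (cylinder E w)" by simp
    qed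
    then have "((\<lambda>n. ergodic_sum ?h (F n) (x n) / real (card (F n))) \<longlongrightarrow> integral\<^sup>L \<nu> ?h) G"
      unfolding ergodic_average_locally_constant[OF fin E(1)] m_def[symmetric]
      using p by (auto intro!: tendsto_sum tendsto_mult_left)
    from tendstoD[OF this e3]
    show "eventually (\<lambda>n. dist (ergodic_sum ?f (F n) (x n) / real (card (F n))) (integral\<^sup>L \<nu> ?f) < \<epsilon>) G"
    proof eventually_elim
      case (elim n)
      have "\<bar>ergodic_sum ?f (F n) (x n) - ergodic_sum ?h (F n) (x n)\<bar> \<le> (\<Sum>g\<in>F n. \<bar>?f (shift g (x n)) - ?h (shift g (x n))\<bar>)"
        unfolding ergodic_sum_def sum_subtractf[symmetric] by (rule sum_abs)
      also have "\<dots> \<le> (\<Sum>g\<in>F n. \<epsilon> / 3)" using E(2) by (intro sum_mono less_imp_le)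
      also have "\<dots> = real (card (F n)) * (\<epsilon> / 3)" by simp
      finally have "\<bar>ergodic_sum ?f (F n) (x n) / real (card (F n)) - ergodic_sum ?h (F n) (x n) / real (card (F n))\<bar> \<le> \<epsilon> / 3"
        using e3 by (cases "card (F n) = 0") (simp_all add: diff_divide_distrib[symmetric] field_simps)
      moreover have "\<bar>integral\<^sup>L \<nu> ?f - integral\<^sup>L \<nu> ?h\<bar> \<le> \<epsilon> / 3"
      proof -
        have int_f: "integrable \<nu> ?f" by (rule integrable_bcontfun[OF \<nu>(1) sets])
        have "\<bar>integral\<^sup>L \<nu> ?f - integral\<^sup>L \<nu> ?h\<bar> = \<bar>\<integral>x. ?f x - ?h x \<partial>\<nu>\<bar>"
          using int_f int(1) by simp
        also have "\<dots> \<le> (\<integral>x. \<bar>?f x - ?h x\<bar> \<partial>\<nu>)" by (rule integral_abs_bound)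
        also have "\<dots> \<le> \<epsilon> / 3"
          using E(2) int_f int(1) by (intro integral_le_const) (auto intro: less_imp_le)
        finally show ?thesis .
      qed
      ultimately show ?case using elim unfolding dist_real_def by linarith
    qed
  qed
  with inv G show ?thesis by (rule that)
qed

section \<open>Pressure and ground state energy\<close>
text \<open>
  Every single term of the sequence that defines the pressure is at least the integral: the ergodic sum
  at any point of \<open>X\<close> is at most the logarithm of the partition function, and by invariance it
  integrates to \<open>card (F n)\<close> times the integral of \<open>\<phi>\<close>.
\<close>
lemma integral_le_pressure:
  fixes X :: "('g::{group_add,countable} \<Rightarrow> 'a::{finite,discrete_topology}) set"
  assumes F: "folner_sequence F" and X: "subshift X" and \<nu>: "\<nu> \<in> invariant_measures X"
  shows "integral\<^sup>L \<nu> (apply_bcontfun \<phi>) \<le> pressure F X \<phi>"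
proof (rule LIMSEQ_le_const[OF tendsto_pressure[OF F X]], intro exI[of _ 1] allI impI)
  fix n :: nat assume n: "1 \<le> n"
  note D = invariant_measuresD[OF \<nu>]
  interpret prob_space \<nu> by (rule D)
  let ?f = "apply_bcontfun \<phi>"
  note meas = borel_measurable_bcontfun[OF D(2), of \<phi>]
  have fin: "finite (F n)" "F n \<noteq> {}" using folner_card_pos[OF F n] .
  have shX: "shift g z \<in> X" if "z \<in> X" for g z using X that by (auto simp: subshift_def)
  have shm: "shift g \<in> measurable \<nu> \<nu>" for g
  proof -
    have "shift g \<in> measurable borel borel"
      by (rule borel_measurable_continuous_onI[OF continuous_shift])
    then have "shift g \<in> measurable (restrict_space borel X) (restrict_space borel X)"
      using shX by (intro measurable_restrict_space3) auto
    then show ?thesis by (simp only: measurable_cong_sets[OF D(2) D(2)])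
  qed
  have int: "integrable \<nu> (\<lambda>x. ?f (shift g x))" for g
    by (rule integrable_const_bound[of _ "norm \<phi>"])
      (use measurable_compose[OF shm meas] in \<open>simp_all add: abs_bcontfun_le\<close>)
  have shift: "integral\<^sup>L \<nu> (\<lambda>x. ?f (shift g x)) = integral\<^sup>L \<nu> ?f" for g
    using integral_distr[OF shm meas, of g] unfolding D(4) by simp
  have "real (card (F n)) * integral\<^sup>L \<nu> ?f = integral\<^sup>L \<nu> (ergodic_sum ?f (F n))"
    unfolding ergodic_sum_def using int by (simp add: Bochner_Integration.integral_sum shift)
  also have "\<dots> \<le> ln (partition_function X (F n) ?f)"
  proof (rule integral_le_const)
    show "integrable \<nu> (ergodic_sum ?f (F n))"
      unfolding ergodic_sum_def using int by (intro Bochner_Integration.integrable_sum)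
    show "AE x in \<nu>. ergodic_sum ?f (F n) x \<le> ln (partition_function X (F n) ?f)"
      by (rule AE_I2) (use le_ln_partition_function[of ?f "norm \<phi>", OF abs_bcontfun_le fin(1)] D(3) in blast)
  qed
  finally show "integral\<^sup>L \<nu> ?f \<le> ln (partition_function X (F n) ?f) / real (card (F n))"
    using fin by (simp add: field_simps card_gt_0_iff)
qed

text \<open>
  There are at most \<open>CARD('a) ^ card (F n)\<close> patterns, each of weight at most the exponential of the
  maximal ergodic sum.  The measure arises from the points that attain these maxima, which for
  nonnegative \<open>\<beta>\<close> do not depend on \<open>\<beta>\<close>.
\<close>
lemma pressure_le_integral:
  fixes X :: "('g::{group_add,countable} \<Rightarrow> 'a::{finite,discrete_topology}) set"
  assumes F: "folner_sequence F" and X: "subshift X"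
  obtains \<nu> where "\<nu> \<in> invariant_measures X"
    "\<And>\<beta>. 0 \<le> \<beta> \<Longrightarrow> pressure F X (\<beta> *\<^sub>R \<phi>) \<le> ln CARD('a) + \<beta> * integral\<^sup>L \<nu> (apply_bcontfun \<phi>)"
proof -
  let ?f = "apply_bcontfun \<phi>"
  have cont: "continuous_on UNIV ?f" using apply_bcontfun[of \<phi>] by (simp add: bcontfun_def)
  have X': "closed X" "X \<noteq> {}" using X by (auto simp: subshift_def)
  have "compact X" using compact_Int_closed[OF compact_full_shift X'(1)] by simp
  have "\<exists>x\<in>X. \<forall>y\<in>X. ergodic_sum ?f (F n) y \<le> ergodic_sum ?f (F n) x" for n
  proof (rule continuous_attains_sup[OF \<open>compact X\<close> X'(2)])
    have "continuous_on X (\<lambda>x. ?f (shift g x))" for g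
      by (rule continuous_on_compose2[OF cont continuous_on_subset[OF continuous_shift]]) auto
    then show "continuous_on X (ergodic_sum ?f (F n))"
      unfolding ergodic_sum_def by (intro continuous_on_sum)
  qed
  then obtain x where x: "\<And>n. x n \<in> X" "\<And>n y. y \<in> X \<Longrightarrow> ergodic_sum ?f (F n) y \<le> ergodic_sum ?f (F n) (x n)"
    by metis
  obtain \<nu> G where \<nu>: "\<nu> \<in> invariant_measures X" and G: "G \<noteq> bot" "G \<le> sequentially"
    and lim: "\<And>\<phi>. ((\<lambda>n. ergodic_sum (apply_bcontfun \<phi>) (F n) (x n) / real (card (F n)))
       \<longlongrightarrow> integral\<^sup>L \<nu> (apply_bcontfun \<phi>)) G"
    by (rule empirical_measures_accumulate[where x = x, OF F X x(1)]) (rule that)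
  have "pressure F X (\<beta> *\<^sub>R \<phi>) \<le> ln CARD('a) + \<beta> * integral\<^sup>L \<nu> ?f" if \<beta>: "0 \<le> \<beta>" for \<beta>
  proof (rule tendsto_le[OF G(1)])
    let ?g = "apply_bcontfun (\<beta> *\<^sub>R \<phi>)"
    show "((\<lambda>n. ln (partition_function X (F n) ?g) / real (card (F n))) \<longlongrightarrow> pressure F X (\<beta> *\<^sub>R \<phi>)) G"
      by (rule tendsto_mono[OF G(2) tendsto_pressure[OF F X]])
    show "((\<lambda>n. ln (real CARD('a)) + \<beta> * (ergodic_sum ?f (F n) (x n) / real (card (F n))))
        \<longlongrightarrow> ln (real CARD('a)) + \<beta> * integral\<^sup>L \<nu> ?f) G"
      by (intro tendsto_intros lim)
    have "eventually (\<lambda>n. 1 \<le> n) G"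
      by (rule filter_leD[OF G(2) eventually_ge_at_top])
    then show "eventually (\<lambda>n. ln (partition_function X (F n) ?g) / real (card (F n)) \<le>
        ln (real CARD('a)) + \<beta> * (ergodic_sum ?f (F n) (x n) / real (card (F n)))) G"
    proof eventually_elim
      case (elim n)
      note fin = folner_card_pos[OF F elim]
      have "ergodic_sum ?g (F n) y \<le> \<beta> * ergodic_sum ?f (F n) (x n)" if "y \<in> X" for y
      proof -
        have "ergodic_sum ?g (F n) y = \<beta> * ergodic_sum ?f (F n) y"
          by (simp add: ergodic_sum_def scaleR_bcontfun.rep_eq sum_distrib_left)
        then show ?thesis using x(2)[OF that, of n] \<beta> by (simp add: mult_left_mono)
      qed
      from ln_partition_function_le[OF fin(1) X'(2) this]
      show ?case using fin by (simp add: field_simps card_gt_0_iff)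
    qed
  qed
  with \<nu> show ?thesis by (rule that)
qed

lemma ground_state_energy_pressure:
  fixes X :: "('g::{group_add,countable} \<Rightarrow> 'a::{finite,discrete_topology}) set"
  assumes F: "folner_sequence F" and X: "subshift X" and \<beta>: "0 < \<beta>"
  shows "\<bar>pressure F X (\<beta> *\<^sub>R \<phi>) / \<beta> - ground_state_energy X \<phi>\<bar> \<le> ln CARD('a) / \<beta>"
proof -
  obtain \<nu> where \<nu>: "\<nu> \<in> invariant_measures X"
    "\<And>\<beta>. 0 \<le> \<beta> \<Longrightarrow> pressure F X (\<beta> *\<^sub>R \<phi>) \<le> ln CARD('a) + \<beta> * integral\<^sup>L \<nu> (apply_bcontfun \<phi>)"
    by (rule pressure_le_integral[where \<phi> = \<phi>, OF F X]) (rule that)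
  have "bdd_above ((\<lambda>\<nu>. integral\<^sup>L \<nu> (apply_bcontfun \<phi>)) ` invariant_measures X)"
  proof (rule bdd_aboveI2)
    fix \<mu> assume "\<mu> \<in> invariant_measures X"
    note D = invariant_measuresD[OF this]
    show "integral\<^sup>L \<mu> (apply_bcontfun \<phi>) \<le> norm \<phi>"
      using abs_bcontfun_le[of \<phi>]
      by (intro prob_space.integral_le_const[OF D(1)] integrable_bcontfun[OF D(1,2)]) (auto simp: abs_le_iff)
  qed
  then have "integral\<^sup>L \<nu> (apply_bcontfun \<phi>) \<le> ground_state_energy X \<phi>"
    unfolding ground_state_energy_def using \<nu>(1) by (intro cSUP_upper)
  then have "\<beta> * integral\<^sup>L \<nu> (apply_bcontfun \<phi>) \<le> \<beta> * ground_state_energy X \<phi>" using \<beta> by simp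
  then have 1: "pressure F X (\<beta> *\<^sub>R \<phi>) \<le> ln CARD('a) + \<beta> * ground_state_energy X \<phi>"
    using \<nu>(2)[of \<beta>] \<beta> by linarith
  have "ground_state_energy X \<phi> \<le> pressure F X (\<beta> *\<^sub>R \<phi>) / \<beta>"
    unfolding ground_state_energy_def
  proof (rule cSUP_least)
    show "invariant_measures X \<noteq> {}" using \<nu>(1) by blast
    fix \<mu> assume \<mu>: "\<mu> \<in> invariant_measures X"
    have "\<beta> * integral\<^sup>L \<mu> (apply_bcontfun \<phi>) = integral\<^sup>L \<mu> (apply_bcontfun (\<beta> *\<^sub>R \<phi>))"
      by (simp add: scaleR_bcontfun.rep_eq)
    also have "\<dots> \<le> pressure F X (\<beta> *\<^sub>R \<phi>)" by (rule integral_le_pressure[OF F X \<mu>])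
    finally show "integral\<^sup>L \<mu> (apply_bcontfun \<phi>) \<le> pressure F X (\<beta> *\<^sub>R \<phi>) / \<beta>"
      using \<beta> by (simp add: field_simps)
  qed
  moreover have "pressure F X (\<beta> *\<^sub>R \<phi>) / \<beta> \<le> (ln CARD('a) + \<beta> * ground_state_energy X \<phi>) / \<beta>"
    using 1 \<beta> by (intro divide_right_mono) simp_all
  moreover have "(ln CARD('a) + \<beta> * ground_state_energy X \<phi>) / \<beta> = ln CARD('a) / \<beta> + ground_state_energy X \<phi>"
    using \<beta> by (simp add: add_divide_distrib)
  moreover have "0 \<le> ln CARD('a) / \<beta>" using \<beta> by simp
  ultimately show ?thesis by linarith
qed

section \<open>Register programs on Turing machines\<close>
text \<open>
  Structured programs on registers that hold natural numbers.  \<open>Ask\<close> replaces the contents of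
  register 1, which lives on the oracle tape, by the answer of the oracle; \<open>Loop r\<close> runs as long as
  register \<open>r\<close> is nonzero.
\<close>
datatype cmd = Inc nat | Dec nat | Ask | Seq cmd cmd | Cond nat cmd cmd | Loop nat cmd

inductive exec :: "(nat \<Rightarrow> nat) \<Rightarrow> cmd \<Rightarrow> (nat \<Rightarrow> nat) \<Rightarrow> (nat \<Rightarrow> nat) \<Rightarrow> bool"
  for \<gamma> where
  Inc: "exec \<gamma> (Inc r) v (v(r := Suc (v r)))"
| Dec: "exec \<gamma> (Dec r) v (v(r := v r - 1))"
| Ask: "exec \<gamma> Ask v (v(1 := \<gamma> (v 1)))"
| Seq: "exec \<gamma> c v v' \<Longrightarrow> exec \<gamma> d v' v'' \<Longrightarrow> exec \<gamma> (Seq c d) v v''"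
| Cond_nonzero: "v r \<noteq> 0 \<Longrightarrow> exec \<gamma> c v v' \<Longrightarrow> exec \<gamma> (Cond r c d) v v'"
| Cond_zero: "v r = 0 \<Longrightarrow> exec \<gamma> d v v' \<Longrightarrow> exec \<gamma> (Cond r c d) v v'"
| Loop_zero: "v r = 0 \<Longrightarrow> exec \<gamma> (Loop r c) v v"
| Loop_nonzero:
    "v r \<noteq> 0 \<Longrightarrow> exec \<gamma> c v v' \<Longrightarrow> exec \<gamma> (Loop r c) v' v'' \<Longrightarrow> exec \<gamma> (Loop r c) v v''"

text \<open>
  Register \<open>r\<close> is kept in unary on tape \<open>r\<close>, with the head on its first symbol.  Incrementing takes
  two instructions, since the head has to move left to the blank cell before
  it can write there.
\<close>
datatype instr = Go_Left nat | Put_One nat | Erase nat | Jump_Zero nat nat | Jump nat | Query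

fun code_length :: "cmd \<Rightarrow> nat" where
  "code_length (Inc r) = 2"
| "code_length (Dec r) = 1"
| "code_length Ask = 1"
| "code_length (Seq c d) = code_length c + code_length d"
| "code_length (Cond r c d) = code_length c + code_length d + 2"
| "code_length (Loop r c) = code_length c + 2"

text \<open>
  The first argument is the address of the first instruction.  Addresses are states of the machine, and
  execution falls through to the address after the last instruction.
\<close>
fun code :: "nat \<Rightarrow> cmd \<Rightarrow> instr list" where
  "code q (Inc r) = [Go_Left r, Put_One r]"
| "code q (Dec r) = [Erase r]"
| "code q Ask = [Query]"
| "code q (Seq c d) = code q c @ code (q + code_length c) d"
| "code q (Cond r c d) =
     Jump_Zero r (q + code_length c + 2) # code (q + 1) c @
     Jump (q + code_length c + code_length d + 2) # code (q + code_length c + 2) d"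
| "code q (Loop r c) = Jump_Zero r (q + code_length c + 2) # code (q + 1) c @ [Jump q]"

lemma length_code [simp]: "length (code q c) = code_length c"
  by (induction c arbitrary: q) auto

fun registers :: "cmd \<Rightarrow> nat set" where
  "registers (Inc r) = {r}"
| "registers (Dec r) = {r}"
| "registers Ask = {1}"
| "registers (Seq c d) = registers c \<union> registers d"
| "registers (Cond r c d) = insert r (registers c \<union> registers d)"
| "registers (Loop r c) = insert r (registers c)"

lemma finite_registers: "finite (registers c)"
  by (induction c) auto

definition keep :: "nat list \<Rightarrow> (nat \<times> direction) list" where
  "keep ss = map (\<lambda>s. (s, Stay)) ss"

fun instr_transition ::
  "nat \<Rightarrow> instr \<Rightarrow> nat \<Rightarrow> nat list \<Rightarrow> nat \<times> (nat \<times> direction) list" where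
  "instr_transition N (Go_Left r) q ss = (Suc q, (keep ss)[r := (ss ! r, Move_Left)])"
| "instr_transition N (Put_One r) q ss = (Suc q, (keep ss)[r := (1, Stay)])"
| "instr_transition N (Erase r) q ss = (Suc q, (keep ss)[r := (0, Move_Right)])"
| "instr_transition N (Jump_Zero r t) q ss = (if ss ! r = 0 then t else Suc q, keep ss)"
| "instr_transition N (Jump t) q ss = (t, keep ss)"
| "instr_transition N Query q ss = (2, (keep ss)[N := (Suc q, Stay)])"

text \<open>
  States 0 to 3 have a prescribed role, so the program is loaded at address 4, and running past its end
  leads to the halting state.  After an answer of the oracle the machine is always in state 3, whichever
  query it comes from; therefore \<open>Query\<close> first writes the state in which to resume as a symbol on the
  additional tape \<open>N\<close>, and state 3 jumps to the state that it reads there.  This is why there are as many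
  symbols as states.
\<close>
definition code_machine :: "nat \<Rightarrow> instr list \<Rightarrow> otm" where
  "code_machine N P =
     \<lparr>num_tapes = Suc N, num_states = length P + 5, num_symbols = length P + 5,
      transition = (\<lambda>q ss.
        if q = 0 then (4, keep ss)
        else if q = 3 then (ss ! N, keep ss)
        else if 4 \<le> q \<and> q < length P + 4 then instr_transition N (P ! (q - 4)) q ss
        else (1, keep ss))\<rparr>"

lemma length_keep [simp]: "length (keep ss) = length ss"
  by (simp add: keep_def)

lemma nth_keep [simp]: "r < length ss \<Longrightarrow> keep ss ! r = (ss ! r, Stay)"
  by (simp add: keep_def)

definition bounded_jump :: "nat \<Rightarrow> instr \<Rightarrow> bool" where
  "bounded_jump B i = (case i of Jump_Zero r t \<Rightarrow> t \<le> B | Jump t \<Rightarrow> t \<le> B | _ \<Rightarrow> True)"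

lemma bounded_jump_mono: "bounded_jump B i \<Longrightarrow> B \<le> C \<Longrightarrow> bounded_jump C i"
  by (auto simp: bounded_jump_def split: instr.splits)

lemma bounded_jump_code: "i \<in> set (code q c) \<Longrightarrow> bounded_jump (q + code_length c) i"
proof (induction c arbitrary: q)
  case (Seq c d)
  then consider "i \<in> set (code q c)" | "i \<in> set (code (q + code_length c) d)" by auto
  then show ?case
    by cases (use Seq.IH in \<open>fastforce intro: bounded_jump_mono\<close>)+
next
  case (Cond r c d)
  then consider "i = Jump_Zero r (q + code_length c + 2)" | "i \<in> set (code (q + 1) c)"
    | "i = Jump (q + code_length c + code_length d + 2)"
    | "i \<in> set (code (q + code_length c + 2) d)" by auto
  then show ?case
  proof cases
    case 2
    from Cond.IH(1)[OF this] show ?thesis by (rule bounded_jump_mono) simp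
  next
    case 4
    from Cond.IH(2)[OF this] show ?thesis by (rule bounded_jump_mono) simp
  qed (auto simp: bounded_jump_def)
next
  case (Loop r c)
  then consider "i = Jump_Zero r (q + code_length c + 2)" | "i \<in> set (code (q + 1) c)"
    | "i = Jump q" by auto
  then show ?case
  proof cases
    case 2
    from Loop.IH[OF this] show ?thesis by (rule bounded_jump_mono) simp
  qed (auto simp: bounded_jump_def)
qed (auto simp: bounded_jump_def)

lemma turing_machine_code_machine:
  assumes "N \<ge> 2" and "\<And>i. i \<in> set P \<Longrightarrow> bounded_jump (length P + 4) i"
  shows "turing_machine (code_machine N P)"
proof -
  let ?B = "length P + 5"
  have upd: "\<forall>(s, d)\<in>set ((keep ss)[r := (s', d')]). s < ?B"
    if "\<forall>s\<in>set ss. s < ?B" "s' < ?B" for ss r s' d'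
    using that set_update_subset_insert[of "keep ss" r "(s', d')"] by (auto simp: keep_def)
  have keep: "\<forall>(s, d)\<in>set (keep ss). s < ?B" if "\<forall>s\<in>set ss. s < ?B" for ss
    using that by (auto simp: keep_def)
  have instr: "case instr_transition N i q ss of (q', as) \<Rightarrow>
      q' < ?B \<and> length as = Suc N \<and> (\<forall>(s, d)\<in>set as. s < ?B)"
    if "i \<in> set P" "length ss = Suc N" "\<forall>s\<in>set ss. s < ?B" "q < length P + 4" for i q ss
  proof -
    have b: "bounded_jump (length P + 4) i" using assms(2) that(1) .
    have nth: "ss ! r < ?B" if "r < Suc N" for r
      using that \<open>length ss = Suc N\<close> \<open>\<forall>s\<in>set ss. s < ?B\<close> by simp
    show ?thesis
    proof (cases i)
      case (Go_Left r)
      show ?thesis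
      proof (cases "r < Suc N")
        case True
        then show ?thesis using Go_Left that upd[OF that(3) nth[OF True]] by simp
      next
        case False
        then show ?thesis using Go_Left that keep[OF that(3)] by (simp add: list_update_beyond)
      qed
    next
      case (Put_One r)
      then show ?thesis using that upd[OF that(3), of 1] by simp
    next
      case (Erase r)
      then show ?thesis using that upd[OF that(3), of 0] by simp
    next
      case Query
      then show ?thesis using that upd[OF that(3), of "Suc q"] by simp
    qed (use that b keep[OF that(3)] in \<open>auto simp: bounded_jump_def\<close>)
  qed
  have "case transition (code_machine N P) q ss of (q', as) \<Rightarrow>
      q' < ?B \<and> length as = Suc N \<and> (\<forall>(s, d)\<in>set as. s < ?B)"
    if "q < ?B" "length ss = Suc N" "\<forall>s\<in>set ss. s < ?B" for q ss
  proof (cases "q \<noteq> 0 \<and> q \<noteq> 3 \<and> 4 \<le> q \<and> q < length P + 4")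
    case True
    then have "P ! (q - 4) \<in> set P" by (intro nth_mem) linarith
    from instr[OF this that(2,3)] True show ?thesis by (simp add: code_machine_def)
  next
    case False
    then show ?thesis using that keep[OF that(3)] by (auto simp: code_machine_def)
  qed
  then show ?thesis
    using assms(1) unfolding turing_machine_def by (simp add: code_machine_def)
qed

text \<open>
  Moving the head and writing leave blanks at either end of the lists, so a number has several
  representations.
\<close>
definition holds :: "tape \<Rightarrow> nat \<Rightarrow> bool" where
  "holds t n \<longleftrightarrow> (\<exists>i j. t = (replicate i 0, replicate n 1 @ replicate j 0))"

lemma holdsI: "t = (replicate i 0, replicate n 1 @ replicate j 0) \<Longrightarrow> holds t n"
  by (auto simp: holds_def)

lemma holds_empty: "holds ([], []) 0"
  by (auto simp: holds_def)

lemma holds_tape_of_nat: "holds (tape_of_nat n) n"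
  unfolding holds_def tape_of_nat_def by (rule exI[of _ 0], rule exI[of _ 0]) simp

lemma nat_of_tape_holds: "holds t n \<Longrightarrow> nat_of_tape t = n"
proof -
  assume "holds t n"
  then obtain i j where t: "t = (replicate i 0, replicate n 1 @ replicate j 0)"
    by (auto simp: holds_def)
  have "takeWhile (\<lambda>s. s = (1::nat)) (replicate j 0) = []" by (cases j) auto
  then show ?thesis unfolding nat_of_tape_def t
    by (subst snd_conv, subst takeWhile_append2) auto
qed

lemma read_tape_holds: "holds t n \<Longrightarrow> read_tape t = (if n = 0 then 0 else 1)"
proof -
  assume "holds t n"
  then obtain i j where t: "t = (replicate i 0, replicate n 1 @ replicate j 0)"
    by (auto simp: holds_def)
  show ?thesis unfolding read_tape_def t
    by (cases n; cases j) auto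
qed

lemma holds_keep: "holds t n \<Longrightarrow> holds (act_tape (read_tape t, Stay) t) n"
proof -
  assume h: "holds t n"
  then obtain i j where t: "t = (replicate i 0, replicate n 1 @ replicate j 0)"
    by (auto simp: holds_def)
  show ?thesis
  proof (cases n)
    case 0
    then show ?thesis unfolding t
      by (intro holdsI[of _ i _ "Suc (j - 1)"]) (cases j; simp add: read_tape_def)
  next
    case (Suc k)
    then show ?thesis unfolding t
      by (intro holdsI[of _ i _ j]) (simp add: read_tape_def)
  qed
qed

lemma holds_inc:
  "holds t n \<Longrightarrow> holds (act_tape (1, Stay) (act_tape (read_tape t, Move_Left) t)) (Suc n)"
proof -
  assume h: "holds t n"
  then obtain i j where t: "t = (replicate i 0, replicate n 1 @ replicate j 0)"
    by (auto simp: holds_def)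
  show ?thesis
  proof (cases n)
    case 0
    then show ?thesis unfolding t
      by (intro holdsI[of _ "i - 1" _ "Suc (j - 1)"]) (cases i; cases j; simp add: read_tape_def)
  next
    case (Suc k)
    then show ?thesis unfolding t
      by (intro holdsI[of _ "i - 1" _ j]) (cases i; simp add: read_tape_def)
  qed
qed

lemma holds_dec: "holds t n \<Longrightarrow> holds (act_tape (0, Move_Right) t) (n - 1)"
proof -
  assume h: "holds t n"
  then obtain i j where t: "t = (replicate i 0, replicate n 1 @ replicate j 0)"
    by (auto simp: holds_def)
  show ?thesis
  proof (cases n)
    case 0
    then show ?thesis unfolding t
      by (intro holdsI[of _ "Suc i" _ "j - 1"]) (cases j; simp)
  next
    case (Suc k)
    then show ?thesis unfolding t
      by (intro holdsI[of _ "Suc i" _ j]) simp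
  qed
qed

definition represents :: "nat \<Rightarrow> tape list \<Rightarrow> (nat \<Rightarrow> nat) \<Rightarrow> bool" where
  "represents N ts v \<longleftrightarrow> length ts = Suc N \<and> (\<forall>r<N. holds (ts ! r) (v r))"

definition reaches where
  "reaches \<gamma> M C C' \<longleftrightarrow> (\<exists>k. (otm_step \<gamma> M ^^ k) C = C')"

lemma reaches_trans: "reaches \<gamma> M C C' \<Longrightarrow> reaches \<gamma> M C' C'' \<Longrightarrow> reaches \<gamma> M C C''"
  unfolding reaches_def by (metis comp_apply funpow_add)

lemma reaches_step: "otm_step \<gamma> M C = C' \<Longrightarrow> reaches \<gamma> M C C'"
  unfolding reaches_def by (-, rule exI[of _ 1]) simp

lemma represents_keep:
  assumes "represents N ts v"
  shows "represents N (map2 act_tape (keep (map read_tape ts)) ts) v"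
  using assms by (auto simp: represents_def holds_keep)

lemma represents_update:
  assumes "represents N ts v" and "holds (act_tape a (ts ! r)) n"
  shows "represents N (map2 act_tape ((keep (map read_tape ts))[r := a]) ts) (v(r := n))"
  using assms by (auto simp: represents_def holds_keep nth_list_update)

lemma code_machine_step:
  assumes "q = length P' + 4"
  shows "otm_step \<gamma> (code_machine N (P' @ i # P'')) (q, ts) =
    (case instr_transition N i q (map read_tape ts) of (q', as) \<Rightarrow> (q', map2 act_tape as ts))"
  using assms by (simp add: otm_step_def code_machine_def)

text \<open>
  The contents of tape \<open>N\<close> are left unspecified by \<open>represents\<close>, because its symbol is rewritten before
  each query.
\<close>
lemma code_machine_simulates:
  assumes "exec \<gamma> c v v'" and "P = P' @ code q c @ P''" and "q = length P' + 4"
    and "represents N ts v" and "registers c \<subseteq> {..<N}" and "N \<ge> 2"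
  shows "\<exists>ts'. reaches \<gamma> (code_machine N P) (q, ts) (q + code_length c, ts') \<and> represents N ts' v'"
  using assms(1-5)
proof (induction arbitrary: P' P'' q ts rule: exec.induct)
  case (Inc r v)
  let ?M = "code_machine N P"
  define ts1 where "ts1 = map2 act_tape ((keep (map read_tape ts))[r := (read_tape (ts ! r), Move_Left)]) ts"
  define ts2 where "ts2 = map2 act_tape ((keep (map read_tape ts1))[r := (1, Stay)]) ts1"
  have r: "r < N" using Inc by simp
  have len: "length ts = Suc N" using Inc by (simp add: represents_def)
  have P: "P = P' @ Go_Left r # Put_One r # P''" using Inc by simp
  have s1: "otm_step \<gamma> ?M (q, ts) = (Suc q, ts1)"
    using code_machine_step[OF \<open>q = length P' + 4\<close>, of \<gamma> N "Go_Left r" "Put_One r # P''" ts] r len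
    by (simp add: P ts1_def)
  have s2: "otm_step \<gamma> ?M (Suc q, ts1) = (Suc (Suc q), ts2)"
    using code_machine_step[of "Suc q" "P' @ [Go_Left r]" \<gamma> N "Put_One r" P'' ts1] Inc
    by (simp add: P ts2_def)
  have "represents N ts2 (v(r := Suc (v r)))"
    using Inc(3) r len unfolding represents_def ts2_def ts1_def
    by (auto simp: nth_list_update holds_inc[simplified] holds_keep)
  then show ?case
    using reaches_trans[OF reaches_step[OF s1] reaches_step[OF s2]] by (auto simp: fun_upd_def)
next
  case (Dec r v)
  let ?ts = "map2 act_tape ((keep (map read_tape ts))[r := (0, Move_Right)]) ts"
  have s: "otm_step \<gamma> (code_machine N P) (q, ts) = (Suc q, ?ts)"
    using code_machine_step[OF \<open>q = length P' + 4\<close>, of \<gamma> N "Erase r" P'' ts] Dec by simp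
  have "represents N ?ts (v(r := v r - 1))"
    using Dec by (intro represents_update holds_dec) (auto simp: represents_def)
  then show ?case using reaches_step[OF s] by (auto simp: fun_upd_def)
next
  case (Ask v)
  let ?M = "code_machine N P"
  let ?ts1 = "map2 act_tape ((keep (map read_tape ts))[N := (Suc q, Stay)]) ts"
  let ?ts2 = "?ts1[1 := tape_of_nat (\<gamma> (nat_of_tape (?ts1 ! 1)))]"
  let ?ts3 = "map2 act_tape (keep (map read_tape ?ts2)) ?ts2"
  have len: "length ts = Suc N" using Ask by (simp add: represents_def)
  have P: "P = P' @ Query # P''" using Ask by simp
  have s1: "otm_step \<gamma> ?M (q, ts) = (2, ?ts1)"
    using code_machine_step[OF \<open>q = length P' + 4\<close>, of \<gamma> N Query P'' ts] P by simp
  have s2: "otm_step \<gamma> ?M (2, ?ts1) = (3, ?ts2)"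
    by (simp add: otm_step_def)
  obtain l u where lu: "ts ! N = (l, u)" by force
  have "map read_tape ?ts2 ! N = Suc q"
    using len \<open>N \<ge> 2\<close> by (simp add: lu) (simp add: read_tape_def)
  then have s3: "otm_step \<gamma> ?M (3, ?ts2) = (Suc q, ?ts3)"
    by (simp add: otm_step_def code_machine_def)
  have r1: "represents N ?ts1 v"
    using Ask(3) len unfolding represents_def by (auto simp: holds_keep)
  then have "nat_of_tape (?ts1 ! 1) = v 1"
    using \<open>N \<ge> 2\<close> unfolding represents_def by (intro nat_of_tape_holds) auto
  then have "represents N ?ts2 (v(1 := \<gamma> (v 1)))"
    using r1 \<open>N \<ge> 2\<close> unfolding represents_def
    by (auto simp: nth_list_update holds_tape_of_nat simp del: nth_map nth_zip)
  then have "represents N ?ts3 (v(1 := \<gamma> (v 1)))"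
    by (rule represents_keep)
  then show ?case
    using reaches_trans[OF reaches_step[OF s1] reaches_trans[OF reaches_step[OF s2] reaches_step[OF s3]]]
    by (auto simp: fun_upd_def)
next
  case (Seq c v v' d v'')
  obtain ts1 where 1: "reaches \<gamma> (code_machine N P) (q, ts) (q + code_length c, ts1)"
    "represents N ts1 v'"
    using Seq.IH(1)[of P' q "code (q + code_length c) d @ P''" ts] Seq.prems by auto
  obtain ts2 where 2: "reaches \<gamma> (code_machine N P) (q + code_length c, ts1)
      (q + code_length c + code_length d, ts2)" "represents N ts2 v''"
    using Seq.IH(2)[of "P' @ code q c" "q + code_length c" P'' ts1] Seq.prems 1 by auto
  from reaches_trans[OF 1(1) 2(1)] 2(2) show ?case by (auto simp: add.assoc)
next
  case (Cond_nonzero v r c v' d)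
  let ?M = "code_machine N P" and ?ts = "map2 act_tape (keep (map read_tape ts)) ts"
  have r: "r < N" and len: "length ts = Suc N"
    using Cond_nonzero.prems by (auto simp: represents_def)
  have "read_tape (ts ! r) \<noteq> 0"
    using Cond_nonzero.prems(3) Cond_nonzero.hyps r read_tape_holds[of "ts ! r" "v r"] by (auto simp: represents_def)
  then have s: "otm_step \<gamma> ?M (q, ts) = (Suc q, ?ts)"
    using code_machine_step[OF \<open>q = length P' + 4\<close>, of \<gamma> N
        "Jump_Zero r (q + code_length c + 2)" _ ts] Cond_nonzero.prems r len by simp
  obtain ts1 where 1: "reaches \<gamma> ?M (Suc q, ?ts) (Suc q + code_length c, ts1)"
    "represents N ts1 v'"
    using Cond_nonzero.IH[of "P' @ [Jump_Zero r (q + code_length c + 2)]" "Suc q"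
        "Jump (q + code_length c + code_length d + 2) # code (q + code_length c + 2) d @ P''" ?ts]
      Cond_nonzero.prems represents_keep[OF Cond_nonzero.prems(3)] by auto
  let ?ts1 = "map2 act_tape (keep (map read_tape ts1)) ts1"
  have s2: "otm_step \<gamma> ?M (Suc q + code_length c, ts1) =
      (q + code_length c + code_length d + 2, ?ts1)"
    using code_machine_step[of "Suc q + code_length c"
        "P' @ Jump_Zero r (q + code_length c + 2) # code (Suc q) c" \<gamma> N
        "Jump (q + code_length c + code_length d + 2)" _ ts1] Cond_nonzero.prems by simp
  show ?case
    using reaches_trans[OF reaches_step[OF s] reaches_trans[OF 1(1) reaches_step[OF s2]]]
      represents_keep[OF 1(2)] by (auto simp: add_ac)
next
  case (Cond_zero v r d v' c)
  let ?M = "code_machine N P" and ?ts = "map2 act_tape (keep (map read_tape ts)) ts"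
  have r: "r < N" and len: "length ts = Suc N"
    using Cond_zero.prems by (auto simp: represents_def)
  have "read_tape (ts ! r) = 0"
    using Cond_zero.prems(3) Cond_zero.hyps r read_tape_holds[of "ts ! r" "v r"] by (auto simp: represents_def)
  then have s: "otm_step \<gamma> ?M (q, ts) = (q + code_length c + 2, ?ts)"
    using code_machine_step[OF \<open>q = length P' + 4\<close>, of \<gamma> N
        "Jump_Zero r (q + code_length c + 2)" _ ts] Cond_zero.prems r len by simp
  obtain ts1 where 1: "reaches \<gamma> ?M (q + code_length c + 2, ?ts)
      (q + code_length c + 2 + code_length d, ts1)" "represents N ts1 v'"
    using Cond_zero.IH[of "P' @ Jump_Zero r (q + code_length c + 2) # code (Suc q) c @
         [Jump (q + code_length c + code_length d + 2)]" "q + code_length c + 2" P'' ?ts]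
      Cond_zero.prems represents_keep[OF Cond_zero.prems(3)] by auto
  show ?case
    using reaches_trans[OF reaches_step[OF s] 1(1)] 1(2) by (auto simp: add_ac)
next
  case (Loop_zero v r c)
  let ?M = "code_machine N P" and ?ts = "map2 act_tape (keep (map read_tape ts)) ts"
  have r: "r < N" and len: "length ts = Suc N"
    using Loop_zero.prems by (auto simp: represents_def)
  have "read_tape (ts ! r) = 0"
    using Loop_zero.prems(3) Loop_zero.hyps r read_tape_holds[of "ts ! r" "v r"] by (auto simp: represents_def)
  then have s: "otm_step \<gamma> ?M (q, ts) = (q + code_length c + 2, ?ts)"
    using code_machine_step[OF \<open>q = length P' + 4\<close>, of \<gamma> N
        "Jump_Zero r (q + code_length c + 2)" _ ts] Loop_zero.prems r len by simp
  show ?case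
    using reaches_step[OF s] represents_keep[OF Loop_zero.prems(3)] by (auto simp: add_ac)
next
  case (Loop_nonzero v r c v' v'')
  let ?M = "code_machine N P" and ?ts = "map2 act_tape (keep (map read_tape ts)) ts"
  have r: "r < N" and len: "length ts = Suc N"
    using Loop_nonzero.prems by (auto simp: represents_def)
  have "read_tape (ts ! r) \<noteq> 0"
    using Loop_nonzero.prems(3) Loop_nonzero.hyps r read_tape_holds[of "ts ! r" "v r"] by (auto simp: represents_def)
  then have s: "otm_step \<gamma> ?M (q, ts) = (Suc q, ?ts)"
    using code_machine_step[OF \<open>q = length P' + 4\<close>, of \<gamma> N
        "Jump_Zero r (q + code_length c + 2)" _ ts] Loop_nonzero.prems r len by simp
  obtain ts1 where 1: "reaches \<gamma> ?M (Suc q, ?ts) (Suc q + code_length c, ts1)"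
    "represents N ts1 v'"
    using Loop_nonzero.IH(1)[of "P' @ [Jump_Zero r (q + code_length c + 2)]" "Suc q"
        "Jump q # P''" ?ts]
      Loop_nonzero.prems represents_keep[OF Loop_nonzero.prems(3)] by auto
  let ?ts1 = "map2 act_tape (keep (map read_tape ts1)) ts1"
  have s2: "otm_step \<gamma> ?M (Suc q + code_length c, ts1) = (q, ?ts1)"
    using code_machine_step[of "Suc q + code_length c"
        "P' @ Jump_Zero r (q + code_length c + 2) # code (Suc q) c" \<gamma> N
        "Jump q" _ ts1] Loop_nonzero.prems by simp
  obtain ts2 where 2: "reaches \<gamma> ?M (q, ?ts1) (q + code_length (Loop r c), ts2)"
    "represents N ts2 v''"
    using Loop_nonzero.IH(2)[OF Loop_nonzero.prems(1,2) represents_keep[OF 1(2)] Loop_nonzero.prems(4)]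
    by auto
  show ?case
    using reaches_trans[OF reaches_step[OF s] reaches_trans[OF 1(1) reaches_trans[OF reaches_step[OF s2] 2(1)]]]
      2(2) by auto
qed

theorem cmd_turing_machine:
  obtains M where "turing_machine M"
    and "\<And>\<gamma> n v'. exec \<gamma> c ((\<lambda>_. 0)(0 := n)) v' \<Longrightarrow> otm_outputs M \<gamma> n (v' 0)"
proof -
  obtain N where N: "registers c \<subseteq> {..<N}" "N \<ge> 2"
  proof -
    obtain N0 where "\<forall>r\<in>registers c. r < N0"
      using finite_registers[of c] finite_nat_set_iff_bounded by auto
    then show ?thesis by (intro that[of "max N0 2"]) auto
  qed
  let ?P = "code 4 c"
  let ?M = "code_machine N ?P"
  have tm: "turing_machine ?M"
    using N(2) bounded_jump_code[of _ 4 c] by (intro turing_machine_code_machine) (auto simp: add_ac)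
  have "otm_outputs ?M \<gamma> n (v' 0)" if ex: "exec \<gamma> c ((\<lambda>_. 0)(0 := n)) v'" for \<gamma> n v'
  proof -
    define ts where "ts = (replicate (Suc N) ([], []))[0 := tape_of_nat n]"
    have init: "otm_init ?M n = (0, ts)"
      by (simp add: otm_init_def code_machine_def ts_def)
    have rep: "represents N ts ((\<lambda>_. 0)(0 := n))"
      using N(2) by (auto simp: represents_def ts_def nth_list_update holds_tape_of_nat holds_empty
          nth_Cons split: nat.split)
    let ?ts = "map2 act_tape (keep (map read_tape ts)) ts"
    have s: "otm_step \<gamma> ?M (0, ts) = (4, ?ts)"
      by (simp add: otm_step_def code_machine_def)
    obtain ts1 where 1: "reaches \<gamma> ?M (4, ?ts) (4 + code_length c, ts1)" "represents N ts1 v'"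
      using code_machine_simulates[OF ex, of ?P "[]" 4 "[]" N ?ts] represents_keep[OF rep] N by auto
    let ?ts1 = "map2 act_tape (keep (map read_tape ts1)) ts1"
    have s2: "otm_step \<gamma> ?M (4 + code_length c, ts1) = (1, ?ts1)"
      by (simp add: otm_step_def code_machine_def)
    have "reaches \<gamma> ?M (otm_init ?M n) (1, ?ts1)"
      unfolding init
      using reaches_trans[OF reaches_step[OF s] reaches_trans[OF 1(1) reaches_step[OF s2]]] .
    moreover have "nat_of_tape (?ts1 ! 0) = v' 0"
      using represents_keep[OF 1(2)] N(2) unfolding represents_def
      by (intro nat_of_tape_holds) auto
    ultimately show ?thesis unfolding otm_outputs_def reaches_def by blast
  qed
  with tm show ?thesis by (rule that)
qed

section \<open>Computable functionals\<close>

text \<open>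
  Partial functionals are given by their graphs \<open>R \<gamma> n m\<close>, with \<open>\<gamma>\<close> the oracle.  A program works like a
  stack: it finds its argument in register \<open>b\<close>, may use all higher registers as long as it leaves them
  zero, and leaves the lower ones as they were.  Asking for a program for every \<open>b\<close> makes subprograms composable
  without any renaming of registers; registers 0 and 1 are reserved for input, output and the oracle.
\<close>
definition computable_rel :: "((nat \<Rightarrow> nat) \<Rightarrow> nat \<Rightarrow> nat \<Rightarrow> bool) \<Rightarrow> bool" where
  "computable_rel R \<longleftrightarrow> (\<forall>b\<ge>2. \<exists>c. \<forall>\<gamma> n m v.
     R \<gamma> n m \<longrightarrow> v b = n \<longrightarrow> (\<forall>r>b. v r = 0) \<longrightarrow> exec \<gamma> c v (v(b := m)))"

definition computable_fun :: "((nat \<Rightarrow> nat) \<Rightarrow> nat \<Rightarrow> nat) \<Rightarrow> bool" where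
  "computable_fun f \<longleftrightarrow> computable_rel (\<lambda>\<gamma> n m. m = f \<gamma> n)"

lemma computable_relI:
  assumes "\<And>b. b \<ge> 2 \<Longrightarrow> \<exists>c. \<forall>\<gamma> n m v.
     R \<gamma> n m \<longrightarrow> v b = n \<longrightarrow> (\<forall>r>b. v r = 0) \<longrightarrow> exec \<gamma> c v (v(b := m))"
  shows "computable_rel R"
  using assms by (simp add: computable_rel_def)

lemma computable_relE:
  assumes "computable_rel R" "b \<ge> 2"
  obtains c where "\<And>\<gamma> n m v. R \<gamma> n m \<Longrightarrow> v b = n \<Longrightarrow> (\<And>r. r > b \<Longrightarrow> v r = 0) \<Longrightarrow>
    exec \<gamma> c v (v(b := m))"
  using assms unfolding computable_rel_def by meson

lemma computable_rel_mono:
  "computable_rel R \<Longrightarrow> (\<And>\<gamma> n m. S \<gamma> n m \<Longrightarrow> R \<gamma> n m) \<Longrightarrow> computable_rel S"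
  unfolding computable_rel_def by meson

lemma computable_funI:
  "computable_rel R \<Longrightarrow> (\<And>\<gamma> n. R \<gamma> n (f \<gamma> n)) \<Longrightarrow> computable_fun f"
  unfolding computable_fun_def by (erule computable_rel_mono) simp

lemma exec_eq: "exec \<gamma> c v v' \<Longrightarrow> v' = v'' \<Longrightarrow> exec \<gamma> c v v''"
  by simp

subsection \<open>Moving numbers between registers\<close>

definition clear_cmd :: "nat \<Rightarrow> cmd" where "clear_cmd r = Loop r (Dec r)"

lemma exec_clear: "exec \<gamma> (clear_cmd r) v (v(r := 0))"
proof (induction "v r" arbitrary: v)
  case 0
  then have "v(r := 0) = v" by (simp add: fun_eq_iff)
  then show ?case unfolding clear_cmd_def using exec.Loop_zero[of v r \<gamma> "Dec r"] 0 by simp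
next
  case (Suc k)
  have "exec \<gamma> (clear_cmd r) (v(r := v r - 1)) ((v(r := v r - 1))(r := 0))"
    using Suc by (intro Suc.hyps) simp
  then show ?case unfolding clear_cmd_def
    by - (rule exec.Loop_nonzero[OF _ exec.Dec], use Suc(2) in auto)
qed

definition move_cmd :: "nat \<Rightarrow> nat \<Rightarrow> cmd" where "move_cmd r s = Loop r (Seq (Dec r) (Inc s))"

lemma exec_move: "r \<noteq> s \<Longrightarrow> exec \<gamma> (move_cmd r s) v (v(s := v s + v r, r := 0))"
proof (induction "v r" arbitrary: v)
  case 0
  then have "v(s := v s + v r, r := 0) = v" by (simp add: fun_eq_iff)
  then show ?case unfolding move_cmd_def using exec.Loop_zero[of v r \<gamma>] 0 by simp
next
  case (Suc k)
  let ?v = "v(r := v r - 1, s := Suc (v s))"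
  have 1: "exec \<gamma> (Seq (Dec r) (Inc s)) v ?v"
    by (rule exec_eq[OF exec.Seq[OF exec.Dec exec.Inc]]) (use Suc.prems in \<open>auto simp: fun_eq_iff\<close>)
  have "exec \<gamma> (move_cmd r s) ?v (?v(s := ?v s + ?v r, r := 0))"
    using Suc by (intro Suc.hyps) auto
  then have "exec \<gamma> (move_cmd r s) ?v (v(s := v s + v r, r := 0))"
    by (rule exec_eq) (use Suc.prems Suc(2) in \<open>auto simp: fun_eq_iff\<close>)
  then show ?case unfolding move_cmd_def
    by - (rule exec.Loop_nonzero[OF _ 1], use Suc(2) in auto)
qed

definition split_cmd :: "nat \<Rightarrow> nat \<Rightarrow> nat \<Rightarrow> cmd" where
  "split_cmd r s t = Loop r (Seq (Dec r) (Seq (Inc s) (Inc t)))"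

lemma exec_split:
  "r \<noteq> s \<Longrightarrow> r \<noteq> t \<Longrightarrow> s \<noteq> t \<Longrightarrow>
   exec \<gamma> (split_cmd r s t) v (v(s := v s + v r, t := v t + v r, r := 0))"
proof (induction "v r" arbitrary: v)
  case 0
  then have "v(s := v s + v r, t := v t + v r, r := 0) = v" by (simp add: fun_eq_iff)
  then show ?case unfolding split_cmd_def using exec.Loop_zero[of v r \<gamma>] 0 by simp
next
  case (Suc k)
  let ?v = "v(r := v r - 1, s := Suc (v s), t := Suc (v t))"
  have 1: "exec \<gamma> (Seq (Dec r) (Seq (Inc s) (Inc t))) v ?v"
    by (rule exec_eq[OF exec.Seq[OF exec.Dec exec.Seq[OF exec.Inc exec.Inc]]])
       (use Suc.prems in \<open>auto simp: fun_eq_iff\<close>)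
  have "exec \<gamma> (split_cmd r s t) ?v (?v(s := ?v s + ?v r, t := ?v t + ?v r, r := 0))"
    using Suc by (intro Suc.hyps) auto
  then have "exec \<gamma> (split_cmd r s t) ?v (v(s := v s + v r, t := v t + v r, r := 0))"
    by (rule exec_eq) (use Suc.prems Suc(2) in \<open>auto simp: fun_eq_iff\<close>)
  then show ?case unfolding split_cmd_def
    by - (rule exec.Loop_nonzero[OF _ 1], use Suc(2) in auto)
qed

definition copy_cmd :: "nat \<Rightarrow> nat \<Rightarrow> nat \<Rightarrow> cmd" where
  "copy_cmd r s t = Seq (split_cmd r s t) (move_cmd t r)"

lemma exec_copy:
  "r \<noteq> s \<Longrightarrow> r \<noteq> t \<Longrightarrow> s \<noteq> t \<Longrightarrow> v t = 0 \<Longrightarrow>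
   exec \<gamma> (copy_cmd r s t) v (v(s := v s + v r))"
  unfolding copy_cmd_def
  by (rule exec_eq[OF exec.Seq[OF exec_split exec_move]]) (auto simp: fun_eq_iff)

text \<open>
  Computes \<open>prod_encode (m, n) = triangle (m + n) + m\<close>: first \<open>m\<close> is added to both the result and \<open>n\<close>,
  then \<open>triangle\<close> is summed up from its largest term down.
\<close>
definition encode_cmd :: "nat \<Rightarrow> nat \<Rightarrow> nat \<Rightarrow> cmd" where
  "encode_cmd x y z =
     Seq (split_cmd y x z) (Loop z (Seq (copy_cmd z x y) (Dec z)))"

lemma exec_encode:
  assumes "x \<noteq> y" "x \<noteq> z" "y \<noteq> z" "v x = 0"
  shows "exec \<gamma> (encode_cmd x y z) v (v(x := prod_encode (v y, v z), y := 0, z := 0))"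
proof -
  have loop: "exec \<gamma> (Loop z (Seq (copy_cmd z x y) (Dec z))) u
      (u(x := u x + triangle (u z), z := 0))" if "u y = 0" for u
    using that
  proof (induction "u z" arbitrary: u)
    case 0
    then have "u(x := u x + triangle (u z), z := 0) = u" by (simp add: fun_eq_iff)
    then show ?case using exec.Loop_zero[of u z \<gamma>] 0 by simp
  next
    case (Suc k)
    let ?u = "u(x := u x + u z, z := u z - 1)"
    have 1: "exec \<gamma> (Seq (copy_cmd z x y) (Dec z)) u ?u"
      by (rule exec_eq[OF exec.Seq[OF exec_copy exec.Dec]])
        (use assms Suc.prems in \<open>auto simp: fun_eq_iff\<close>)
    have "exec \<gamma> (Loop z (Seq (copy_cmd z x y) (Dec z))) ?u (?u(x := ?u x + triangle (?u z), z := 0))"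
      using Suc assms by (intro Suc.hyps) auto
    then have "exec \<gamma> (Loop z (Seq (copy_cmd z x y) (Dec z))) ?u (u(x := u x + triangle (u z), z := 0))"
      by (rule exec_eq) (use assms Suc(2)[symmetric] in \<open>auto simp: fun_eq_iff\<close>)
    then show ?case by - (rule exec.Loop_nonzero[OF _ 1], use Suc(2) in auto)
  qed
  show ?thesis unfolding encode_cmd_def
    by (rule exec_eq[OF exec.Seq[OF exec_split loop]])
      (use assms in \<open>auto simp: fun_eq_iff prod_encode_def add_ac\<close>)
qed

text \<open>
  Walks along the enumeration of pairs by \<open>prod_decode\<close>: the successor of \<open>(m, Suc n)\<close> is \<open>(Suc m, n)\<close>,
  and that of \<open>(m, 0)\<close> is \<open>(0, Suc m)\<close>.
\<close>
definition decode_cmd :: "nat \<Rightarrow> nat \<Rightarrow> nat \<Rightarrow> cmd" where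
  "decode_cmd x y z =
     Loop x (Seq (Dec x) (Cond z (Seq (Dec z) (Inc y)) (Seq (move_cmd y z) (Inc z))))"

lemma prod_encode_step_zero: "prod_encode (0, Suc a) = Suc (prod_encode (a, 0))"
  by (simp add: prod_encode_def)

lemma prod_encode_step_Suc: "prod_encode (Suc a, b) = Suc (prod_encode (a, Suc b))"
  by (simp add: prod_encode_def)

lemma exec_decode:
  assumes "x \<noteq> y" "x \<noteq> z" "y \<noteq> z"
  shows "v y = 0 \<Longrightarrow> v z = 0 \<Longrightarrow> exec \<gamma> (decode_cmd x y z) v
    (v(x := 0, y := fst (prod_decode (v x)), z := snd (prod_decode (v x))))"
proof -
  have "exec \<gamma> (decode_cmd x y z) v (v(x := 0, y := fst (prod_decode (v x + prod_encode (v y, v z))),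
     z := snd (prod_decode (v x + prod_encode (v y, v z)))))" for v
  proof (induction "v x" arbitrary: v)
    case 0
    then show ?case unfolding decode_cmd_def
      by (intro exec_eq[OF exec.Loop_zero]) (auto simp: fun_eq_iff)
  next
    case (Suc k)
    define u where "u = (if v z = 0 then v(x := v x - 1, z := Suc (v y), y := 0)
        else v(x := v x - 1, z := v z - 1, y := Suc (v y)))"
    have 1: "exec \<gamma> (Seq (Dec x) (Cond z (Seq (Dec z) (Inc y)) (Seq (move_cmd y z) (Inc z)))) v u"
    proof (cases "v z = 0")
      case True
      show ?thesis
        by (rule exec_eq[OF exec.Seq[OF exec.Dec exec.Cond_zero[OF _ exec.Seq[OF exec_move exec.Inc]]]])
          (use True assms in \<open>auto simp: fun_eq_iff u_def\<close>)
    next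
      case False
      show ?thesis
        by (rule exec_eq[OF exec.Seq[OF exec.Dec exec.Cond_nonzero[OF _ exec.Seq[OF exec.Dec exec.Inc]]]])
          (use False assms in \<open>auto simp: fun_eq_iff u_def\<close>)
    qed
    have x: "u x = k" using Suc(2) assms by (auto simp: u_def)
    have e: "u x + prod_encode (u y, u z) = v x + prod_encode (v y, v z)"
    proof (cases "v z")
      case 0
      then show ?thesis using Suc(2)[symmetric] assms by (simp add: u_def prod_encode_step_zero)
    next
      case (Suc l)
      then show ?thesis using \<open>Suc k = v x\<close>[symmetric] assms by (simp add: u_def prod_encode_step_Suc)
    qed
    have "exec \<gamma> (decode_cmd x y z) u (v(x := 0, y := fst (prod_decode (v x + prod_encode (v y, v z))),
     z := snd (prod_decode (v x + prod_encode (v y, v z)))))"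
      by (rule exec_eq[OF Suc.hyps(1)[of u]]) (auto simp: x e[unfolded x], auto simp: u_def fun_eq_iff assms)
    then show ?case unfolding decode_cmd_def
      by - (rule exec.Loop_nonzero[OF _ 1], use Suc(2) in auto)
  qed
  from this[of v] show "v y = 0 \<Longrightarrow> v z = 0 \<Longrightarrow> ?thesis"
    by (simp add: prod_encode_def)
qed

subsection \<open>Closure properties\<close>

lemma computable_rel_relcomp:
  assumes "computable_rel R" "computable_rel S"
  shows "computable_rel (\<lambda>\<gamma> n m. \<exists>y. R \<gamma> n y \<and> S \<gamma> y m)"
proof (rule computable_relI)
  fix b :: nat assume b: "b \<ge> 2"
  obtain c where c: "\<And>\<gamma> n m v. R \<gamma> n m \<Longrightarrow> v b = n \<Longrightarrow> (\<And>r. r > b \<Longrightarrow> v r = 0) \<Longrightarrow>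
    exec \<gamma> c v (v(b := m))" using assms(1) b by (rule computable_relE) blast
  obtain d where d: "\<And>\<gamma> n m v. S \<gamma> n m \<Longrightarrow> v b = n \<Longrightarrow> (\<And>r. r > b \<Longrightarrow> v r = 0) \<Longrightarrow>
    exec \<gamma> d v (v(b := m))" using assms(2) b by (rule computable_relE) blast
  have "exec \<gamma> (Seq c d) v (v(b := m))"
    if "R \<gamma> (v b) y" "S \<gamma> y m" "\<forall>r>b. v r = 0" for \<gamma> m v y
    by (rule exec_eq[OF exec.Seq[OF c[OF that(1)] d[OF that(2)]]]) (use that(3) in auto)
  then show "\<exists>c. \<forall>\<gamma> n m v. (\<exists>y. R \<gamma> n y \<and> S \<gamma> y m) \<longrightarrow> v b = n \<longrightarrow> (\<forall>r>b. v r = 0) \<longrightarrow>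
    exec \<gamma> c v (v(b := m))"
    by blast
qed

lemma computable_fun_comp:
  assumes "computable_fun g" "computable_fun f"
  shows "computable_fun (\<lambda>\<gamma> n. g \<gamma> (f \<gamma> n))"
  using computable_rel_relcomp[OF assms(2)[unfolded computable_fun_def] assms(1)[unfolded computable_fun_def]]
  by (rule computable_funI) simp

lemma computable_fun_id: "computable_fun (\<lambda>\<gamma> n. n)"
  unfolding computable_fun_def
proof (rule computable_relI)
  fix b
  show "\<exists>c. \<forall>\<gamma> n m v. m = n \<longrightarrow> v b = n \<longrightarrow> (\<forall>r>b. v r = 0) \<longrightarrow> exec \<gamma> c v (v(b := m))"
    by (intro exI[of _ "Seq (Inc b) (Dec b)"] allI impI exec_eq[OF exec.Seq[OF exec.Inc exec.Dec]]) simp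
qed

lemma computable_fun_Suc: "computable_fun f \<Longrightarrow> computable_fun (\<lambda>\<gamma> n. Suc (f \<gamma> n))"
proof (rule computable_fun_comp[of "\<lambda>\<gamma> n. Suc n"])
  show "computable_fun (\<lambda>\<gamma> n. Suc n)"
    unfolding computable_fun_def
  proof (rule computable_relI)
    fix b
    show "\<exists>c. \<forall>\<gamma> n m v. m = Suc n \<longrightarrow> v b = n \<longrightarrow> (\<forall>r>b. v r = 0) \<longrightarrow> exec \<gamma> c v (v(b := m))"
      by (rule exI[of _ "Inc b"]) (auto intro: exec.Inc)
  qed
qed

lemma computable_fun_pred: "computable_fun f \<Longrightarrow> computable_fun (\<lambda>\<gamma> n. f \<gamma> n - 1)"
proof (rule computable_fun_comp[of "\<lambda>\<gamma> n. n - 1"])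
  show "computable_fun (\<lambda>\<gamma> n. n - 1)"
    unfolding computable_fun_def
  proof (rule computable_relI)
    fix b
    show "\<exists>c. \<forall>\<gamma> n m v. m = n - 1 \<longrightarrow> v b = n \<longrightarrow> (\<forall>r>b. v r = 0) \<longrightarrow> exec \<gamma> c v (v(b := m))"
      by (rule exI[of _ "Dec b"]) (auto intro: exec.Dec[simplified])
  qed
qed

lemma computable_fun_const: "computable_fun (\<lambda>\<gamma> n. k)"
proof (induction k)
  case 0
  show ?case unfolding computable_fun_def
  proof (rule computable_relI)
    fix b
    show "\<exists>c. \<forall>\<gamma> n m v. m = 0 \<longrightarrow> v b = n \<longrightarrow> (\<forall>r>b. v r = 0) \<longrightarrow> exec \<gamma> c v (v(b := m))"
      by (rule exI[of _ "clear_cmd b"]) (auto intro: exec_clear)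
  qed
qed (rule computable_fun_Suc)

lemma computable_fun_oracle: "computable_fun f \<Longrightarrow> computable_fun (\<lambda>\<gamma> n. \<gamma> (f \<gamma> n))"
proof (rule computable_fun_comp[of "\<lambda>\<gamma> n. \<gamma> n"])
  show "computable_fun (\<lambda>\<gamma> n. \<gamma> n)"
    unfolding computable_fun_def
  proof (rule computable_relI)
    fix b :: nat assume b: "b \<ge> 2"
    let ?c = "Seq (move_cmd 1 (b + 1)) (Seq (move_cmd b 1) (Seq Ask (Seq (move_cmd 1 b) (move_cmd (b + 1) 1))))"
    show "\<exists>c. \<forall>\<gamma> n m v. m = \<gamma> n \<longrightarrow> v b = n \<longrightarrow> (\<forall>r>b. v r = 0) \<longrightarrow> exec \<gamma> c v (v(b := m))"
    proof (intro exI[of _ ?c] allI impI)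
      fix \<gamma> :: "nat \<Rightarrow> nat" and n m v assume "m = \<gamma> n" "v b = n" "\<forall>r>b. v r = (0::nat)"
      then show "exec \<gamma> ?c v (v(b := m))"
        using b
        by (intro exec_eq[OF exec.Seq[OF exec_move exec.Seq[OF exec_move exec.Seq[OF exec.Ask
            exec.Seq[OF exec_move exec_move]]]]]) (auto simp: fun_eq_iff)
    qed
  qed
qed

definition pfst :: "nat \<Rightarrow> nat" where "pfst n = fst (prod_decode n)"
definition psnd :: "nat \<Rightarrow> nat" where "psnd n = snd (prod_decode n)"

lemma pfst_prod_encode [simp]: "pfst (prod_encode (a, b)) = a"
  and psnd_prod_encode [simp]: "psnd (prod_encode (a, b)) = b"
  by (simp_all add: pfst_def psnd_def)

lemma prod_encode_pfst_psnd [simp]: "prod_encode (pfst n, psnd n) = n"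
  by (simp add: pfst_def psnd_def)

lemma computable_fun_pfst: "computable_fun f \<Longrightarrow> computable_fun (\<lambda>\<gamma> n. pfst (f \<gamma> n))"
proof (rule computable_fun_comp[of "\<lambda>\<gamma> n. pfst n"])
  show "computable_fun (\<lambda>\<gamma> n. pfst n)"
    unfolding computable_fun_def
  proof (rule computable_relI)
    fix b :: nat
    let ?c = "Seq (decode_cmd b (b+1) (b+2)) (Seq (move_cmd (b+1) b) (clear_cmd (b+2)))"
    show "\<exists>c. \<forall>\<gamma> n m v. m = pfst n \<longrightarrow> v b = n \<longrightarrow> (\<forall>r>b. v r = 0) \<longrightarrow> exec \<gamma> c v (v(b := m))"
      by (intro exI[of _ ?c] allI impI
          exec_eq[OF exec.Seq[OF exec_decode exec.Seq[OF exec_move exec_clear]]])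
         (auto simp: fun_eq_iff pfst_def)
  qed
qed

lemma computable_fun_psnd: "computable_fun f \<Longrightarrow> computable_fun (\<lambda>\<gamma> n. psnd (f \<gamma> n))"
proof (rule computable_fun_comp[of "\<lambda>\<gamma> n. psnd n"])
  show "computable_fun (\<lambda>\<gamma> n. psnd n)"
    unfolding computable_fun_def
  proof (rule computable_relI)
    fix b :: nat
    let ?c = "Seq (decode_cmd b (b+1) (b+2)) (Seq (move_cmd (b+2) b) (clear_cmd (b+1)))"
    show "\<exists>c. \<forall>\<gamma> n m v. m = psnd n \<longrightarrow> v b = n \<longrightarrow> (\<forall>r>b. v r = 0) \<longrightarrow> exec \<gamma> c v (v(b := m))"
      by (intro exI[of _ ?c] allI impI
          exec_eq[OF exec.Seq[OF exec_decode exec.Seq[OF exec_move exec_clear]]])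
         (auto simp: fun_eq_iff psnd_def)
  qed
qed

lemma computable_fun_pair:
  assumes "computable_fun f" "computable_fun g"
  shows "computable_fun (\<lambda>\<gamma> n. prod_encode (f \<gamma> n, g \<gamma> n))"
  unfolding computable_fun_def
proof (rule computable_relI)
  fix b :: nat assume b: "b \<ge> 2"
  obtain c where c: "\<And>\<gamma> n m v. m = f \<gamma> n \<Longrightarrow> v (b+1) = n \<Longrightarrow> (\<And>r. r > b+1 \<Longrightarrow> v r = 0) \<Longrightarrow>
    exec \<gamma> c v (v((b+1) := m))"
    using assms(1)[unfolded computable_fun_def] by (rule computable_relE[where b = "b+1"]) (use b in auto)
  obtain d where d: "\<And>\<gamma> n m v. m = g \<gamma> n \<Longrightarrow> v (b+2) = n \<Longrightarrow> (\<And>r. r > b+2 \<Longrightarrow> v r = 0) \<Longrightarrow>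
    exec \<gamma> d v (v((b+2) := m))"
    using assms(2)[unfolded computable_fun_def] by (rule computable_relE[where b = "b+2"]) (use b in auto)
  let ?c = "Seq (copy_cmd b (b+1) (b+2)) (Seq c (Seq (move_cmd b (b+2)) (Seq d (encode_cmd b (b+1) (b+2)))))"
  show "\<exists>c. \<forall>\<gamma> n m v. m = prod_encode (f \<gamma> n, g \<gamma> n) \<longrightarrow> v b = n \<longrightarrow> (\<forall>r>b. v r = 0) \<longrightarrow>
    exec \<gamma> c v (v(b := m))"
    by (intro exI[of _ ?c] allI impI
          exec_eq[OF exec.Seq[OF exec_copy exec.Seq[OF c exec.Seq[OF exec_move exec.Seq[OF d exec_encode]]]]])
         (auto simp: fun_eq_iff)
qed

lemma computable_fun_if_nonzero:
  assumes "computable_fun p" "computable_fun f" "computable_fun g"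
  shows "computable_fun (\<lambda>\<gamma> n. if p \<gamma> n \<noteq> 0 then f \<gamma> n else g \<gamma> n)"
  unfolding computable_fun_def
proof (rule computable_relI)
  fix b :: nat assume b: "b \<ge> 2"
  obtain c where c: "\<And>\<gamma> n m v. m = p \<gamma> n \<Longrightarrow> v (b+1) = n \<Longrightarrow> (\<And>r. r > b+1 \<Longrightarrow> v r = 0) \<Longrightarrow>
    exec \<gamma> c v (v((b+1) := m))"
    using assms(1)[unfolded computable_fun_def] by (rule computable_relE[where b = "b+1"]) (use b in auto)
  obtain d where d: "\<And>\<gamma> n m v. m = f \<gamma> n \<Longrightarrow> v b = n \<Longrightarrow> (\<And>r. r > b \<Longrightarrow> v r = 0) \<Longrightarrow>
    exec \<gamma> d v (v(b := m))"
    using assms(2)[unfolded computable_fun_def] by (rule computable_relE[where b = b]) (use b in auto)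
  obtain e where e: "\<And>\<gamma> n m v. m = g \<gamma> n \<Longrightarrow> v b = n \<Longrightarrow> (\<And>r. r > b \<Longrightarrow> v r = 0) \<Longrightarrow>
    exec \<gamma> e v (v(b := m))"
    using assms(3)[unfolded computable_fun_def] by (rule computable_relE[where b = b]) (use b in auto)
  let ?c = "Seq (copy_cmd b (b+1) (b+2)) (Seq c (Cond (b+1) (Seq (clear_cmd (b+1)) d) e))"
  have "exec \<gamma> ?c v (v(b := if p \<gamma> (v b) \<noteq> 0 then f \<gamma> (v b) else g \<gamma> (v b)))"
    if "\<forall>r>b. v r = 0" for \<gamma> v
  proof (cases "p \<gamma> (v b) = 0")
    case True
    show ?thesis
      by (rule exec_eq[OF exec.Seq[OF exec_copy exec.Seq[OF c exec.Cond_zero[OF _ e]]]])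
         (use True that in \<open>auto simp: fun_eq_iff\<close>)
  next
    case False
    show ?thesis
      by (rule exec_eq[OF exec.Seq[OF exec_copy exec.Seq[OF c exec.Cond_nonzero[OF _ exec.Seq[OF exec_clear d]]]]])
         (use False that in \<open>auto simp: fun_eq_iff\<close>)
  qed
  then show "\<exists>c. \<forall>\<gamma> n m v. m = (if p \<gamma> n \<noteq> 0 then f \<gamma> n else g \<gamma> n) \<longrightarrow> v b = n \<longrightarrow>
      (\<forall>r>b. v r = 0) \<longrightarrow> exec \<gamma> c v (v(b := m))"
    by (intro exI[of _ ?c]) blast
qed

text \<open>
  Iterating \<open>f\<close> until \<open>p\<close> vanishes; the graph is empty at arguments where that never happens.
\<close>
lemma computable_rel_while:
  assumes "computable_fun p" "computable_fun f"
  shows "computable_rel (\<lambda>\<gamma> n m. \<exists>k. m = (f \<gamma> ^^ k) n \<and> p \<gamma> m = 0 \<and> (\<forall>i<k. p \<gamma> ((f \<gamma> ^^ i) n) \<noteq> 0))"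
proof (rule computable_relI)
  fix b :: nat assume b: "b \<ge> 2"
  obtain c where c: "\<And>\<gamma> n m v. m = p \<gamma> n \<Longrightarrow> v (b+1) = n \<Longrightarrow> (\<And>r. r > b+1 \<Longrightarrow> v r = 0) \<Longrightarrow>
    exec \<gamma> c v (v((b+1) := m))"
    using assms(1)[unfolded computable_fun_def] by (rule computable_relE[where b = "b+1"]) (use b in auto)
  obtain d where d: "\<And>\<gamma> n m v. m = f \<gamma> n \<Longrightarrow> v b = n \<Longrightarrow> (\<And>r. r > b \<Longrightarrow> v r = 0) \<Longrightarrow>
    exec \<gamma> d v (v(b := m))"
    using assms(2)[unfolded computable_fun_def] by (rule computable_relE[where b = b]) (use b in auto)
  let ?t = "Seq (copy_cmd b (b+1) (b+2)) c"
  let ?l = "Loop (b+1) (Seq (clear_cmd (b+1)) (Seq d ?t))"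
  have t: "exec \<gamma> ?t v (v((b+1) := p \<gamma> (v b)))" if "\<forall>r>b. v r = 0" for \<gamma> v
    by (rule exec_eq[OF exec.Seq[OF exec_copy c]]) (use that in \<open>auto simp: fun_eq_iff\<close>)
  have l: "exec \<gamma> ?l (v((b+1) := p \<gamma> (v b))) (v(b := (f \<gamma> ^^ k) (v b)))"
    if "\<forall>r>b. v r = 0" "p \<gamma> ((f \<gamma> ^^ k) (v b)) = 0" "\<forall>i<k. p \<gamma> ((f \<gamma> ^^ i) (v b)) \<noteq> 0" for \<gamma> v k
    using that
  proof (induction k arbitrary: v)
    case 0
    then show ?case by (intro exec_eq[OF exec.Loop_zero]) (auto simp: fun_eq_iff)
  next
    case (Suc k)
    let ?u = "v(b := f \<gamma> (v b))"
    have nz: "p \<gamma> (v b) \<noteq> 0" using Suc.prems(3) by (metis funpow_0 zero_less_Suc)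
    have "exec \<gamma> ?l (?u((b+1) := p \<gamma> (?u b))) (?u(b := (f \<gamma> ^^ k) (?u b)))"
    proof (rule Suc.IH)
      show "\<forall>r>b. ?u r = 0" using Suc.prems(1) by simp
      show "p \<gamma> ((f \<gamma> ^^ k) (?u b)) = 0" using Suc.prems(2) by (simp add: funpow_swap1)
      show "\<forall>i<k. p \<gamma> ((f \<gamma> ^^ i) (?u b)) \<noteq> 0"
      proof (intro allI impI)
        fix i assume "i < k"
        then show "p \<gamma> ((f \<gamma> ^^ i) (?u b)) \<noteq> 0"
          using Suc.prems(3)[rule_format, of "Suc i"] by (simp add: funpow_swap1)
      qed
    qed
    then have l': "exec \<gamma> ?l (?u((b+1) := p \<gamma> (?u b))) (v(b := (f \<gamma> ^^ Suc k) (v b)))"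
      by (simp add: funpow_swap1)
    have "exec \<gamma> (Seq (clear_cmd (b+1)) (Seq d ?t)) (v((b+1) := p \<gamma> (v b))) (?u((b+1) := p \<gamma> (?u b)))"
      by (rule exec_eq[OF exec.Seq[OF exec_clear exec.Seq[OF d t]]])
        (use Suc.prems(1) in \<open>auto simp: fun_eq_iff\<close>)
    from exec.Loop_nonzero[OF _ this l'] nz show ?case by (simp add: fun_upd_def)
  qed
  have "exec \<gamma> (Seq ?t ?l) v (v(b := (f \<gamma> ^^ k) (v b)))"
    if "\<forall>r>b. v r = 0" "p \<gamma> ((f \<gamma> ^^ k) (v b)) = 0" "\<forall>i<k. p \<gamma> ((f \<gamma> ^^ i) (v b)) \<noteq> 0" for \<gamma> v k
    using exec.Seq[OF t[OF that(1)] l[OF that]] .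
  then show "\<exists>c. \<forall>\<gamma> n m v. (\<exists>k. m = (f \<gamma> ^^ k) n \<and> p \<gamma> m = 0 \<and> (\<forall>i<k. p \<gamma> ((f \<gamma> ^^ i) n) \<noteq> 0)) \<longrightarrow>
      v b = n \<longrightarrow> (\<forall>r>b. v r = 0) \<longrightarrow> exec \<gamma> c v (v(b := m))"
    by (intro exI[of _ "Seq ?t ?l"]) blast
qed

text \<open>
  The program is placed at register 2, and its argument and result are moved from and to register 0,
  which is the input and output tape.
\<close>
theorem computable_rel_turing_machine:
  assumes "computable_rel R"
  obtains M where "turing_machine M" and "\<And>\<gamma> n m. R \<gamma> n m \<Longrightarrow> otm_outputs M \<gamma> n m"
proof -
  obtain c where c: "\<And>\<gamma> n m v. R \<gamma> n m \<Longrightarrow> v 2 = n \<Longrightarrow> (\<And>r. r > 2 \<Longrightarrow> v r = 0) \<Longrightarrow>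
    exec \<gamma> c v (v(2 := m))" using assms by (rule computable_relE[where b = 2]) auto
  let ?c = "Seq (move_cmd 0 2) (Seq c (move_cmd 2 0))"
  have ex: "exec \<gamma> ?c ((\<lambda>_. 0)(0 := n)) ((\<lambda>_. 0)(0 := m))" if "R \<gamma> n m" for \<gamma> n m
    by (rule exec_eq[OF exec.Seq[OF exec_move exec.Seq[OF c[OF that] exec_move]]]) (auto simp: fun_eq_iff)
  obtain M where M: "turing_machine M"
    "\<And>\<gamma> n v'. exec \<gamma> ?c ((\<lambda>_. 0)(0 := n)) v' \<Longrightarrow> otm_outputs M \<gamma> n (v' 0)"
    by (rule cmd_turing_machine[where c = ?c]) blast
  show ?thesis
  proof (rule that[OF M(1)])
    fix \<gamma> n m assume "R \<gamma> n m"
    from M(2)[OF ex[OF this]] show "otm_outputs M \<gamma> n m" by simp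
  qed
qed

section \<open>Arithmetic, bounded quantifiers and search\<close>
definition computable_pred :: "((nat \<Rightarrow> nat) \<Rightarrow> nat \<Rightarrow> bool) \<Rightarrow> bool" where
  "computable_pred Q \<longleftrightarrow> computable_fun (\<lambda>\<gamma> n. of_bool (Q \<gamma> n))"

named_theorems computable

lemmas [computable] = computable_fun_id computable_fun_const computable_fun_Suc computable_fun_pred
  computable_fun_pfst computable_fun_psnd computable_fun_pair computable_fun_oracle

lemma computable_fun_if [computable]:
  assumes "computable_pred Q" "computable_fun f" "computable_fun g"
  shows "computable_fun (\<lambda>\<gamma> n. if Q \<gamma> n then f \<gamma> n else g \<gamma> n)"
  using computable_fun_if_nonzero[OF assms[unfolded computable_pred_def]] by simp

text \<open>
  The loop runs on codes of tuples: the number of remaining rounds, the argument \<open>n\<close>, the number of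
  completed rounds and the accumulator.  Functions of several arguments are computable in the sense
  that they are so as functions of a code of a tuple.
\<close>
lemma computable_fun_rec:
  assumes g: "computable_fun g" and k: "computable_fun k"
    and h: "computable_fun (\<lambda>\<gamma> z. h \<gamma> (pfst z) (pfst (psnd z)) (psnd (psnd z)))"
  shows "computable_fun (\<lambda>\<gamma> n. rec_nat (g \<gamma> n) (\<lambda>i acc. h \<gamma> n i acc) (k \<gamma> n))"
proof -
  let ?s = "\<lambda>\<gamma> z. prod_encode (pfst z - 1, prod_encode (pfst (psnd z),
      prod_encode (Suc (pfst (psnd (psnd z))),
        h \<gamma> (pfst (psnd z)) (pfst (psnd (psnd z))) (psnd (psnd (psnd z))))))"
  let ?i = "\<lambda>\<gamma> n. prod_encode (k \<gamma> n, prod_encode (n, prod_encode (0, g \<gamma> n)))"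
  have s: "computable_fun ?s"
    by (intro computable computable_fun_comp[OF h, of "\<lambda>_ z. psnd z"])
  have p: "computable_fun (\<lambda>_. pfst)" by (intro computable)
  have i: "computable_fun ?i" by (intro computable g k)
  have o: "computable_fun (\<lambda>_ z. psnd (psnd (psnd z)))" by (intro computable)
  have iter: "(?s \<gamma> ^^ j) (?i \<gamma> n) = prod_encode (k \<gamma> n - j, prod_encode (n, prod_encode (j,
      rec_nat (g \<gamma> n) (\<lambda>i acc. h \<gamma> n i acc) j)))" for \<gamma> n j
    by (induction j) simp_all
  show ?thesis
  proof (rule computable_funI[OF computable_rel_relcomp[OF i[unfolded computable_fun_def]
        computable_rel_relcomp[OF computable_rel_while[OF p s] o[unfolded computable_fun_def]]]])
    fix \<gamma> n
    show "\<exists>y. y = ?i \<gamma> n \<and> (\<exists>z. (\<exists>j. z = (?s \<gamma> ^^ j) y \<and> pfst z = 0 \<and>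
        (\<forall>i<j. pfst ((?s \<gamma> ^^ i) y) \<noteq> 0)) \<and>
        rec_nat (g \<gamma> n) (\<lambda>i acc. h \<gamma> n i acc) (k \<gamma> n) = psnd (psnd (psnd z)))"
      by (intro exI[of _ "?i \<gamma> n"] conjI refl exI[of _ "(?s \<gamma> ^^ k \<gamma> n) (?i \<gamma> n)"]
          exI[of _ "k \<gamma> n"]) (simp_all only: iter, simp_all)
  qed
qed

lemma computable_fun_add [computable]:
  assumes "computable_fun f" "computable_fun g"
  shows "computable_fun (\<lambda>\<gamma> n. f \<gamma> n + g \<gamma> n)"
proof -
  have "computable_fun (\<lambda>\<gamma> n. rec_nat (f \<gamma> n) (\<lambda>_ acc. Suc acc) (g \<gamma> n))"
    by (intro computable_fun_rec computable assms)
  moreover have "rec_nat x (\<lambda>_ acc. Suc acc) y = x + y" for x y by (induction y) auto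
  ultimately show ?thesis by simp
qed

lemma computable_fun_mult [computable]:
  assumes "computable_fun f" "computable_fun g"
  shows "computable_fun (\<lambda>\<gamma> n. f \<gamma> n * g \<gamma> n)"
proof -
  have "computable_fun (\<lambda>\<gamma> n. rec_nat 0 (\<lambda>_ acc. acc + f \<gamma> n) (g \<gamma> n))"
    by (intro computable_fun_rec computable assms computable_fun_comp[OF assms(1)])
  moreover have "rec_nat 0 (\<lambda>_ acc. acc + x) y = x * y" for x y :: nat by (induction y) auto
  ultimately show ?thesis by simp
qed

lemma computable_fun_power [computable]:
  assumes "computable_fun f" "computable_fun g"
  shows "computable_fun (\<lambda>\<gamma> n. f \<gamma> n ^ g \<gamma> n)"
proof -
  have "computable_fun (\<lambda>\<gamma> n. rec_nat 1 (\<lambda>_ acc. acc * f \<gamma> n) (g \<gamma> n))"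
    by (intro computable_fun_rec computable assms computable_fun_comp[OF assms(1)])
  moreover have "rec_nat 1 (\<lambda>_ acc. acc * x) y = x ^ y" for x y :: nat by (induction y) auto
  ultimately show ?thesis by simp
qed

lemma computable_fun_diff [computable]:
  assumes "computable_fun f" "computable_fun g"
  shows "computable_fun (\<lambda>\<gamma> n. f \<gamma> n - g \<gamma> n)"
proof -
  have "computable_fun (\<lambda>\<gamma> n. rec_nat (f \<gamma> n) (\<lambda>_ acc. acc - 1) (g \<gamma> n))"
    by (intro computable_fun_rec computable assms)
  moreover have "rec_nat x (\<lambda>_ acc. acc - 1) y = x - y" for x y :: nat by (induction y) auto
  ultimately show ?thesis by simp
qed

lemma computable_pred_comp:
  "computable_pred Q \<Longrightarrow> computable_fun f \<Longrightarrow> computable_pred (\<lambda>\<gamma> n. Q \<gamma> (f \<gamma> n))"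
  unfolding computable_pred_def by (rule computable_fun_comp)

lemma computable_pred_conj [computable]:
  assumes "computable_pred P" "computable_pred Q"
  shows "computable_pred (\<lambda>\<gamma> n. P \<gamma> n \<and> Q \<gamma> n)"
  using computable_fun_mult[OF assms[unfolded computable_pred_def]]
  by (simp add: computable_pred_def flip: of_bool_conj)

lemma computable_pred_not [computable]:
  assumes "computable_pred P"
  shows "computable_pred (\<lambda>\<gamma> n. \<not> P \<gamma> n)"
  using computable_fun_diff[OF computable_fun_const[of 1] assms[unfolded computable_pred_def]]
  unfolding computable_pred_def by (rule back_subst[of computable_fun]) (simp add: fun_eq_iff)

lemma computable_pred_less [computable]:
  assumes "computable_fun f" "computable_fun g"
  shows "computable_pred (\<lambda>\<gamma> n. f \<gamma> n < g \<gamma> n)"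
proof -
  have "computable_fun (\<lambda>\<gamma> n. if g \<gamma> n - f \<gamma> n \<noteq> 0 then 1 else 0)"
    by (intro computable_fun_if_nonzero computable assms)
  then show ?thesis unfolding computable_pred_def
    by (rule back_subst[of computable_fun]) (simp add: fun_eq_iff)
qed

lemma computable_pred_le [computable]:
  assumes "computable_fun f" "computable_fun g"
  shows "computable_pred (\<lambda>\<gamma> n. f \<gamma> n \<le> g \<gamma> n)"
  using computable_pred_not[OF computable_pred_less[OF assms(2,1)]] by (simp add: not_less)

lemma computable_pred_eq [computable]:
  assumes "computable_fun f" "computable_fun g"
  shows "computable_pred (\<lambda>\<gamma> n. f \<gamma> n = g \<gamma> n)"
  using computable_pred_conj[OF computable_pred_le[OF assms] computable_pred_le[OF assms(2,1)]]
  by (simp add: order_eq_iff)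

lemma computable_pred_ball:
  assumes Q: "computable_pred (\<lambda>\<gamma> z. Q \<gamma> (pfst z) (psnd z))" and k: "computable_fun k"
  shows "computable_pred (\<lambda>\<gamma> n. \<forall>i < k \<gamma> n. Q \<gamma> n i)"
proof -
  have "computable_fun (\<lambda>\<gamma> n. rec_nat 1 (\<lambda>i acc. if Q \<gamma> n i then acc else 0) (k \<gamma> n))"
    using computable_pred_comp[OF Q, of "\<lambda>_ z. prod_encode (pfst z, pfst (psnd z))"]
    by (intro computable_fun_rec computable_fun_if computable k)
       (simp add: computable)
  moreover have "rec_nat (1::nat) (\<lambda>i acc. if P i then acc else 0) j = of_bool (\<forall>i<j. P i)" for P and j :: nat
    by (induction j) (auto simp: less_Suc_eq)
  ultimately show ?thesis by (simp only: computable_pred_def)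
qed

text \<open>
  Unbounded search is a loop on pairs of the argument and the candidate.
\<close>
lemma computable_fun_Least:
  assumes Q: "computable_pred (\<lambda>\<gamma> z. Q \<gamma> (pfst z) (psnd z))" and ex: "\<And>\<gamma> n. \<exists>i. Q \<gamma> n i"
  shows "computable_fun (\<lambda>\<gamma> n. LEAST i. Q \<gamma> n i)"
proof -
  let ?s = "\<lambda>\<gamma> z. prod_encode (pfst z, Suc (psnd z))"
  have p: "computable_fun (\<lambda>\<gamma> z. of_bool (\<not> Q \<gamma> (pfst z) (psnd z)))"
    using computable_pred_not[OF Q] by (simp only: computable_pred_def)
  have s: "computable_fun ?s" by (intro computable)
  have i: "computable_fun (\<lambda>\<gamma> n. prod_encode (n, 0))" by (intro computable)
  have o: "computable_fun (\<lambda>_ z. psnd z)" by (intro computable)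
  have iter: "(?s \<gamma> ^^ j) (prod_encode (n, 0)) = prod_encode (n, j)" for \<gamma> n j
    by (induction j) simp_all
  show ?thesis
    by (rule computable_funI[OF computable_rel_relcomp[OF i[unfolded computable_fun_def]
        computable_rel_relcomp[OF computable_rel_while[OF p s] o[unfolded computable_fun_def]]]])
      (intro exI conjI, rule refl, rule refl,
       auto simp: iter intro: LeastI_ex[OF ex] dest: not_less_Least)
qed

lemma computable_fun_div [computable]:
  assumes "computable_fun f" "computable_fun g"
  shows "computable_fun (\<lambda>\<gamma> n. f \<gamma> n div g \<gamma> n)"
proof -
  have "computable_fun (\<lambda>\<gamma> n. rec_nat 0
      (\<lambda>_ acc. if 0 < g \<gamma> n \<and> Suc acc * g \<gamma> n \<le> f \<gamma> n then Suc acc else acc) (f \<gamma> n))"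
    by (intro computable_fun_rec computable assms computable_fun_comp[OF assms(1)]
      computable_fun_comp[OF assms(2)])
  moreover have "rec_nat 0 (\<lambda>_ acc. if 0 < y \<and> Suc acc * y \<le> x then Suc acc else acc) k
      = min k (x div y)" for x y k :: nat
  proof (induction k)
    case (Suc k)
    show ?case
    proof (cases "y = 0")
      case False
      then have "Suc c * y \<le> x \<longleftrightarrow> Suc c \<le> x div y" for c by (simp add: less_eq_div_iff_mult_less_eq)
      then show ?thesis using False Suc by (auto simp: min_def)
    qed (use Suc in simp)
  qed simp
  ultimately show ?thesis by (simp add: min_absorb2)
qed

lemma computable_fun_mod [computable]:
  assumes "computable_fun f" "computable_fun g"
  shows "computable_fun (\<lambda>\<gamma> n. f \<gamma> n mod g \<gamma> n)"
  unfolding minus_div_mult_eq_mod[symmetric] by (intro computable assms)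

lemma computable_fun_funpow:
  assumes h: "computable_fun (\<lambda>\<gamma> z. h \<gamma> (pfst z) (psnd z))"
    and g: "computable_fun g" and k: "computable_fun k"
  shows "computable_fun (\<lambda>\<gamma> n. (h \<gamma> n ^^ k \<gamma> n) (g \<gamma> n))"
proof -
  have "computable_fun (\<lambda>\<gamma> n. rec_nat (g \<gamma> n) (\<lambda>i acc. h \<gamma> n acc) (k \<gamma> n))"
    using computable_fun_comp[OF h, of "\<lambda>_ z. prod_encode (pfst z, psnd (psnd z))"]
    by (intro computable_fun_rec g k) (simp add: computable)
  moreover have "rec_nat x (\<lambda>i acc. f acc) j = (f ^^ j) x" for f and x j :: nat
    by (induction j) auto
  ultimately show ?thesis by simp
qed

section \<open>Codes of lists\<close>

text \<open>
  List operations on the codes of \<open>list_encode\<close>.  The empty list has code 0, and there \<open>lhd\<close> and \<open>ltl\<close>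
  both return 0, which is what reading and moving on a tape beyond its stored cells requires.
\<close>
definition lcons :: "nat \<Rightarrow> nat \<Rightarrow> nat" where "lcons x l = Suc (prod_encode (x, l))"
definition lhd :: "nat \<Rightarrow> nat" where "lhd l = pfst (l - 1)"
definition ltl :: "nat \<Rightarrow> nat" where "ltl l = psnd (l - 1)"
definition lnth :: "nat \<Rightarrow> nat \<Rightarrow> nat" where "lnth l i = lhd ((ltl ^^ i) l)"

lemma pfst_0 [simp]: "pfst 0 = 0" and psnd_0 [simp]: "psnd 0 = 0"
  by (simp_all add: pfst_def psnd_def prod_decode_def prod_decode_aux.simps)

lemma lcons_list_encode [simp]: "lcons x (list_encode xs) = list_encode (x # xs)"
  by (simp add: lcons_def)

lemma lhd_list_encode: "lhd (list_encode xs) = (case xs of [] \<Rightarrow> 0 | x # _ \<Rightarrow> x)"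
  by (cases xs) (simp_all add: lhd_def)

lemma ltl_list_encode: "ltl (list_encode xs) = list_encode (tl xs)"
  by (cases xs) (simp_all add: ltl_def)

lemma ltl_funpow: "(ltl ^^ i) (list_encode xs) = list_encode (drop i xs)"
proof (induction i arbitrary: xs)
  case (Suc i)
  then show ?case by (simp add: ltl_list_encode tl_drop drop_Suc)
qed simp

lemma lnth_list_encode: "lnth (list_encode xs) i = (if i < length xs then xs ! i else 0)"
  unfolding lnth_def ltl_funpow lhd_list_encode
  by (auto simp: hd_drop_conv_nth[symmetric] split: list.splits)

lemma computable_fun_lcons [computable]:
  "computable_fun f \<Longrightarrow> computable_fun g \<Longrightarrow> computable_fun (\<lambda>\<gamma> n. lcons (f \<gamma> n) (g \<gamma> n))"
  unfolding lcons_def by (intro computable)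

lemma computable_fun_lhd [computable]:
  "computable_fun f \<Longrightarrow> computable_fun (\<lambda>\<gamma> n. lhd (f \<gamma> n))"
  unfolding lhd_def by (intro computable)

lemma computable_fun_ltl [computable]:
  "computable_fun f \<Longrightarrow> computable_fun (\<lambda>\<gamma> n. ltl (f \<gamma> n))"
  unfolding ltl_def by (intro computable)

lemma computable_fun_lnth [computable]:
  "computable_fun f \<Longrightarrow> computable_fun g \<Longrightarrow> computable_fun (\<lambda>\<gamma> n. lnth (f \<gamma> n) (g \<gamma> n))"
  unfolding lnth_def by (intro computable computable_fun_funpow[of "\<lambda>_ _. ltl"])

lemma computable_fun_list:
  assumes "\<And>i. i \<in> set is \<Longrightarrow> computable_fun (f i)"
  shows "computable_fun (\<lambda>\<gamma> n. list_encode (map (\<lambda>i. f i \<gamma> n) is))"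
  using assms
proof (induction "is")
  case Nil
  then show ?case by (simp add: computable)
next
  case (Cons i "is")
  then have "computable_fun (\<lambda>\<gamma> n. lcons (f i \<gamma> n) (list_encode (map (\<lambda>i. f i \<gamma> n) is)))"
    by (intro computable) auto
  then show ?case by simp
qed

lemma computable_fun_finite_table:
  assumes "finite K"
  shows "computable_fun (\<lambda>\<gamma> n. if n \<in> K then g n else 0)"
  using assms
proof induction
  case empty
  show ?case by (simp add: computable)
next
  case (insert k K)
  have "computable_fun (\<lambda>\<gamma> n. if n = k then g k else if n \<in> K then g n else 0)"
    by (intro computable insert.IH)
  then show ?case
    by (rule back_subst[of computable_fun]) (auto simp: fun_eq_iff)
qed

text \<open>
  The unary representation of numbers on tapes, and its inverse.
\<close>
definition ones :: "nat \<Rightarrow> nat" where "ones n = (lcons 1 ^^ n) 0"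
definition ones_length :: "nat \<Rightarrow> nat" where "ones_length l = (LEAST i. lnth l i \<noteq> 1)"

lemma ones_eq: "ones n = list_encode (replicate n 1)"
  unfolding ones_def by (induction n) (simp_all add: lcons_def)

lemma ones_length_eq: "ones_length (list_encode r) = length (takeWhile (\<lambda>s. s = 1) r)"
  unfolding ones_length_def
proof (rule Least_equality)
  show "lnth (list_encode r) (length (takeWhile (\<lambda>s. s = 1) r)) \<noteq> 1"
    using nth_length_takeWhile[of "\<lambda>s. s = 1" r] by (auto simp: lnth_list_encode)
next
  fix i assume i: "lnth (list_encode r) i \<noteq> 1"
  show "length (takeWhile (\<lambda>s. s = 1) r) \<le> i"
  proof (rule ccontr)
    assume "\<not> ?thesis"
    then have "i < length (takeWhile (\<lambda>s. s = 1) r)" by simp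
    moreover from this have "r ! i = 1"
      using takeWhile_nth[of i "\<lambda>s. s = 1" r] nth_mem[of i "takeWhile (\<lambda>s. s = 1) r"] set_takeWhileD by metis
    moreover have "length (takeWhile (\<lambda>s. s = 1) r) \<le> length r" by (rule length_takeWhile_le)
    ultimately show False using i by (simp add: lnth_list_encode)
  qed
qed

lemma computable_fun_ones [computable]:
  "computable_fun f \<Longrightarrow> computable_fun (\<lambda>\<gamma> n. ones (f \<gamma> n))"
  unfolding ones_def by (intro computable computable_fun_funpow[of "\<lambda>_ _. lcons 1"])

lemma computable_fun_ones_length [computable]:
  assumes "computable_fun f"
  shows "computable_fun (\<lambda>\<gamma> n. ones_length (f \<gamma> n))"
  unfolding ones_length_def
proof (rule computable_fun_Least)
  show "computable_pred (\<lambda>\<gamma> z. lnth (f \<gamma> (pfst z)) (psnd z) \<noteq> 1)"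
    by (intro computable computable_fun_comp[OF assms])
  show "\<exists>i. lnth (f \<gamma> n) i \<noteq> 1" for \<gamma> n
    by (rule exI[of _ "length (list_decode (f \<gamma> n))"])
       (use lnth_list_encode[of "list_decode (f \<gamma> n)"] in simp)
qed

section \<open>Simulating oracle machines\<close>
declare list_encode.simps(2) [simp del]

definition tape_code :: "tape \<Rightarrow> nat" where
  "tape_code t = prod_encode (list_encode (fst t), list_encode (snd t))"

text \<open>
  The code is a list with the state as entry 0 and tape \<open>i\<close> as entry \<open>Suc i\<close>.
\<close>
definition config_code :: "nat \<times> tape list \<Rightarrow> nat" where
  "config_code C = list_encode (fst C # map tape_code (snd C))"

definition action_code :: "nat \<times> direction \<Rightarrow> nat" where
  "action_code a = prod_encode (fst a, case snd a of Stay \<Rightarrow> 0 | Move_Right \<Rightarrow> 1 | Move_Left \<Rightarrow> 2)"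

text \<open>
  The action of \<open>act_tape\<close> on codes; the directions \<open>Stay\<close>, \<open>Move_Right\<close> and \<open>Move_Left\<close> have the codes
  0, 1 and 2.
\<close>
definition act_code :: "nat \<Rightarrow> nat \<Rightarrow> nat" where
  "act_code a t =
     (if psnd a = 0 then prod_encode (pfst t, lcons (pfst a) (ltl (psnd t)))
      else if psnd a = 1 then prod_encode (lcons (pfst a) (pfst t), ltl (psnd t))
      else prod_encode (ltl (pfst t), lcons (lhd (pfst t)) (lcons (pfst a) (ltl (psnd t)))))"

lemma act_code_eq: "act_code (action_code a) (tape_code t) = tape_code (act_tape a t)"
proof -
  obtain s d l r where "a = (s, d)" "t = (l, r)" by (cases a; cases t) auto
  then show ?thesis
    by (cases d) (simp_all add: act_code_def action_code_def tape_code_def ltl_list_encode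
        lhd_list_encode split: list.splits)
qed

lemma read_tape_code: "lhd (psnd (tape_code t)) = read_tape t"
  by (simp add: tape_code_def lhd_list_encode read_tape_def)

lemma tape_code_tape_of_nat: "tape_code (tape_of_nat n) = prod_encode (0, ones n)"
  by (simp add: tape_code_def tape_of_nat_def ones_eq)

lemma nat_of_tape_code: "ones_length (psnd (tape_code t)) = nat_of_tape t"
  by (simp add: tape_code_def ones_length_eq nat_of_tape_def)

lemma computable_fun_act_code [computable]:
  "computable_fun f \<Longrightarrow> computable_fun g \<Longrightarrow> computable_fun (\<lambda>\<gamma> n. act_code (f \<gamma> n) (g \<gamma> n))"
  unfolding act_code_def by (intro computable)

text \<open>
  The transition function of a machine is an arbitrary function, computable only because it matters on
  finitely many arguments.  On these it is a finite table.
\<close>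
definition transition_keys :: "otm \<Rightarrow> nat set" where
  "transition_keys M = list_encode ` {q # ss | q ss. q < num_states M \<and>
     set ss \<subseteq> {..<num_symbols M} \<and> length ss = num_tapes M}"

definition transition_code :: "otm \<Rightarrow> nat \<Rightarrow> nat" where
  "transition_code M k = (case transition M (hd (list_decode k)) (tl (list_decode k)) of
     (q, as) \<Rightarrow> list_encode (q # map action_code as))"

lemma finite_transition_keys: "finite (transition_keys M)"
proof -
  have "{q # ss | q ss. q < num_states M \<and> set ss \<subseteq> {..<num_symbols M} \<and> length ss = num_tapes M}
     = (\<lambda>(q, ss). q # ss) ` ({..<num_states M} \<times> {ss. set ss \<subseteq> {..<num_symbols M} \<and> length ss = num_tapes M})"
    by auto
  then show ?thesis
    unfolding transition_keys_def by (simp add: finite_lists_length_eq)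
qed

definition lookup_transition :: "otm \<Rightarrow> nat \<Rightarrow> nat" where
  "lookup_transition M k = (if k \<in> transition_keys M then transition_code M k else 0)"

lemma computable_fun_lookup_transition [computable]:
  "computable_fun f \<Longrightarrow> computable_fun (\<lambda>\<gamma> n. lookup_transition M (f \<gamma> n))"
  unfolding lookup_transition_def
  by (rule computable_fun_comp[OF computable_fun_finite_table[OF finite_transition_keys]])

text \<open>
  One step on pairs of a parameter \<open>p\<close> and the code of a configuration, where queries are answered by
  \<open>h\<close> at the pair of \<open>p\<close> and the query.  The oracle tape, tape 1, is entry 2 of the code.
\<close>
definition step_code ::
  "((nat \<Rightarrow> nat) \<Rightarrow> nat \<Rightarrow> nat) \<Rightarrow> otm \<Rightarrow> (nat \<Rightarrow> nat) \<Rightarrow> nat \<Rightarrow> nat" where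
  "step_code h M \<gamma> z =
    (let p = pfst z; C = psnd z; T = \<lambda>i. lnth (ltl C) i;
         k = list_encode (map (\<lambda>i. if i = 0 then lhd C else lhd (psnd (T (i - 1)))) [0..<Suc (num_tapes M)]);
         A = lookup_transition M k
     in prod_encode (p,
      if lhd C = 1 then C
      else if lhd C = 2 then list_encode (map (\<lambda>i. if i = 0 then 3
         else if i = 2 then prod_encode (0, ones (h \<gamma> (prod_encode (p, ones_length (psnd (T 1))))))
         else T (i - 1)) [0..<Suc (num_tapes M)])
      else list_encode (map (\<lambda>i. if i = 0 then lhd A else act_code (lnth (ltl A) (i - 1)) (T (i - 1)))
         [0..<Suc (num_tapes M)])))"

lemma computable_fun_step_code:
  assumes "computable_fun h"
  shows "computable_fun (step_code h M)"
proof -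
  have "computable_fun (\<lambda>\<gamma> z. step_code h M \<gamma> z)"
    unfolding step_code_def Let_def
    by (intro computable computable_fun_list computable_fun_comp[OF assms])
  then show ?thesis by simp
qed

text \<open>
  The invariant which ensures that the lookup in the finite table succeeds at every step.
\<close>
definition valid_config :: "otm \<Rightarrow> nat \<times> tape list \<Rightarrow> bool" where
  "valid_config M C \<longleftrightarrow> fst C < num_states M \<and> length (snd C) = num_tapes M \<and>
     (\<forall>t\<in>set (snd C). set (fst t) \<union> set (snd t) \<subseteq> {..<num_symbols M})"

lemma map_upt_Suc_Cons: "map f [0..<Suc n] = f 0 # map (\<lambda>i. f (Suc i)) [0..<n]"
  by (simp add: map_upt_Suc del: upt_Suc)

lemma read_tape_bound:
  assumes "set (snd t) \<subseteq> {..<B}" "0 < B" shows "read_tape t < B"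
  using assms by (auto simp: read_tape_def split: list.splits)

lemma valid_config_transition:
  assumes "turing_machine M" "valid_config M (q, ts)"
  obtains q' as where "transition M q (map read_tape ts) = (q', as)" "q' < num_states M"
    "length as = num_tapes M" "\<And>a. a \<in> set as \<Longrightarrow> fst a < num_symbols M"
    "list_encode (q # map read_tape ts) \<in> transition_keys M"
proof -
  have M: "num_symbols M \<ge> 2" using assms(1) by (simp add: turing_machine_def)
  have q: "q < num_states M" and len: "length ts = num_tapes M" using assms(2) by (auto simp: valid_config_def)
  have r: "read_tape t < num_symbols M" if "t \<in> set ts" for t
    using assms(2) that M by (intro read_tape_bound) (auto simp: valid_config_def)
  obtain q' as where qa: "transition M q (map read_tape ts) = (q', as)" by force
  have "length (map read_tape ts) = num_tapes M \<and> (\<forall>s\<in>set (map read_tape ts). s < num_symbols M)"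
    using r len by auto
  then have "case transition M q (map read_tape ts) of (q', as) \<Rightarrow>
           q' < num_states M \<and> length as = num_tapes M \<and> (\<forall>(s, d)\<in>set as. s < num_symbols M)"
    using assms(1) q unfolding turing_machine_def by simp
  then have "q' < num_states M" "length as = num_tapes M" "\<And>a. a \<in> set as \<Longrightarrow> fst a < num_symbols M"
    unfolding qa by auto
  moreover have "list_encode (q # map read_tape ts) \<in> transition_keys M"
    unfolding transition_keys_def using q r len by (intro imageI) auto
  ultimately show ?thesis by (rule that[OF qa])
qed

lemma set_act_tape:
  assumes "set (fst t) \<union> set (snd t) \<subseteq> {..<B}" "fst a < B"
  shows "set (fst (act_tape a t)) \<union> set (snd (act_tape a t)) \<subseteq> {..<B}"
proof -
  obtain s d l r where at: "a = (s, d)" "t = (l, r)" by (cases a; cases t) auto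
  have "set (tl xs) \<subseteq> set xs" for xs :: "nat list" by (cases xs) auto
  then show ?thesis
    using assms unfolding at by (cases d) (auto split: list.splits)
qed

lemma valid_config_step:
  assumes "turing_machine M" "valid_config M C"
  shows "valid_config M (otm_step \<gamma> M C)"
proof -
  obtain q ts where C: "C = (q, ts)" by force
  have M: "num_states M \<ge> 4" "num_symbols M \<ge> 2" "num_tapes M \<ge> 2"
    using assms(1) by (simp_all add: turing_machine_def)
  consider "q = 1" | "q = 2" | "q \<noteq> 1" "q \<noteq> 2" by blast
  then show ?thesis
  proof cases
    case 1
    then show ?thesis using assms C by (simp add: otm_step_def)
  next
    case 2
    have "set (fst t) \<union> set (snd t) \<subseteq> {..<num_symbols M}"
      if "t \<in> set (ts[1 := tape_of_nat n])" for t n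
    proof -
      have "t \<in> insert (tape_of_nat n) (set ts)"
        using that set_update_subset_insert by fastforce
      then show ?thesis using assms(2) M by (auto simp: C valid_config_def tape_of_nat_def)
    qed
    then show ?thesis using 2 M assms(2) by (auto simp: C otm_step_def valid_config_def)
  next
    case 3
    obtain q' as where a: "transition M q (map read_tape ts) = (q', as)" "q' < num_states M"
    "length as = num_tapes M" "\<And>a. a \<in> set as \<Longrightarrow> fst a < num_symbols M"
      by (rule valid_config_transition[OF assms(1) assms(2)[unfolded C]]) blast
    have s: "otm_step \<gamma> M C = (q', map2 act_tape as ts)"
      using 3 a by (simp add: C otm_step_def)
    have "set (fst t) \<union> set (snd t) \<subseteq> {..<num_symbols M}" if t: "t \<in> set (map2 act_tape as ts)" for t
    proof -
      obtain i where i: "i < length as" "i < length ts" "t = act_tape (as ! i) (ts ! i)"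
        using t by (auto simp: in_set_conv_nth)
      then show ?thesis using set_act_tape[of "ts ! i" "num_symbols M" "as ! i"] assms(2) a(4)
        by (simp add: C valid_config_def)
    qed
    then show ?thesis unfolding s valid_config_def using a assms(2) by (simp add: C valid_config_def)
  qed
qed

lemma valid_config_init:
  assumes "turing_machine M" shows "valid_config M (otm_init M n)"
proof -
  have M: "num_states M \<ge> 4" "num_symbols M \<ge> 2" "num_tapes M \<ge> 2"
    using assms(1) by (simp_all add: turing_machine_def)
  have "set (fst t) \<union> set (snd t) \<subseteq> {..<num_symbols M}"
    if "t \<in> set ((replicate (num_tapes M) ([], []))[0 := tape_of_nat n])" for t
  proof -
    have "t \<in> insert (tape_of_nat n) (set (replicate (num_tapes M) ([], [])))"
      using that set_update_subset_insert by fastforce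
    then show ?thesis using M by (auto simp: tape_of_nat_def)
  qed
  then show ?thesis using M by (simp add: otm_init_def valid_config_def)
qed

lemma step_code_eq:
  assumes M: "turing_machine M" and C: "valid_config M C"
  shows "step_code h M \<gamma> (prod_encode (p, config_code C)) =
    prod_encode (p, config_code (otm_step (\<lambda>i. h \<gamma> (prod_encode (p, i))) M C))"
proof -
  obtain q ts where qts: "C = (q, ts)" by force
  have T: "num_tapes M \<ge> 2" using M by (simp add: turing_machine_def)
  have len: "length ts = num_tapes M" using C by (simp add: valid_config_def qts)
  let ?C = "config_code C"
  have hd: "lhd ?C = q" by (simp add: config_code_def qts lhd_list_encode)
  have nth: "lnth (ltl ?C) i = tape_code (ts ! i)" if "i < num_tapes M" for i
    using that len by (simp add: config_code_def qts ltl_list_encode lnth_list_encode)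
  consider "q = 1" | "q = 2" | "q \<noteq> 1" "q \<noteq> 2" by blast
  then show ?thesis
  proof cases
    case 1
    then have "otm_step (\<lambda>i. h \<gamma> (prod_encode (p, i))) M C = C"
      by (simp add: qts otm_step_def)
    then show ?thesis
      unfolding step_code_def Let_def psnd_prod_encode pfst_prod_encode hd using 1 by simp
  next
    case 2
    have 1: "lnth (ltl ?C) 1 = tape_code (ts ! 1)" using T by (intro nth) simp
    have "map (\<lambda>i. if Suc i = 0 then 3
         else if Suc i = 2 then prod_encode (0, ones (h \<gamma> (prod_encode (p, ones_length (psnd (lnth (ltl ?C) 1))))))
         else lnth (ltl ?C) (Suc i - 1)) [0..<num_tapes M]
      = map tape_code (ts[1 := tape_of_nat (h \<gamma> (prod_encode (p, nat_of_tape (ts ! 1))))])"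
      by (rule nth_equalityI)
        (auto simp: len nth nth_list_update 1[simplified] nat_of_tape_code tape_code_tape_of_nat)
    then show ?thesis
      unfolding step_code_def Let_def psnd_prod_encode pfst_prod_encode hd map_upt_Suc_Cons
      using 2 by (simp add: qts otm_step_def) (simp add: config_code_def)
  next
    case 3
    obtain q' as where a: "transition M q (map read_tape ts) = (q', as)"
      "length as = num_tapes M" "list_encode (q # map read_tape ts) \<in> transition_keys M"
      by (rule valid_config_transition[OF M C[unfolded qts]]) blast
    let ?k = "list_encode (map (\<lambda>i. if i = 0 then q else lhd (psnd (lnth (ltl ?C) (i - 1)))) [0..<Suc (num_tapes M)])"
    have "map (\<lambda>i. lhd (psnd (lnth (ltl ?C) i))) [0..<num_tapes M] = map read_tape ts"
      by (rule nth_equalityI) (auto simp: len nth read_tape_code)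
    then have k: "?k = list_encode (q # map read_tape ts)"
      unfolding map_upt_Suc_Cons by simp
    let ?A = "list_encode (q' # map action_code as)"
    have A: "lookup_transition M ?k = ?A"
      unfolding k lookup_transition_def using a by (simp only: if_True transition_code_def list_encode_inverse) simp
    have "map (\<lambda>i. act_code (lnth (ltl ?A) i) (lnth (ltl ?C) i)) [0..<num_tapes M]
      = map tape_code (map2 act_tape as ts)"
      by (rule nth_equalityI)
        (auto simp: len a nth ltl_list_encode lnth_list_encode act_code_eq)
    then have "list_encode (map (\<lambda>i. if i = 0 then lhd ?A
        else act_code (lnth (ltl ?A) (i - 1)) (lnth (ltl ?C) (i - 1))) [0..<Suc (num_tapes M)])
      = config_code (q', map2 act_tape as ts)"
      unfolding map_upt_Suc_Cons by (simp add: config_code_def lhd_list_encode)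
    moreover have "otm_step (\<lambda>i. h \<gamma> (prod_encode (p, i))) M C = (q', map2 act_tape as ts)"
      using 3 a by (simp add: qts otm_step_def)
    ultimately show ?thesis
      unfolding step_code_def Let_def psnd_prod_encode pfst_prod_encode hd A using 3 by simp
  qed
qed

text \<open>
  A run of a machine can be computed even if its oracle is replaced by a computable function of the
  true oracle and of a parameter: a loop of coded steps until the halting state, which a halted
  machine never leaves.
\<close>
theorem computable_rel_otm_outputs:
  assumes M: "turing_machine M" and h: "computable_fun h"
  shows "computable_rel (\<lambda>\<gamma> z m. otm_outputs M (\<lambda>i. h \<gamma> (prod_encode (pfst z, i))) (psnd z) m)"
proof -
  have T: "num_tapes M \<ge> 2" using M by (simp add: turing_machine_def)
  let ?init = "\<lambda>\<gamma> z. prod_encode (pfst z, list_encode (map (\<lambda>i. if i = 0 then 0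
     else if i = 1 then prod_encode (0, ones (psnd z)) else prod_encode (0, 0)) [0..<Suc (num_tapes M)]))"
  let ?run = "\<lambda>\<gamma> z. of_bool (lhd (psnd z) \<noteq> 1) :: nat"
  let ?out = "\<lambda>\<gamma> z. ones_length (psnd (lnth (ltl (psnd z)) 0))"
  have init: "computable_fun ?init"
    by (intro computable computable_fun_list)
  have run: "computable_fun ?run"
    by (fold computable_pred_def) (intro computable)
  have out: "computable_fun ?out" by (intro computable)
  have step: "computable_fun (step_code h M)" by (rule computable_fun_step_code[OF h])
  have init_eq: "?init \<gamma> z = prod_encode (pfst z, config_code (otm_init M (psnd z)))" for \<gamma> z
  proof -
    have "map (\<lambda>i. if Suc i = 0 then 0 else if Suc i = 1 then prod_encode (0, ones (psnd z))
        else prod_encode (0, 0)) [0..<num_tapes M]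
      = map tape_code ((replicate (num_tapes M) ([], []))[0 := tape_of_nat (psnd z)])"
      by (rule nth_equalityI) (auto simp: nth_list_update tape_code_tape_of_nat, simp add: tape_code_def)
    then show ?thesis unfolding map_upt_Suc_Cons by (simp add: otm_init_def config_code_def)
  qed
  show ?thesis
  proof (rule computable_rel_mono[OF computable_rel_relcomp[OF init[unfolded computable_fun_def]
        computable_rel_relcomp[OF computable_rel_while[OF run step] out[unfolded computable_fun_def]]]])
    fix \<gamma> z m
    let ?\<gamma> = "\<lambda>i. h \<gamma> (prod_encode (pfst z, i))"
    let ?C = "\<lambda>k. (otm_step ?\<gamma> M ^^ k) (otm_init M (psnd z))"
    assume "otm_outputs M ?\<gamma> (psnd z) m"
    then obtain k ts where k: "?C k = (1, ts)" "nat_of_tape (ts ! 0) = m"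
      by (auto simp: otm_outputs_def)
    define l where "l = (LEAST l. fst (?C l) = 1)"
    have l: "fst (?C l) = 1" unfolding l_def by (rule LeastI[of _ k]) (simp add: k)
    have less: "fst (?C i) \<noteq> 1" if "i < l" for i using that unfolding l_def by (rule not_less_Least)
    have stay: "?C (l + i) = ?C l" for i
    proof (induction i)
      case (Suc i)
      have "otm_step ?\<gamma> M (?C l) = ?C l" using l by (cases "?C l") (simp add: otm_step_def)
      then show ?case using Suc by simp
    qed simp
    have "l \<le> k" unfolding l_def by (rule Least_le) (simp add: k)
    with stay[of "k - l"] k have Cl: "?C l = (1, ts)" by simp
    have valid: "valid_config M (?C i)" for i
      by (induction i) (simp_all add: valid_config_init[OF M] valid_config_step[OF M])
    have iter: "(step_code h M \<gamma> ^^ i) (?init \<gamma> z) = prod_encode (pfst z, config_code (?C i))" for i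
    proof (induction i)
      case 0
      show ?case unfolding init_eq by simp
    next
      case (Suc i)
      then show ?case using step_code_eq[OF M valid[of i], of h \<gamma> "pfst z"] by simp
    qed
    have state: "lhd (psnd (prod_encode (pfst z, config_code C))) = fst C" for C
      by (simp add: config_code_def lhd_list_encode)
    have "length ts = num_tapes M" using valid[of l] Cl by (simp add: valid_config_def)
    then have m: "m = ?out \<gamma> (prod_encode (pfst z, config_code (?C l)))"
      using T k(2) by (simp add: Cl config_code_def ltl_list_encode lnth_list_encode nat_of_tape_code)
    show "\<exists>y. y = ?init \<gamma> z \<and> (\<exists>x. (\<exists>k. x = (step_code h M \<gamma> ^^ k) y \<and> ?run \<gamma> x = 0 \<and>
        (\<forall>i<k. ?run \<gamma> ((step_code h M \<gamma> ^^ i) y) \<noteq> 0)) \<and> m = ?out \<gamma> x)"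
    proof (rule exI[of _ "?init \<gamma> z"], rule conjI[OF refl],
        rule exI[of _ "prod_encode (pfst z, config_code (?C l))"], rule conjI[OF _ m], rule exI[of _ l], intro conjI allI impI)
      show "prod_encode (pfst z, config_code (?C l)) = (step_code h M \<gamma> ^^ l) (?init \<gamma> z)"
        by (simp only: iter)
      show "?run \<gamma> (prod_encode (pfst z, config_code (?C l))) = 0"
        by (simp only: state l) simp
      show "?run \<gamma> ((step_code h M \<gamma> ^^ i) (?init \<gamma> z)) \<noteq> 0" if "i < l" for i
        unfolding state iter using less[OF that] by simp
    qed
  qed
qed

lemma computable_nat_fun_computable_fun:
  assumes "computable_nat_fun c" "computable_fun f"
  shows "computable_fun (\<lambda>\<gamma> n. c (f \<gamma> n))"
proof -
  obtain M where M: "turing_machine M" "\<And>\<gamma> n. otm_outputs M \<gamma> n (c n)"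
    using assms(1) by (auto simp: computable_nat_fun_def)
  have i: "computable_fun (\<lambda>\<gamma> n. prod_encode (0, f \<gamma> n))" by (intro computable assms)
  show ?thesis
    by (rule computable_funI[OF computable_rel_relcomp[OF i[unfolded computable_fun_def]
      computable_rel_otm_outputs[OF M(1) computable_fun_id]]]) (use M(2) in auto)
qed

section \<open>Codes of rationals and of tables\<close>
text \<open>
  Keeps the argument of a partial functional together with its value, for use in a later computation.
\<close>
lemma computable_rel_pair_input:
  assumes "computable_rel R"
  shows "computable_rel (\<lambda>\<gamma> n m. \<exists>y. R \<gamma> n y \<and> m = prod_encode (n, y))"
proof (rule computable_relI)
  fix b :: nat assume b: "b \<ge> 2"
  obtain c where c: "\<And>\<gamma> n m v. R \<gamma> n m \<Longrightarrow> v (b+2) = n \<Longrightarrow> (\<And>r. r > b+2 \<Longrightarrow> v r = 0) \<Longrightarrow>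
    exec \<gamma> c v (v((b+2) := m))"
    using assms by (rule computable_relE[where b = "b+2"]) (use b in auto)
  let ?c = "Seq (copy_cmd b (b+2) (b+1)) (Seq (move_cmd b (b+1)) (Seq c (encode_cmd b (b+1) (b+2))))"
  have "exec \<gamma> ?c v (v(b := prod_encode (v b, y)))" if "R \<gamma> (v b) y" "\<forall>r>b. v r = 0" for \<gamma> v y
    by (rule exec_eq[OF exec.Seq[OF exec_copy exec.Seq[OF exec_move exec.Seq[OF c[OF that(1)] exec_encode]]]])
       (use that(2) in \<open>auto simp: fun_eq_iff\<close>)
  then show "\<exists>c. \<forall>\<gamma> n m v. (\<exists>y. R \<gamma> n y \<and> m = prod_encode (n, y)) \<longrightarrow> v b = n \<longrightarrow>
      (\<forall>r>b. v r = 0) \<longrightarrow> exec \<gamma> c v (v(b := m))"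
    by (intro exI[of _ ?c]) blast
qed

lemma computable_fun_sum:
  assumes f: "computable_fun (\<lambda>\<gamma> z. f \<gamma> (pfst z) (psnd z))" and k: "computable_fun k"
  shows "computable_fun (\<lambda>\<gamma> n. \<Sum>i<k \<gamma> n. f \<gamma> n i)"
proof -
  have "computable_fun (\<lambda>\<gamma> n. rec_nat 0 (\<lambda>i acc. acc + f \<gamma> n i) (k \<gamma> n))"
    using computable_fun_comp[OF f, of "\<lambda>_ z. prod_encode (pfst z, pfst (psnd z))"]
    by (intro computable_fun_rec computable k) (simp add: computable)
  moreover have "rec_nat 0 (\<lambda>i acc. acc + g i) j = (\<Sum>i<j. g i)" for g :: "nat \<Rightarrow> nat" and j
    by (induction j) (simp_all add: lessThan_Suc add.commute)
  ultimately show ?thesis by (simp only:)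
qed

definition llength :: "nat \<Rightarrow> nat" where "llength l = (LEAST i. (ltl ^^ i) l = 0)"

lemma list_encode_eq_0_iff: "list_encode xs = 0 \<longleftrightarrow> xs = []"
  by (cases xs) (simp_all add: list_encode.simps)

lemma llength_list_encode: "llength (list_encode xs) = length xs"
  unfolding llength_def by (rule Least_equality) (auto simp: ltl_funpow list_encode_eq_0_iff)

lemma computable_fun_llength [computable]:
  assumes "computable_fun f" shows "computable_fun (\<lambda>\<gamma> n. llength (f \<gamma> n))"
  unfolding llength_def
proof (rule computable_fun_Least)
  show "computable_pred (\<lambda>\<gamma> z. (ltl ^^ psnd z) (f \<gamma> (pfst z)) = 0)"
    by (intro computable computable_fun_funpow[of "\<lambda>_ _. ltl"] computable_fun_comp[OF assms])
  show "\<exists>i. (ltl ^^ i) (f \<gamma> n) = 0" for \<gamma> n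
    by (rule exI[of _ "length (list_decode (f \<gamma> n))"])
       (use ltl_funpow[of _ "list_decode (f \<gamma> n)"] in \<open>simp add: list_encode_eq_0_iff\<close>)
qed

subsection \<open>Codes of rationals\<close>

lemma int_decode_eq:
  "int_decode n = int (if n mod 2 = 0 then n div 2 else 0) - int (if n mod 2 = 0 then 0 else Suc (n div 2))"
  by (auto simp: int_decode_def sum_decode_def even_iff_mod_2_eq_zero)

lemma rat_of_code_eq: "rat_of_code m = of_int (int_decode (pfst m)) / real (Suc (psnd m))"
  by (simp add: rat_of_code_def pfst_def psnd_def split: prod.split)

definition nat_pos :: "nat \<Rightarrow> nat" where "nat_pos n = (if n mod 2 = 0 then n div 2 else 0)"
definition nat_neg :: "nat \<Rightarrow> nat" where "nat_neg n = (if n mod 2 = 0 then 0 else Suc (n div 2))"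

text \<open>
  Equality of rationals in terms of natural numbers: denominators are cleared, and every integer is
  written as the difference of \<open>nat_pos\<close> and \<open>nat_neg\<close>.
\<close>
lemma scaled_rat_of_code_eq_iff:
  "2 ^ j * rat_of_code m = rat_of_code k \<longleftrightarrow>
   2 ^ j * nat_pos (pfst m) * Suc (psnd k) + nat_neg (pfst k) * Suc (psnd m) =
   nat_pos (pfst k) * Suc (psnd m) + 2 ^ j * nat_neg (pfst m) * Suc (psnd k)"
proof -
  have r: "rat_of_code m = (real (nat_pos (pfst m)) - real (nat_neg (pfst m))) / real (Suc (psnd m))" for m
    by (simp add: rat_of_code_eq int_decode_eq nat_pos_def nat_neg_def)
  have "2 ^ j * rat_of_code m = rat_of_code k \<longleftrightarrow>
     2 ^ j * (real (nat_pos (pfst m)) - real (nat_neg (pfst m))) * real (Suc (psnd k)) =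
     (real (nat_pos (pfst k)) - real (nat_neg (pfst k))) * real (Suc (psnd m))"
    unfolding r by (simp add: divide_simps del: of_nat_Suc)
  also have "\<dots> \<longleftrightarrow> real (2 ^ j * nat_pos (pfst m) * Suc (psnd k) + nat_neg (pfst k) * Suc (psnd m)) =
   real (nat_pos (pfst k) * Suc (psnd m) + 2 ^ j * nat_neg (pfst m) * Suc (psnd k))"
    by (simp add: algebra_simps)
  finally show ?thesis by (simp only: of_nat_eq_iff)
qed

lemma computable_pred_scaled_rat [computable]:
  assumes "computable_fun f" "computable_fun g" "computable_fun h"
  shows "computable_pred (\<lambda>\<gamma> n. 2 ^ f \<gamma> n * rat_of_code (g \<gamma> n) = rat_of_code (h \<gamma> n))"
  unfolding scaled_rat_of_code_eq_iff nat_pos_def nat_neg_def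
  by (intro computable assms)

text \<open>
  Division of a coded rational by \<open>2 ^ j\<close>; denominators are stored minus 1.
\<close>
definition halve_code :: "nat \<Rightarrow> nat \<Rightarrow> nat" where
  "halve_code j m = prod_encode (pfst m, 2 ^ j * Suc (psnd m) - 1)"

lemma rat_of_code_halve_code: "rat_of_code (halve_code j m) = rat_of_code m / 2 ^ j"
proof -
  have "Suc (2 ^ j * Suc (psnd m) - 1) = 2 ^ j * Suc (psnd m)" by simp
  then show ?thesis unfolding rat_of_code_eq halve_code_def pfst_prod_encode psnd_prod_encode
    by (simp add: algebra_simps)
qed

subsection \<open>Evaluating tables\<close>

text \<open>
  A number \<open>w\<close> represents a configuration with letter number \<open>digit A w i\<close> at the group element \<open>e i\<close>.
\<close>
definition digit :: "nat \<Rightarrow> nat \<Rightarrow> nat \<Rightarrow> nat" where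
  "digit A w i = w div A ^ i mod A"

lemma digit_less: "0 < A \<Longrightarrow> digit A w i < A"
  by (simp add: digit_def)

lemma digit_expansion_less:
  assumes "\<And>i. i < N \<Longrightarrow> d i < (A::nat)"
  shows "(\<Sum>i<N. d i * A ^ i) < A ^ N"
  using assms
proof (induction N)
  case (Suc N)
  have "(\<Sum>i<N. d i * A ^ i) < A ^ N" by (rule Suc.IH) (use Suc.prems in auto)
  then have "(\<Sum>i<Suc N. d i * A ^ i) < Suc (d N) * A ^ N" by simp
  also have "\<dots> \<le> A * A ^ N" using Suc.prems[of N] by (intro mult_right_mono) auto
  finally show ?case by simp
qed simp

lemma digit_digit_expansion:
  assumes "\<And>i. i < N \<Longrightarrow> d i < (A::nat)" "i < N"
  shows "digit A (\<Sum>i<N. d i * A ^ i) i = d i"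
  using assms
proof (induction N)
  case (Suc N)
  have A: "0 < A" using Suc.prems by (metis gr_zeroI not_less0)
  let ?w = "\<Sum>i<N. d i * A ^ i"
  have w: "?w < A ^ N" by (rule digit_expansion_less) (use Suc.prems in auto)
  show ?case
  proof (cases "i = N")
    case True
    then show ?thesis using w A Suc.prems(1)[of N] by (simp add: digit_def)
  next
    case False
    then have i: "i < N" using Suc.prems by simp
    then obtain l where l: "N = i + Suc l" using less_imp_Suc_add by auto
    have eq: "?w + d N * A ^ N = ?w + A ^ i * (A * (d N * A ^ l))"
      by (simp add: l power_add algebra_simps)
    have "(?w + d N * A ^ N) div A ^ i = ?w div A ^ i + A * (d N * A ^ l)"
      unfolding eq using A by simp
    then have "digit A (?w + d N * A ^ N) i = digit A ?w i"
      by (simp add: digit_def)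
    then show ?thesis using Suc.IH Suc.prems(1) i by simp
  qed
qed simp

text \<open>
  The code of the rational that the table \<open>c\<close> assigns to the configuration represented by \<open>w\<close>.  The sum is
  the \<open>horner_sum\<close> in \<open>table_code\<close>.
\<close>
definition table_value :: "nat \<Rightarrow> nat \<Rightarrow> nat \<Rightarrow> nat" where
  "table_value A c w =
     lnth (psnd c) (\<Sum>i<llength (pfst c). digit A w (lnth (pfst c) i) * A ^ i)"

lemma table_value_eq:
  fixes a :: "'a::finite \<Rightarrow> nat"
  assumes c: "table_code e a c f" and a: "bij_betw a UNIV {..<CARD('a)}"
    and w: "\<And>i. i \<in> set (list_decode (pfst c)) \<Longrightarrow> digit CARD('a) w i = a (x (e i))"
  shows "f x = rat_of_code (table_value CARD('a) c w)"
proof -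
  let ?A = "CARD('a)"
  define ns where "ns = list_decode (pfst c)"
  define qs where "qs = list_decode (psnd c)"
  have c1: "pfst c = list_encode ns" "psnd c = list_encode qs" by (simp_all add: ns_def qs_def)
  have f: "f x = rat_of_code (qs ! horner_sum (\<lambda>i. a (x (e i))) ?A ns)" "length qs = ?A ^ length ns"
    using c by (simp_all add: table_code_def Let_def ns_def qs_def pfst_def psnd_def)
  have h: "horner_sum (\<lambda>i. a (x (e i))) ?A ns = (\<Sum>i<length ns. digit ?A w (ns ! i) * ?A ^ i)"
    unfolding horner_sum_eq_sum by (rule sum.cong) (use w in \<open>auto simp: ns_def\<close>)
  have "(\<Sum>i<length ns. digit ?A w (ns ! i) * ?A ^ i) < ?A ^ length ns"
    by (rule digit_expansion_less) (simp add: digit_less)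
  moreover have "(\<Sum>i<llength (pfst c). digit ?A w (lnth (pfst c) i) * ?A ^ i)
    = (\<Sum>i<length ns. digit ?A w (ns ! i) * ?A ^ i)"
    unfolding c1 llength_list_encode by (rule sum.cong) (auto simp: lnth_list_encode)
  ultimately show ?thesis
    unfolding f h table_value_def using f(2) by (simp add: c1 lnth_list_encode)
qed

lemma list_decode_less: "i \<in> set (list_decode l) \<Longrightarrow> i < l"
proof -
  have "i \<in> set xs \<Longrightarrow> i < list_encode xs" for xs
  proof (induction xs)
    case (Cons x xs)
    then show ?case using le_prod_encode_1[of x "list_encode xs"] le_prod_encode_2[of "list_encode xs" x]
      by (auto simp: list_encode.simps)
  qed simp
  from this[of "list_decode l"] show "i \<in> set (list_decode l) \<Longrightarrow> i < l" by simp
qed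

lemma pfst_le: "pfst c \<le> c"
  using le_prod_encode_1[of "pfst c" "psnd c"] by simp

text \<open>
  A decidable form of \<open>2 ^ j * f = f'\<close> for functions \<open>f\<close> and \<open>f'\<close> with tables \<open>c\<close> and \<open>c'\<close>, whose windows
  may differ.  Every index in a window is smaller than the code of its table, so \<open>c + c'\<close> digits
  suffice to represent all patterns on both windows.
\<close>
definition scaled_tables :: "nat \<Rightarrow> nat \<Rightarrow> nat \<Rightarrow> nat \<Rightarrow> bool" where
  "scaled_tables A j c c' \<longleftrightarrow> (\<forall>w < A ^ (c + c').
     2 ^ j * rat_of_code (table_value A c w) = rat_of_code (table_value A c' w))"

lemma scaled_tables_iff:
  fixes a :: "'a::finite \<Rightarrow> nat"
  assumes e: "bij e" and a: "bij_betw a UNIV {..<CARD('a)}"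
    and c: "table_code e a c f" and c': "table_code e a c' f'"
  shows "scaled_tables CARD('a) j c c' \<longleftrightarrow> (\<forall>x. 2 ^ j * f x = f' x)"
proof
  let ?A = "CARD('a)"
  assume s: "scaled_tables ?A j c c'"
  show "\<forall>x. 2 ^ j * f x = f' x"
  proof
    fix x
    let ?w = "\<Sum>i<c + c'. a (x (e i)) * ?A ^ i"
    have d: "a (x (e i)) < ?A" for i using a by (auto simp: bij_betw_def)
    have w: "digit ?A ?w i = a (x (e i))" if "i < c + c'" for i
      using d that by (rule digit_digit_expansion)
    have 1: "f x = rat_of_code (table_value ?A c ?w)"
      by (rule table_value_eq[OF c a], rule w) (use list_decode_less[of _ "pfst c"] pfst_le[of c] in force)
    have 2: "f' x = rat_of_code (table_value ?A c' ?w)"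
      by (rule table_value_eq[OF c' a], rule w) (use list_decode_less[of _ "pfst c'"] pfst_le[of c'] in force)
    have "?w < ?A ^ (c + c')" using d by (rule digit_expansion_less)
    with s show "2 ^ j * f x = f' x" unfolding 1 2 scaled_tables_def by blast
  qed
next
  let ?A = "CARD('a)"
  assume eq: "\<forall>x. 2 ^ j * f x = f' x"
  show "scaled_tables ?A j c c'"
    unfolding scaled_tables_def
  proof (intro allI impI)
    fix w
    let ?x = "\<lambda>g. inv_into UNIV a (digit ?A w (inv e g))"
    have w: "digit ?A w i = a (?x (e i))" for i
    proof -
      have "digit ?A w i \<in> range a"
        using a digit_less[of ?A w i] by (auto simp: bij_betw_def)
      then show ?thesis using e by (simp add: f_inv_into_f bij_is_inj)
    qed
    have "f ?x = rat_of_code (table_value ?A c w)" by (rule table_value_eq[OF c a w])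
    moreover have "f' ?x = rat_of_code (table_value ?A c' w)" by (rule table_value_eq[OF c' a w])
    ultimately show "2 ^ j * rat_of_code (table_value ?A c w) = rat_of_code (table_value ?A c' w)"
      using eq by metis
  qed
qed

lemma computable_fun_table_value [computable]:
  assumes "computable_fun f" "computable_fun g"
  shows "computable_fun (\<lambda>\<gamma> n. table_value A (f \<gamma> n) (g \<gamma> n))"
  unfolding table_value_def digit_def
  by (intro computable computable_fun_sum assms computable_fun_comp[OF assms(1)] computable_fun_comp[OF assms(2)])

lemma computable_pred_scaled_tables [computable]:
  assumes "computable_fun f" "computable_fun g" "computable_fun h"
  shows "computable_pred (\<lambda>\<gamma> n. scaled_tables A (f \<gamma> n) (g \<gamma> n) (h \<gamma> n))"
  unfolding scaled_tables_def
  by (intro computable_pred_ball computable assms computable_fun_comp[OF assms(1)]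
    computable_fun_comp[OF assms(2)] computable_fun_comp[OF assms(3)])

section \<open>Computing a limit of rescalings\<close>
text \<open>
  If \<open>s (\<gamma> (m + j))\<close> is within \<open>1 / 2 ^ (m + j)\<close> of \<open>\<phi>\<close>, then its multiple by \<open>2 ^ j\<close> is within \<open>1 / 2 ^ m\<close> of
  \<open>2 ^ j * \<phi>\<close>, and this multiple again is a member of the enumeration, since that ranges over all
  rational locally constant functions.  So an oracle for \<open>\<phi>\<close> computes one for \<open>2 ^ j * \<phi>\<close>.  Running
  the machine for \<open>P\<close> on it with precision 1 and dividing by \<open>2 ^ j\<close> gives \<open>g \<phi>\<close> with error at most
  \<open>(L + 1) / 2 ^ j\<close>.
\<close>
theorem computable_functional_scaling_limit:
  fixes e :: "nat \<Rightarrow> 'g" and a :: "'a::{finite,discrete_topology} \<Rightarrow> nat"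
    and s :: "nat \<Rightarrow> (('g \<Rightarrow> 'a) \<Rightarrow>\<^sub>C real)"
  assumes e: "bij e" and a: "bij_betw a UNIV {..<CARD('a)}"
    and s: "computable_enumeration e a s" and P: "computable_functional s P"
    and lim: "\<And>j \<phi>. \<bar>P ((2 ^ j) *\<^sub>R \<phi>) / 2 ^ j - g \<phi>\<bar> \<le> L / 2 ^ j"
  shows "computable_functional s g"
proof -
  let ?A = "CARD('a)"
  obtain c where c: "computable_nat_fun c" "\<And>n. table_code e a (c n) (apply_bcontfun (s n))"
    and range: "range s = {f. locally_constant (apply_bcontfun f) \<and> (\<forall>x. apply_bcontfun f x \<in> \<rat>)}"
    using s by (auto simp: computable_enumeration_def)
  obtain M where M: "turing_machine M" "\<And>\<phi> \<gamma> n. oracle_for s \<phi> \<gamma> \<Longrightarrow>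
      \<exists>m. otm_outputs M \<gamma> n m \<and> \<bar>rat_of_code m - P \<phi>\<bar> < 1 / 2 ^ n"
    using P by (auto simp: computable_functional_def)
  obtain k :: nat where k: "L + 1 \<le> 2 ^ k"
    using real_arch_pow[of 2 "L + 1"] less_imp_le by auto
  have scaled: "scaled_tables ?A j (c i) (c i') \<longleftrightarrow> s i' = (2 ^ j) *\<^sub>R s i" for j i i'
    unfolding scaled_tables_iff[OF e a c(2) c(2)] by (auto simp: bcontfun_eqI scaleR_bcontfun.rep_eq)
  \<comment> \<open>The simulated oracle: at \<open>(j, m)\<close>, the first index of \<open>2 ^ j\<close> times \<open>s (\<gamma> (m + j))\<close>.\<close>
  define h where "h = (\<lambda>\<gamma> z. LEAST i. scaled_tables ?A (pfst z) (c (\<gamma> (psnd z + pfst z))) (c i))"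
  have ex: "\<exists>i'. scaled_tables ?A j (c i) (c i')" for j i
  proof -
    have "s i \<in> range s" by simp
    then have "(2 ^ j) *\<^sub>R s i \<in> range s"
      unfolding range by (auto simp: locally_constant_def scaleR_bcontfun.rep_eq Rats_mult Rats_power)
    then show ?thesis unfolding scaled by (metis imageE)
  qed
  have h: "computable_fun h"
    unfolding h_def
    by (rule computable_fun_Least[OF _ ex])
      (intro computable computable_nat_fun_computable_fun[OF c(1)])
  have sh: "s (h \<gamma> (prod_encode (j, i))) = (2 ^ j) *\<^sub>R s (\<gamma> (i + j))" for \<gamma> j i
  proof -
    have "scaled_tables ?A j (c (\<gamma> (i + j))) (c (h \<gamma> (prod_encode (j, i))))"
      using LeastI_ex[OF ex[of j "\<gamma> (i + j)"]] by (simp add: h_def)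
    then show ?thesis by (simp only: scaled)
  qed
  have simulated: "oracle_for s ((2 ^ j) *\<^sub>R \<phi>) (\<lambda>i. h \<gamma> (prod_encode (j, i)))"
    if "oracle_for s \<phi> \<gamma>" for \<phi> \<gamma> j
    unfolding oracle_for_def
  proof
    fix i
    have "norm (s (h \<gamma> (prod_encode (j, i))) - (2 ^ j) *\<^sub>R \<phi>) = 2 ^ j * norm (s (\<gamma> (i + j)) - \<phi>)"
      unfolding sh scaleR_diff_right[symmetric] by simp
    also have "\<dots> < 2 ^ j * (1 / 2 ^ (i + j))"
      using that by (intro mult_strict_left_mono) (auto simp: oracle_for_def)
    also have "\<dots> = 1 / 2 ^ i" by (simp add: power_add)
    finally show "norm (s (h \<gamma> (prod_encode (j, i))) - (2 ^ j) *\<^sub>R \<phi>) < 1 / 2 ^ i" .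
  qed
  let ?R = "\<lambda>\<gamma> z m. otm_outputs M (\<lambda>i. h \<gamma> (prod_encode (pfst z, i))) (psnd z) m"
  \<comment> \<open>For precision \<open>n\<close> the exponent is \<open>j = n + k\<close>, and the machine for \<open>P\<close> gets input 0.\<close>
  have init: "computable_fun (\<lambda>\<gamma> n. prod_encode (n + k, 0))" by (intro computable)
  have out: "computable_fun (\<lambda>\<gamma> z. halve_code (pfst (pfst z)) (psnd z))"
    unfolding halve_code_def by (intro computable)
  have "computable_rel (\<lambda>\<gamma> n m. \<exists>y. y = prod_encode (n + k, 0) \<and>
      (\<exists>z. (\<exists>r. ?R \<gamma> y r \<and> z = prod_encode (y, r)) \<and> m = halve_code (pfst (pfst z)) (psnd z)))"
    by (rule computable_rel_relcomp[OF init[unfolded computable_fun_def] computable_rel_relcomp[OF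
        computable_rel_pair_input[OF computable_rel_otm_outputs[OF M(1) h]] out[unfolded computable_fun_def]]])
  then have "computable_rel (\<lambda>\<gamma> n m. \<exists>r. otm_outputs M (\<lambda>i. h \<gamma> (prod_encode (n + k, i))) 0 r \<and>
      m = halve_code (n + k) r)"
    by (rule computable_rel_mono) auto
  then obtain N where N: "turing_machine N" "\<And>\<gamma> n r.
      otm_outputs M (\<lambda>i. h \<gamma> (prod_encode (n + k, i))) 0 r \<Longrightarrow> otm_outputs N \<gamma> n (halve_code (n + k) r)"
    by (rule computable_rel_turing_machine) blast
  have "\<exists>m. otm_outputs N \<gamma> n m \<and> \<bar>rat_of_code m - g \<phi>\<bar> < 1 / 2 ^ n" if \<gamma>: "oracle_for s \<phi> \<gamma>" for \<phi> \<gamma> n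
  proof -
    let ?j = "n + k"
    obtain r where r: "otm_outputs M (\<lambda>i. h \<gamma> (prod_encode (?j, i))) 0 r"
      "\<bar>rat_of_code r - P ((2 ^ ?j) *\<^sub>R \<phi>)\<bar> < 1"
      using M(2)[OF simulated[OF \<gamma>, of ?j], of 0] by auto
    have "\<bar>rat_of_code r / 2 ^ ?j - P ((2 ^ ?j) *\<^sub>R \<phi>) / 2 ^ ?j\<bar> < 1 / 2 ^ ?j"
      using r(2) by (simp flip: diff_divide_distrib add: abs_divide divide_strict_right_mono)
    with lim[of ?j \<phi>] have "\<bar>rat_of_code r / 2 ^ ?j - g \<phi>\<bar> < (L + 1) / 2 ^ ?j"
      by (simp add: add_divide_distrib)
    also have "\<dots> \<le> 2 ^ k / 2 ^ ?j" using k by (intro divide_right_mono) auto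
    also have "\<dots> = 1 / 2 ^ n" by (simp add: power_add)
    finally show ?thesis using N(2)[OF r(1)] by (auto simp: rat_of_code_halve_code)
  qed
  with N(1) show ?thesis unfolding computable_functional_def by blast
qed

theorem theorem5p2:
  fixes F :: "nat \<Rightarrow> 'g::{group_add,countable} set"
    and X :: "('g \<Rightarrow> 'a::{finite,discrete_topology}) set"
    and e :: "nat \<Rightarrow> 'g"
    and a :: "'a \<Rightarrow> nat"
    and s :: "nat \<Rightarrow> (('g \<Rightarrow> 'a) \<Rightarrow>\<^sub>C real)"
  assumes "folner_sequence F"
    and "subshift X"
    and "bij e"
    and "bij_betw a UNIV {..<CARD('a)}"
    and "computable_enumeration e a s"
    and "computable_functional s (pressure F X)"
  shows "computable_functional s (ground_state_energy X)"
  using assms(3-6)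
  by (rule computable_functional_scaling_limit)
    (rule ground_state_energy_pressure[OF assms(1,2)], simp)

end
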